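(* Let $n\ge 0$ be an integer, let $u_0,\dots,u_n\in\mathcal{H}(\mathbb{D})$, $\vec u=\{u_k\}_{k=0}^n$, let $\tau$ be a holomorphic self-map of $\mathbb{D}$, let $0<q<\infty$, and let $\mu$ be a positive measure on $\mathbb{D}$ or on $\partial\mathbb{D}$. Let $\gamma=\gamma(X)$ be the parameter attached to the space $X$ as in the context, and for $0\le k\le n$ let $Q_k$ be the function $$Q_k(z)=\frac{|u_k(z)|}{(1-|\tau(z)|^2)^{k+\gamma}}.$$ (A) Suppose that $X=H^\infty$ or $X=A^{-\alpha}$ ($\alpha>0$). Then the following conditions are equivalent: (i) $S^{n}_{\vec{u},\tau}: X\to L^q(\mu)$ is order bounded. (ii) $\displaystyle\sum_{k=0}^{n}Q_k\in L^q(\mu)$. (iii) $Q_k\in L^q(\mu)$ for each $0\le k\le n$. (iv) $\displaystyle\sup_{a\in\mathbb{D}}|S^{n}_{\vec{u},\tau}(f_a(\sigma_a)^k)|\in L^q(\mu)$ for each $0\le k\le n$. (v) $\displaystyle\sup_{m\in\mathbb{N}}m^{\gamma}|S^{n}_{\vec{u},\tau}(p_m)|\in L^q(\mu)$, where $p_m(z)=z^m$, $z\in\mathbb{D}$. (B) If $X=A_\alpha^p$ ($0<p<\infty$, $\alpha>-1$) or $X=H^p$ ($0<p<\infty$), then conditions (i)–(iv) are equivalent.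
   Context: $\mathbb{D}$ is the open unit disk in $\mathbb{C}$ and $\mathcal{H}(\mathbb{D})$ is the space of holomorphic functions on $\mathbb{D}$. Spaces $X$: $H^\infty$ is the space of bounded holomorphic functions on $\mathbb{D}$ with the sup norm; $A^{-\alpha}$ ($\alpha>0$) is the space of $f\in\mathcal{H}(\mathbb{D})$ with norm $\sup_{z\in\mathbb{D}}(1-|z|^2)^\alpha|f(z)|<\infty$; $A_\alpha^p$ ($0<p<\infty$, $\alpha>-1$) is the weighted Bergman space of $f\in\mathcal{H}(\mathbb{D})$ with $\|f\|_{A_\alpha^p}^p=\int_{\mathbb{D}}|f(z)|^p\,dA_\alpha(z)<\infty$, where $dA_\alpha(z)=(\alpha+1)(1-|z|^2)^\alpha dA(z)$ and $A$ is normalized area measure on $\mathbb{D}$; $H^p$ ($0<p<\infty$) is the Hardy space of $f\in\mathcal{H}(\mathbb{D})$ with $\|f\|_{H^p}^p=\sup_{0<r<1}\int_{\partial\mathbb{D}}|f(r\zeta)|^p\,dm(\zeta)<\infty$, where $m$ is normalized Lebesgue measure on $\partial\mathbb{D}$. The parameter $\gamma$: $\gamma=0$ if $X=H^\infty$; $\gamma=\alpha$ if $X=A^{-\alpha}$; $\gamma=\frac{\alpha+2}{p}$ if $X=A_\alpha^p$; $\gamma=\frac1p$ if $X=H^p$. The operator: $S^{n}_{\vec{u},\tau}(f)(z)=\sum_{k=0}^{n}u_k(z)f^{(k)}(\tau(z))$ for $f\in\mathcal{H}(\mathbb{D})$, where $f^{(k)}$ is the $k$-th derivative. $B_X$ is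 the unit ball $\{f\in X:\|f\|_X\le1\}$. The operator $S: X\to L^q(\mu)$ is order bounded if there is a nonnegative $h\in L^q(\mu)$ such that $|Sf|\le h$ $\mu$-a.e. for every $f\in B_X$. When $\mu$ lives on $\partial\mathbb{D}$, the functions involved are understood on $\partial\mathbb{D}$ through their (radial) boundary values $\mu$-a.e. For $a\in\mathbb{D}$: $\sigma_a(z)=\frac{a-z}{1-\bar a z}$ and $f_a(z)=\left(\frac{1-|a|^2}{(1-\bar a z)^2}\right)^{\gamma}$, $z\in\mathbb{D}$; $(\sigma_a)^k$ is the $k$-th (pointwise) power. Suprema in (iv) and (v) are taken pointwise.
   Formalization: In (v) the supremum includes m=0 with weight 1 (else τ=0, n=0, u_0 not in L^q(μ) is a counterexample); for X=H^∞ and μ on the circle, each bounded f is assumed to have a radial boundary value at τ(ζ) for μ-a.e. ζ with u_0(ζ)≠0, so that S is defined. *)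

theory Defs
  imports "HOL-Analysis.Analysis"
begin

abbreviation disk :: "complex set" where "disk \<equiv> ball 0 1"

abbreviation circle :: "complex set" where "circle \<equiv> sphere 0 1"

text \<open>
  Functions on the disk are functions on \<^typ>\<open>complex\<close> whose values off the disk are never used.
  They are extended to the closed disk by radial limits, so that one formula serves for measures
  on the disk (where the extension changes nothing) and for measures on the circle.
\<close>

definition radial_limit :: "(complex \<Rightarrow> complex) \<Rightarrow> complex \<Rightarrow> complex \<Rightarrow> bool" where
  "radial_limit F z l \<longleftrightarrow> ((\<lambda>r. F (of_real r * z)) \<longlongrightarrow> l) (at_left (1::real))"

definition has_bv :: "(complex \<Rightarrow> complex) \<Rightarrow> complex \<Rightarrow> bool" where
  "has_bv F z \<longleftrightarrow> z \<in> disk \<or> (z \<in> circle \<and> (\<exists>l. radial_limit F z l))"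

definition bv :: "(complex \<Rightarrow> complex) \<Rightarrow> complex \<Rightarrow> complex" where
  "bv F z = (if z \<in> disk then F z else if has_bv F z then (THE l. radial_limit F z l) else 0)"

text \<open>
  Power of an extended nonnegative number with a positive real exponent.
\<close>

definition enn_powr :: "ennreal \<Rightarrow> real \<Rightarrow> ennreal" where
  "enn_powr x s = (if x = top then top else ennreal (enn2real x powr s))"

definition in_Lq :: "real \<Rightarrow> complex measure \<Rightarrow> (complex \<Rightarrow> ennreal) \<Rightarrow> bool" where
  "in_Lq q \<mu> F \<longleftrightarrow> F \<in> borel_measurable \<mu> \<and> (\<integral>\<^sup>+ z. enn_powr (F z) q \<partial>\<mu>) < \<infinity>"

datatype fspace =
    Hinf
  | Growth real         \<comment> \<open>\<open>Growth \<alpha>\<close> is \<open>A\<^sup>-\<^sup>\<alpha>\<close>\<close>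
  | Bergman real real   \<comment> \<open>\<open>Bergman p \<alpha>\<close> is the space with exponent \<open>p\<close> and weight \<open>\<alpha>\<close>\<close>
  | Hardy real

definition weighted_area :: "real \<Rightarrow> complex measure" where
  "weighted_area \<alpha> = density (uniform_measure lborel disk)
     (\<lambda>z. ennreal ((\<alpha> + 1) * (1 - (norm z)\<^sup>2) powr \<alpha>))"

fun space_norm :: "fspace \<Rightarrow> (complex \<Rightarrow> complex) \<Rightarrow> ennreal" where
  "space_norm Hinf f = (SUP z\<in>disk. ennreal (norm (f z)))"
| "space_norm (Growth \<alpha>) f = (SUP z\<in>disk. ennreal ((1 - (norm z)\<^sup>2) powr \<alpha> * norm (f z)))"
| "space_norm (Bergman p \<alpha>) f =
     enn_powr (\<integral>\<^sup>+ z. ennreal (norm (f z) powr p) \<partial>weighted_area \<alpha>) (1 / p)"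
| "space_norm (Hardy p) f =
     enn_powr (SUP r\<in>{0<..<1}. \<integral>\<^sup>+ t. ennreal (norm (f (of_real r * cis t)) powr p)
        \<partial>uniform_measure lborel {0..2 * pi}) (1 / p)"

fun gam :: "fspace \<Rightarrow> real" where
  "gam Hinf = 0"
| "gam (Growth \<alpha>) = \<alpha>"
| "gam (Bergman p \<alpha>) = (\<alpha> + 2) / p"
| "gam (Hardy p) = 1 / p"

definition carrier_of :: "fspace \<Rightarrow> (complex \<Rightarrow> complex) set" where
  "carrier_of X = {f. f holomorphic_on disk \<and> space_norm X f < \<infinity>}"

definition unit_ball :: "fspace \<Rightarrow> (complex \<Rightarrow> complex) set" where
  "unit_ball X = {f \<in> carrier_of X. space_norm X f \<le> 1}"

text \<open>
  On the circle the operator is evaluated by inserting the boundary values of \<open>u\<^sub>k\<close> and \<open>\<tau>\<close> into its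
  defining formula; where the boundary value of \<open>\<tau>\<close> is unimodular, the derivatives of \<open>f\<close> are
  again taken as radial boundary values. A term with \<open>u\<^sub>k(z) = 0\<close> contributes 0, and the
  formula is meaningful at \<open>z\<close> if the boundary values in the remaining terms exist.
\<close>

definition S_op ::
  "nat \<Rightarrow> (nat \<Rightarrow> complex \<Rightarrow> complex) \<Rightarrow> (complex \<Rightarrow> complex) \<Rightarrow> (complex \<Rightarrow> complex) \<Rightarrow> complex \<Rightarrow> complex"
  where "S_op n u \<tau> f z = (\<Sum>k\<le>n. bv (u k) z * bv ((deriv ^^ k) f) (bv \<tau> z))"

definition S_defined ::
  "nat \<Rightarrow> (nat \<Rightarrow> complex \<Rightarrow> complex) \<Rightarrow> (complex \<Rightarrow> complex) \<Rightarrow> (complex \<Rightarrow> complex) \<Rightarrow> complex \<Rightarrow> bool"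
  where "S_defined n u \<tau> f z \<longleftrightarrow>
     (\<forall>k\<le>n. bv (u k) z \<noteq> 0 \<longrightarrow> has_bv ((deriv ^^ k) f) (bv \<tau> z))"

lemma bv_disk: "z \<in> disk \<Longrightarrow> bv F z = F z"
  by (simp add: bv_def)

lemma S_op_disk:
  assumes "\<tau> ` disk \<subseteq> disk" and "z \<in> disk"
  shows "S_op n u \<tau> f z = (\<Sum>k\<le>n. u k z * (deriv ^^ k) f (\<tau> z))" and "S_defined n u \<tau> f z"
proof -
  have "\<tau> z \<in> disk"
    using assms by blast
  with assms(2) show "S_op n u \<tau> f z = (\<Sum>k\<le>n. u k z * (deriv ^^ k) f (\<tau> z))"
    and "S_defined n u \<tau> f z"
    by (simp_all only: S_op_def S_defined_def bv_disk has_bv_def simp_thms)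
qed

definition order_bounded ::
  "fspace \<Rightarrow> real \<Rightarrow> complex measure \<Rightarrow> nat \<Rightarrow> (nat \<Rightarrow> complex \<Rightarrow> complex) \<Rightarrow> (complex \<Rightarrow> complex) \<Rightarrow> bool"
  where "order_bounded X q \<mu> n u \<tau> \<longleftrightarrow>
     (\<exists>h :: complex \<Rightarrow> real. (\<forall>z. 0 \<le> h z) \<and> h \<in> borel_measurable \<mu> \<and> in_Lq q \<mu> (\<lambda>z. ennreal (h z)) \<and>
        (\<forall>f\<in>unit_ball X. AE z in \<mu>. S_defined n u \<tau> f z \<and> norm (S_op n u \<tau> f z) \<le> h z))"

text \<open>
  The denominator can vanish only on the circle. There \<open>0\<^sup>0 = 1\<close> (unlike \<^const>\<open>powr\<close> on the reals),
  and division of \<^typ>\<open>ennreal\<close> gives \<open>c / 0 = \<infinity>\<close> for \<open>c \<noteq> 0\<close> and \<open>0 / 0 = 0\<close>.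
\<close>

definition Q_fun ::
  "real \<Rightarrow> (nat \<Rightarrow> complex \<Rightarrow> complex) \<Rightarrow> (complex \<Rightarrow> complex) \<Rightarrow> nat \<Rightarrow> complex \<Rightarrow> ennreal"
  where "Q_fun \<gamma> u \<tau> k z = ennreal (norm (bv (u k) z)) /
     (if real k + \<gamma> = 0 then 1 else ennreal ((1 - (norm (bv \<tau> z))\<^sup>2) powr (real k + \<gamma>)))"

definition sigma :: "complex \<Rightarrow> complex \<Rightarrow> complex" where
  "sigma a z = (a - z) / (1 - cnj a * z)"

text \<open>
  For \<open>|a|, |z| < 1\<close> the base below has argument in \<open>(-\<pi>, \<pi>)\<close>, so the principal power is holomorphic
  in \<open>z\<close>.
\<close>

definition test_fun :: "real \<Rightarrow> complex \<Rightarrow> complex \<Rightarrow> complex" where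
  "test_fun \<gamma> a z = (of_real (1 - (norm a)\<^sup>2) / (1 - cnj a * z)\<^sup>2) powr of_real \<gamma>"

definition test_sup ::
  "real \<Rightarrow> nat \<Rightarrow> (nat \<Rightarrow> complex \<Rightarrow> complex) \<Rightarrow> (complex \<Rightarrow> complex) \<Rightarrow> nat \<Rightarrow> complex \<Rightarrow> ennreal"
  where "test_sup \<gamma> n u \<tau> k z =
     (SUP a\<in>disk. ennreal (norm (S_op n u \<tau> (\<lambda>w. test_fun \<gamma> a w * sigma a w ^ k) z)))"

text \<open>
  The index \<open>m = 0\<close> is included, with weight 1. Without the constant monomial, \<open>u\<^sub>0\<close> would be
  invisible wherever \<open>\<tau>\<close> vanishes.
\<close>

definition monomial_sup ::
  "real \<Rightarrow> nat \<Rightarrow> (nat \<Rightarrow> complex \<Rightarrow> complex) \<Rightarrow> (complex \<Rightarrow> complex) \<Rightarrow> complex \<Rightarrow> ennreal"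
  where "monomial_sup \<gamma> n u \<tau> z =
     (SUP m::nat. ennreal ((if m = 0 then 1 else real m powr \<gamma>) * norm (S_op n u \<tau> (\<lambda>w. w ^ m) z)))"

end

theory Submission
  imports Defs "HOL-Complex_Analysis.Complex_Analysis"
begin

text \<open>
  Everything is pointwise in \<open>z\<close>: put \<open>w = \<tau>(z)\<close> (a point of the closed disk) and \<open>c\<^sub>k = u\<^sub>k(z)\<close>. All functions
  of the unit ball of \<open>X\<close>, and up to a constant also \<open>f\<^sub>a (\<sigma>\<^sub>a)\<^sup>k\<close> and \<open>m\<^sup>\<gamma> z\<^sup>m\<close>, are \<open>O((1 - |z|\<^sup>2)\<^bsup>-\<gamma>\<^esup>)\<close>; by
  Cauchy's estimates their images under the operator are dominated by \<open>\<Sum> Q\<^sub>k\<close>. Conversely, the functions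
  \<open>f\<^sub>a (\<sigma>\<^sub>a - \<sigma>\<^sub>a(w))\<^sup>i\<close> with \<open>a = r w\<close>, and \<open>z\<^sup>m (z\<^sup>m - w\<^sup>m)\<^sup>i\<close> with \<open>m\<close> of the order of \<open>1 / (1 - |w|)\<close>, are bounded
  combinations of the given test functions and vanish to order exactly \<open>i\<close> at \<open>w\<close>. This gives a triangular
  system from which the \<open>c\<^sub>k\<close> are bounded by backward induction. Where \<open>|w| = 1\<close>, letting \<open>r\<close> tend to 1
  (or \<open>m\<close> to infinity) forces \<open>c\<^sub>k = 0\<close> unless \<open>k + \<gamma> = 0\<close>. Order boundedness controls the supremum over
  \<open>a\<close> because a countable dense set of \<open>a\<close> suffices.
\<close>

subsection \<open>Rotations and circle means\<close>

text \<open>The exponent \<gamma> has two jobs: (1 - |z|^2)^(-\<gamma>) bounds point evaluations on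
  the unit ball of X, and all f_a (\<sigma>_a)^k lie in a fixed multiple of that ball. For Bergman
  and Hardy spaces both facts need integral estimates, and p may be less than 1. The choice a = r w
  makes \<open>1 - cnj a * w\<close> the positive number \<delta> = 1 - r |w|^2. All k-th
  derivatives at w are then O(\<delta>^(-k-\<gamma>)), while the diagonal entries of the triangular
  system are at least \<delta>^(-k-\<gamma>). Rescaling removes \<delta>, so the constants depend on
  n and \<gamma> alone; their independence of z is what carries the pointwise comparison over to
  L^q(\<mu>). For \<mu> on the circle, the boundary value of \<tau> may be unimodular, and
  derivatives of a general f need not have limits there. Test functions and monomials continue
  across the circle and are simply evaluated; for general f, finiteness of \<Sum> Q_k removes the
  doubtful terms, except k = 0 for bounded functions.\<close>

lemma nn_integral_complex_iterated:
  fixes F :: "complex \<Rightarrow> ennreal"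
  assumes [measurable]: "F \<in> borel_measurable borel"
  shows "(\<integral>\<^sup>+ z. F z \<partial>lborel) = (\<integral>\<^sup>+ x. \<integral>\<^sup>+ y. F (Complex x y) \<partial>lborel \<partial>lborel)"
proof -
  interpret product_sigma_finite "\<lambda>_::complex. lborel :: real measure" ..
  have B: "(Basis :: complex set) = {\<i>, 1}"
    by (auto simp: Basis_complex_def)
  have [measurable]: "(\<lambda>f. \<Sum>b\<in>Basis. f b *\<^sub>R b) \<in> measurable (\<Pi>\<^sub>M b\<in>Basis. lborel) (borel :: complex measure)"
    by measurable
  have "(\<integral>\<^sup>+ z. F z \<partial>lborel) = (\<integral>\<^sup>+ f. F (\<Sum>b\<in>Basis. f b *\<^sub>R b) \<partial>(\<Pi>\<^sub>M b\<in>Basis. lborel))"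
    by (subst lborel_eq) (simp add: nn_integral_distr)
  also have "\<dots> = (\<integral>\<^sup>+ f. \<integral>\<^sup>+ y. F (\<Sum>b\<in>Basis. (f(\<i> := y)) b *\<^sub>R b) \<partial>lborel \<partial>(\<Pi>\<^sub>M b\<in>{1::complex}. lborel))"
    unfolding B
    by (subst product_nn_integral_insert) (auto simp flip: B)
  also have "\<dots> = (\<integral>\<^sup>+ f. \<integral>\<^sup>+ y. F (Complex (f 1) y) \<partial>lborel \<partial>(\<Pi>\<^sub>M b\<in>{1::complex}. lborel))"
    unfolding B by (intro nn_integral_cong arg_cong[of _ _ F]) (auto simp: complex_eq_iff)
  also have "\<dots> = (\<integral>\<^sup>+ x. \<integral>\<^sup>+ y. F (Complex x y) \<partial>lborel \<partial>lborel)"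
  proof (rule product_nn_integral_singleton)
    have [measurable]: "(\<lambda>(x,y). Complex x y) \<in> borel_measurable (borel \<Otimes>\<^sub>M borel)"
      unfolding Complex_eq by measurable
    have "(\<lambda>(x,y). F (Complex x y)) \<in> borel_measurable (lborel \<Otimes>\<^sub>M lborel)"
      unfolding case_prod_beta by measurable
    then show "(\<lambda>x. \<integral>\<^sup>+ y. F (Complex x y) \<partial>lborel) \<in> borel_measurable lborel"
      by measurable
  qed
  finally show ?thesis .
qed

lemma measurable_Complex [measurable (raw)]:
  assumes "f \<in> borel_measurable M" "g \<in> borel_measurable M"
  shows "(\<lambda>x. Complex (f x) (g x)) \<in> borel_measurable M"
  using assms unfolding Complex_eq by measurable

text \<open>Shearing first in one coordinate and then in the other gives the rotation.\<close>

lemma nn_integral_rotate: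
  fixes F :: "complex \<Rightarrow> ennreal"
  assumes [measurable]: "F \<in> borel_measurable borel" and c: "cos t \<noteq> 0"
  shows "(\<integral>\<^sup>+ z. F (cis t * z) \<partial>lborel) = (\<integral>\<^sup>+ z. F z \<partial>lborel)"
proof -
  define c s where "c = cos t" and "s = sin t"
  have cs: "c * c + s * s = 1" "c \<noteq> 0"
    using c by (auto simp: c_def s_def simp flip: power2_eq_square)
  have "(\<integral>\<^sup>+ z. F (cis t * z) \<partial>lborel) =
        (\<integral>\<^sup>+ x. \<integral>\<^sup>+ y. F (Complex (c * x - s * y) (s * x + c * y)) \<partial>lborel \<partial>lborel)"
    by (subst nn_integral_complex_iterated)
       (auto intro!: nn_integral_cong arg_cong[of _ _ F] simp: c_def s_def complex_eq_iff)
  \<comment> \<open>For fixed x substitute v = s x + c y; since c^2 + s^2 = 1, the first coordinate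
    becomes (x - s v) / c. Division by c is the reason for assuming cos t \<noteq> 0.\<close>
  also have "\<dots> = (\<integral>\<^sup>+ x. \<bar>1 / c\<bar> * (\<integral>\<^sup>+ v. F (Complex ((x - s * v) / c) v) \<partial>lborel) \<partial>lborel)"
  proof (intro nn_integral_cong)
    fix x
    have e: "c * x - s * (- (s * x) / c + 1 / c * v) = (x - s * v) / c"
      "s * x + c * (- (s * x) / c + 1 / c * v) = v" for v
    proof -
      have "c * x - s * (- (s * x) / c + 1 / c * v) = ((c * c + s * s) * x - s * v) / c"
        using \<open>c \<noteq> 0\<close> by (simp add: field_simps)
      then show "c * x - s * (- (s * x) / c + 1 / c * v) = (x - s * v) / c"
        by (simp only: cs(1) mult_1)
      show "s * x + c * (- (s * x) / c + 1 / c * v) = v"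
        using \<open>c \<noteq> 0\<close> by (simp add: field_simps)
    qed
    have "(\<integral>\<^sup>+ y. F (Complex (c * x - s * y) (s * x + c * y)) \<partial>lborel) =
        \<bar>1 / c\<bar> * (\<integral>\<^sup>+ v. F (Complex (c * x - s * (- (s * x) / c + 1 / c * v)) (s * x + c * (- (s * x) / c + 1 / c * v))) \<partial>lborel)"
      using cs by (intro nn_integral_real_affine) auto
    then show "(\<integral>\<^sup>+ y. F (Complex (c * x - s * y) (s * x + c * y)) \<partial>lborel) =
        \<bar>1 / c\<bar> * (\<integral>\<^sup>+ v. F (Complex ((x - s * v) / c) v) \<partial>lborel)"
      unfolding e .
  qed
  also have "\<dots> = \<bar>1 / c\<bar> * (\<integral>\<^sup>+ x. \<integral>\<^sup>+ v. F (Complex ((x - s * v) / c) v) \<partial>lborel \<partial>lborel)"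
    by (rule nn_integral_cmult) measurable
  also have "\<dots> = \<bar>1 / c\<bar> * (\<integral>\<^sup>+ v. \<integral>\<^sup>+ x. F (Complex ((x - s * v) / c) v) \<partial>lborel \<partial>lborel)"
    by (subst lborel_pair.Fubini') auto
  \<comment> \<open>With v now fixed, the substitution x = s v + c x' removes the quotient, and its
    Jacobian |c| cancels the earlier 1 / |c|.\<close>
  also have "\<dots> = \<bar>1 / c\<bar> * (\<integral>\<^sup>+ v. \<bar>c\<bar> * (\<integral>\<^sup>+ x. F (Complex x v) \<partial>lborel) \<partial>lborel)"
  proof -
    have "(\<integral>\<^sup>+ x. F (Complex ((x - s * v) / c) v) \<partial>lborel) = \<bar>c\<bar> * (\<integral>\<^sup>+ x. F (Complex ((s * v + c * x - s * v) / c) v) \<partial>lborel)" for v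
      using cs by (intro nn_integral_real_affine) auto
    then show ?thesis
      using cs by simp
  qed
  also have "\<dots> = \<bar>1 / c\<bar> * (\<bar>c\<bar> * (\<integral>\<^sup>+ v. \<integral>\<^sup>+ x. F (Complex x v) \<partial>lborel \<partial>lborel))"
    by (subst nn_integral_cmult) auto
  also have "\<dots> = (\<integral>\<^sup>+ v. \<integral>\<^sup>+ x. F (Complex x v) \<partial>lborel \<partial>lborel)"
    using cs by (simp add: mult.assoc[symmetric] ennreal_mult[symmetric])
  also have "\<dots> = (\<integral>\<^sup>+ x. \<integral>\<^sup>+ v. F (Complex x v) \<partial>lborel \<partial>lborel)"
    by (subst lborel_pair.Fubini') auto
  finally show ?thesis
    by (subst (2) nn_integral_complex_iterated) auto
qed

abbreviation circle_mean :: "(real \<Rightarrow> ennreal) \<Rightarrow> ennreal" where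
  "circle_mean g \<equiv> (\<integral>\<^sup>+ t. g t \<partial>uniform_measure lborel {0..2 * pi})"

lemma emeasure_circle_measure: "emeasure (uniform_measure lborel {0..2 * pi}) UNIV = 1"
  by (subst emeasure_uniform_measure) (auto simp: ennreal_divide_self)

lemma finite_measure_circle: "finite_measure (uniform_measure lborel {0..2 * pi})"
  by (rule finite_measureI) (simp add: emeasure_circle_measure)

lemma circle_mean_const: "circle_mean (\<lambda>_. c) = c"
  by (simp add: emeasure_circle_measure)

text \<open>Discards the angles that \<open>nn_integral_rotate\<close> excludes: they are countably
  many, hence null in the average over t.\<close>

lemma AE_cos_nonzero: "AE t in lborel. cos t \<noteq> (0::real)"
proof -
  have "{t::real. cos t = 0} \<subseteq> range (\<lambda>i::int. of_int i * (pi / 2))"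
    by (auto simp: cos_zero_iff_int)
  then have "countable {t::real. cos t = 0}"
    by (rule countable_subset) simp
  then have "{t::real. cos t = 0} \<in> null_sets lborel"
    by (rule countable_imp_null_set_lborel)
  then show ?thesis
    by (rule AE_I') auto
qed

text \<open>Substitute for polar coordinates: rotations preserve the area integral, so by Fubini a
  circle mean can be inserted under it for free.\<close>

lemma nn_integral_rotation_mean:
  fixes F :: "complex \<Rightarrow> ennreal"
  assumes [measurable]: "F \<in> borel_measurable borel"
  shows "(\<integral>\<^sup>+ z. circle_mean (\<lambda>t. F (cis t * z)) \<partial>lborel) = (\<integral>\<^sup>+ z. F z \<partial>lborel)"
proof -
  interpret U: finite_measure "uniform_measure lborel {0..2 * pi}"
    by (rule finite_measure_circle)
  interpret P: pair_sigma_finite "lborel :: complex measure" "uniform_measure lborel {0..2 * pi}" ..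
  have [measurable]: "cis \<in> borel_measurable borel"
    by (intro borel_measurable_continuous_onI continuous_intros)
  have "(\<integral>\<^sup>+ z. circle_mean (\<lambda>t. F (cis t * z)) \<partial>lborel) =
        circle_mean (\<lambda>t. \<integral>\<^sup>+ z. F (cis t * z) \<partial>lborel)"
    by (rule P.Fubini'[symmetric]) measurable
  also have "\<dots> = circle_mean (\<lambda>t. \<integral>\<^sup>+ z. F z \<partial>lborel)"
  proof (rule nn_integral_cong_AE)
    have "AE t in uniform_measure lborel {0..2 * pi}. cos t \<noteq> 0"
      by (rule AE_uniform_measureI) (use AE_cos_nonzero in auto)
    then show "AE t in uniform_measure lborel {0..2 * pi}.
        (\<integral>\<^sup>+ z. F (cis t * z) \<partial>lborel) = (\<integral>\<^sup>+ z. F z \<partial>lborel)"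
      by eventually_elim (simp add: nn_integral_rotate)
  qed
  finally show ?thesis
    by (simp add: circle_mean_const)
qed

lemma circle_mean_eq_integral:
  fixes g :: "real \<Rightarrow> real"
  assumes g: "continuous_on UNIV g" and nn: "\<And>t. 0 \<le> g t"
  shows "circle_mean (\<lambda>t. ennreal (g t)) = ennreal (integral {0..2 * pi} g / (2 * pi))"
proof -
  have [measurable]: "g \<in> borel_measurable borel"
    using g by (rule borel_measurable_continuous_onI)
  have "(g has_integral integral {0..2 * pi} g) {0..2 * pi}"
    by (intro integrable_integral integrable_continuous_interval continuous_on_subset[OF g]) auto
  then have *: "(\<integral>\<^sup>+ t. indicator {0..2 * pi} t * g t \<partial>lborel) = ennreal (integral {0..2 * pi} g)"
    using nn by (intro nn_integral_has_integral_lebesgue) auto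
  have "circle_mean (\<lambda>t. ennreal (g t)) = (\<integral>\<^sup>+ t. ennreal (g t) * indicator {0..2 * pi} t \<partial>lborel) / emeasure lborel {0..2*pi}"
    by (rule nn_integral_uniform_measure) auto
  also have "(\<integral>\<^sup>+ t. ennreal (g t) * indicator {0..2 * pi} t \<partial>lborel) = ennreal (integral {0..2 * pi} g)"
    unfolding *[symmetric] by (intro nn_integral_cong) (simp split: split_indicator)
  finally show ?thesis
    by (simp add: divide_ennreal integral_nonneg[OF integrable_continuous_interval] continuous_on_subset[OF g] nn)
qed

lemma Cauchy_has_integral_circle:
  fixes f :: "complex \<Rightarrow> complex"
  assumes "continuous_on (cball z r) f" "f holomorphic_on ball z r" "w \<in> ball z r"
  shows "((\<lambda>t. f (z + r * cis t) / (z + r * cis t - w) * (r * cis t)) has_integral 2 * pi * f w) {0..2 * pi}"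
proof -
  have "((\<lambda>u. f u / (u - w)) has_contour_integral 2 * of_real pi * \<i> * f w) (part_circlepath z r 0 (2 * pi))"
    using Cauchy_integral_circlepath[of z r f w] assms
    unfolding circlepath_def by (auto simp: dist_norm norm_minus_commute)
  then have "((\<lambda>t. f (z + r * cis t) / (z + r * cis t - w) * r * \<i> * cis t) has_integral 2 * of_real pi * \<i> * f w) {0..2 * pi}"
    by (subst (asm) has_contour_integral_part_circlepath_iff) auto
  from has_integral_mult_right[OF this, of "-\<i>"] show ?thesis
    by (simp add: mult_ac)
qed

text \<open>On the circle the distance to w is at least r - |z - w|, which bounds the Cauchy kernel.
  At w = z this is the sub-mean value property of |f|; an off-centre point loses only the displayed
  factor.\<close>

lemma circle_mean_ge:
  fixes f :: "complex \<Rightarrow> complex"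
  assumes f: "continuous_on (cball z r) f" "f holomorphic_on ball z r" and w: "w \<in> ball z r"
  shows "ennreal (norm (f w) * ((r - dist z w) / r)) \<le> circle_mean (\<lambda>t. ennreal (norm (f (z + r * cis t))))"
proof -
  define d where "d = r - dist z w"
  have r: "r > 0" and d: "d > 0"
    using w zero_le_dist[of z w] unfolding d_def mem_ball by linarith+
  have cont: "continuous_on UNIV (\<lambda>t. f (z + r * cis t))"
    using r by (intro continuous_on_compose2[OF f(1)] continuous_intros) (auto simp: dist_norm norm_mult)
  have far: "d \<le> norm (z + r * cis t - w)" for t
  proof -
    have "norm (of_real r * cis t) \<le> norm (z + r * cis t - w) + norm (w - z)"
      by (metis add_diff_eq diff_add_cancel norm_triangle_ineq add.commute diff_diff_eq2)
    then show ?thesis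
      using r by (simp add: d_def norm_mult dist_norm norm_minus_commute)
  qed
  have le: "norm (2 * pi * f w) \<le> integral {0..2 * pi} (\<lambda>t. norm (f (z + r * cis t)) * (r / d))"
  proof -
    have "norm (integral {0..2 * pi} (\<lambda>t. f (z + r * cis t) / (z + r * cis t - w) * (r * cis t)))
        \<le> integral {0..2 * pi} (\<lambda>t. norm (f (z + r * cis t)) * (r / d))"
    proof (rule integral_norm_bound_integral)
      show "(\<lambda>t. f (z + r * cis t) / (z + r * cis t - w) * (r * cis t)) integrable_on {0..2 * pi}"
        using Cauchy_has_integral_circle[OF f w] by blast
      show "(\<lambda>t. norm (f (z + r * cis t)) * (r / d)) integrable_on {0..2 * pi}"
        by (intro integrable_continuous_interval continuous_intros continuous_on_subset[OF cont]) auto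
      show "norm (f (z + r * cis t) / (z + r * cis t - w) * (r * cis t)) \<le> norm (f (z + r * cis t)) * (r / d)" for t
        using r d far[of t] by (auto simp: norm_mult norm_divide intro!: divide_left_mono mult_nonneg_nonneg mult_pos_pos)
    qed
    then show ?thesis
      using integral_unique[OF Cauchy_has_integral_circle[OF f w]] by simp
  qed
  also have "\<dots> = integral {0..2 * pi} (\<lambda>t. norm (f (z + r * cis t))) * (r / d)"
    by (rule integral_mult_left)
  finally have "norm (f w) * (d / r) \<le> integral {0..2 * pi} (\<lambda>t. norm (f (z + r * cis t))) / (2 * pi)"
    using r d by (simp add: field_simps norm_mult)
  then show ?thesis
    unfolding d_def
    by (subst circle_mean_eq_integral) (auto intro!: ennreal_leI continuous_intros cont)
qed

subsection \<open>Point evaluations on Bergman and Hardy spaces\<close>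

text \<open>
  This replaces the subharmonicity of \<open>|f|\<^sup>p\<close> for \<open>p \<le> 1\<close>: writing \<open>|f| = |f|\<^bsup>1-p\<^esup> |f|\<^sup>p\<close> in a mean value
  inequality bounds a weighted supremum \<open>N\<close> by \<open>c N\<^bsup>1-p\<^esup>\<close>, and \<open>N\<close> can be absorbed since it is finite.
\<close>

lemma absorb_sup:
  fixes g :: "'a \<Rightarrow> real"
  assumes bdd: "bdd_above (g ` A)" and nn: "\<And>x. x \<in> A \<Longrightarrow> 0 \<le> g x" and p: "0 < p" and c: "0 \<le> c"
    and le: "\<And>x. x \<in> A \<Longrightarrow> g x \<le> c * (SUP y\<in>A. g y) powr (1 - p)" and x: "x \<in> A"
  shows "g x powr p \<le> c"
proof -
  define N where "N = (SUP y\<in>A. g y)"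
  have gN: "g y \<le> N" if "y \<in> A" for y
    unfolding N_def using that bdd by (rule cSUP_upper)
  have N: "N \<le> c * N powr (1 - p)"
    unfolding N_def by (rule cSUP_least) (use x le in auto)
  show ?thesis
  proof (cases "N > 0")
    case True
    have "N powr p * N powr (1 - p) \<le> c * N powr (1 - p)"
      using N True by (simp flip: powr_add)
    then have "N powr p \<le> c"
      using True by simp
    moreover have "g x powr p \<le> N powr p"
      using nn[OF x] gN[OF x] p by (intro powr_mono2) auto
    ultimately show ?thesis by simp
  next
    case False
    then have "g x = 0"
      using nn[OF x] gN[OF x] by linarith
    then show ?thesis
      using c p by simp
  qed
qed

text \<open>The splitting x = x^(1-p) x^p for the absorption argument, with M in the first factor; p
  \<le> 1 makes that factor monotone.\<close>

lemma powr_split: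
  fixes x M p :: real
  assumes "0 \<le> x" "x \<le> M" "p \<le> 1"
  shows "x \<le> M powr (1 - p) * x powr p"
proof (cases "x = 0")
  case False
  then have "x = x powr (1 - p) * x powr p"
    using assms by (simp flip: powr_add)
  also have "\<dots> \<le> M powr (1 - p) * x powr p"
    using assms False by (intro mult_right_mono powr_mono2) auto
  finally show ?thesis .
qed simp

text \<open>For each \<zeta> of modulus below r, the mean value inequality for u \<mapsto> f (z +
  \<zeta> u) compares |f z| with the mean of |f| over the circle through z + \<zeta>. Integration
  over \<zeta> then absorbs the angular mean by \<open>nn_integral_rotation_mean\<close>.\<close>

lemma area_mean_ge:
  fixes f :: "complex \<Rightarrow> complex"
  assumes f: "f holomorphic_on ball z r" and r: "0 < r"
  shows "ennreal (norm (f z) * (pi * r\<^sup>2)) \<le> (\<integral>\<^sup>+ \<zeta>. ennreal (norm (f \<zeta>)) * indicator (ball z r) \<zeta> \<partial>lborel)"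
proof -
  define F where "F = (\<lambda>\<zeta>. ennreal (indicator (ball z r) \<zeta> *\<^sub>R norm (f \<zeta>)))"
  have F [measurable]: "F \<in> borel_measurable borel"
    unfolding F_def using f
    by (intro measurable_compose[OF borel_measurable_continuous_on_indicator measurable_ennreal]
        continuous_intros holomorphic_on_imp_continuous_on) auto
  have "ennreal (norm (f z) * (pi * r\<^sup>2)) = (\<integral>\<^sup>+ \<zeta>. ennreal (norm (f z)) * indicator (ball 0 r) \<zeta> \<partial>(lborel :: complex measure))"
    using r by (subst nn_integral_cmult_indicator) (auto simp: emeasure_ball unit_ball_vol_2 ennreal_mult)
  also have "\<dots> \<le> (\<integral>\<^sup>+ \<zeta>. circle_mean (\<lambda>t. F (z + cis t * \<zeta>)) \<partial>lborel)"
  proof (intro nn_integral_mono)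
    fix \<zeta> :: complex
    show "ennreal (norm (f z)) * indicator (ball 0 r) \<zeta> \<le> circle_mean (\<lambda>t. F (z + cis t * \<zeta>))"
    proof (cases "\<zeta> \<in> ball 0 r")
      case True
      have sub: "z + \<zeta> * u \<in> ball z r" if "norm u \<le> 1" for u
      proof -
        have "norm \<zeta> * norm u \<le> norm \<zeta> * 1"
          using that by (intro mult_left_mono) auto
        then show ?thesis
          using True by (simp add: dist_norm norm_mult)
      qed
      have hol: "(\<lambda>u. f (z + \<zeta> * u)) holomorphic_on cball 0 1"
        by (rule holomorphic_on_compose_gen[OF _ f, unfolded o_def])
          (use sub in \<open>auto intro!: holomorphic_intros\<close>)
      have "ennreal (norm (f (z + \<zeta> * 0)) * ((1 - dist (0::complex) 0) / 1))
          \<le> circle_mean (\<lambda>t. ennreal (norm (f (z + \<zeta> * (0 + of_real 1 * cis t)))))"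
        by (rule circle_mean_ge)
          (use hol in \<open>auto intro: holomorphic_on_imp_continuous_on holomorphic_on_subset\<close>)
      also have "\<dots> = circle_mean (\<lambda>t. F (z + cis t * \<zeta>))"
      proof (intro nn_integral_cong)
        fix t
        show "ennreal (norm (f (z + \<zeta> * (0 + of_real 1 * cis t)))) = F (z + cis t * \<zeta>)"
          using sub[of "cis t"] by (simp add: F_def mult.commute[of "cis t"] del: mem_ball)
      qed
      finally show ?thesis
        using True by simp
    qed simp
  qed
  also have "\<dots> = (\<integral>\<^sup>+ \<zeta>. F (z + \<zeta>) \<partial>lborel)"
    by (rule nn_integral_rotation_mean[where F = "\<lambda>\<zeta>. F (z + \<zeta>)"]) measurable
  also have "\<dots> = (\<integral>\<^sup>+ \<zeta>. F \<zeta> \<partial>distr lborel borel ((+) z))"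
    by (subst nn_integral_distr) auto
  also have "distr lborel borel ((+) z) = lborel"
    by (rule lborel_distr_plus)
  also have "(\<integral>\<^sup>+ \<zeta>. F \<zeta> \<partial>lborel) = (\<integral>\<^sup>+ \<zeta>. ennreal (norm (f \<zeta>)) * indicator (ball z r) \<zeta> \<partial>lborel)"
    by (intro nn_integral_cong) (simp add: F_def split: split_indicator)
  finally show ?thesis .
qed

text \<open>Absorption with the weight (R - |z - w|)^(2/p): it vanishes on the boundary of the ball,
  so every z has a disk on which it is controlled, and its p-th power at w is R^2. Holomorphy on the
  closed ball makes the weighted supremum finite.\<close>

lemma area_powr_mean_aux:
  fixes f :: "complex \<Rightarrow> complex"
  assumes f: "f holomorphic_on cball w R" and R: "0 < R" and p: "0 < p" "p \<le> 1"
    and I: "(\<integral>\<^sup>+ z. ennreal (norm (f z) powr p) * indicator (ball w R) z \<partial>lborel) \<le> ennreal K" and K: "0 \<le> K"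
  shows "norm (f w) powr p * R\<^sup>2 \<le> 2 powr (2 / p) / pi * K"
proof -
  define g where "g = (\<lambda>z. (R - dist w z) powr (2 / p) * norm (f z))"
  define N where "N = (SUP z\<in>ball w R. g z)"
  have contf: "continuous_on (cball w R) f"
    using f by (rule holomorphic_on_imp_continuous_on)
  have bdd: "bdd_above (g ` ball w R)"
  proof -
    have "compact (f ` cball w R)"
      using contf by (intro compact_continuous_image) auto
    then obtain B where B: "\<And>z. z \<in> cball w R \<Longrightarrow> norm (f z) \<le> B"
      by (meson compact_imp_bounded bounded_iff imageI)
    have "g z \<le> R powr (2 / p) * B" if "z \<in> ball w R" for z
      unfolding g_def using that B[of z] p R by (intro mult_mono powr_mono2) auto
    then show ?thesis by (auto intro!: bdd_aboveI)
  qed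
  have N: "g z \<le> N" if "z \<in> ball w R" for z
    unfolding N_def using that bdd by (rule cSUP_upper)
  have "g w powr p \<le> 2 powr (2 / p) / pi * K"
  proof (rule absorb_sup[OF bdd])
    show "g z \<le> 2 powr (2 / p) / pi * K * (SUP z\<in>ball w R. g z) powr (1 - p)" if z: "z \<in> ball w R" for z
    proof -
      \<comment> \<open>Half the distance to the boundary: every point of \<open>ball z r\<close>
        still has distance at least r to it, while g z loses only the factor
        \<open>2 powr (2 / p)\<close>.\<close>
      define r where "r = (R - dist w z) / 2"
      have r: "0 < r" using z by (simp add: r_def)
      have far: "r \<le> R - dist w \<zeta>" if "\<zeta> \<in> ball z r" for \<zeta>
        using that dist_triangle[of w \<zeta> z] by (simp add: r_def)
      have sub: "ball z r \<subseteq> ball w R"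
        using far r by force
      have N0: "0 \<le> N" using N[OF z] r by (smt (verit) g_def mult_nonneg_nonneg norm_ge_zero powr_ge_zero)
      have le: "norm (f \<zeta>) \<le> N powr (1 - p) * r powr (2 - 2 / p) * norm (f \<zeta>) powr p" if \<zeta>: "\<zeta> \<in> ball z r" for \<zeta>
      proof -
        have "r powr (2 / p) * norm (f \<zeta>) \<le> g \<zeta>"
          unfolding g_def using far[OF \<zeta>] r p by (intro mult_right_mono powr_mono2) auto
        also have "\<dots> \<le> N" using N \<zeta> sub by blast
        finally have "norm (f \<zeta>) \<le> N * r powr (- (2 / p))"
          using r by (simp add: powr_minus field_simps)
        then have "norm (f \<zeta>) \<le> (N * r powr (- (2 / p))) powr (1 - p) * norm (f \<zeta>) powr p"
          using p by (intro powr_split) auto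
        also have "(N * r powr (- (2 / p))) powr (1 - p) = N powr (1 - p) * r powr (2 - 2 / p)"
        proof -
          have "- (2 / p) * (1 - p) = 2 - 2 / p"
            using p by (simp add: field_simps)
          then show ?thesis
            using N0 r by (simp only: powr_mult powr_powr)
        qed
        finally show ?thesis .
      qed
      have "ennreal (norm (f z) * (pi * r\<^sup>2)) \<le> (\<integral>\<^sup>+ \<zeta>. ennreal (norm (f \<zeta>)) * indicator (ball z r) \<zeta> \<partial>lborel)"
        by (rule area_mean_ge) (use f sub r ball_subset_cball in \<open>blast intro: holomorphic_on_subset\<close>)+
      also have "\<dots> \<le> (\<integral>\<^sup>+ \<zeta>. ennreal (N powr (1 - p) * r powr (2 - 2 / p)) *
            (ennreal (norm (f \<zeta>) powr p) * indicator (ball w R) \<zeta>) \<partial>lborel)"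
        using le sub by (intro nn_integral_mono) (auto split: split_indicator simp flip: ennreal_mult intro!: ennreal_leI)
      also have "\<dots> = ennreal (N powr (1 - p) * r powr (2 - 2 / p)) *
           (\<integral>\<^sup>+ \<zeta>. ennreal (norm (f \<zeta>) powr p) * indicator (ball w R) \<zeta> \<partial>lborel)"
      proof (rule nn_integral_cmult)
        have eq: "ennreal (indicator (ball w R) \<zeta> *\<^sub>R norm (f \<zeta>) powr p) = ennreal (norm (f \<zeta>) powr p) * indicator (ball w R) \<zeta>" for \<zeta>
          by (auto split: split_indicator)
        have "(\<lambda>\<zeta>. ennreal (indicator (ball w R) \<zeta> *\<^sub>R norm (f \<zeta>) powr p)) \<in> borel_measurable borel"
          using p contf by (intro measurable_compose[OF borel_measurable_continuous_on_indicator measurable_ennreal]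
              continuous_on_powr' continuous_intros continuous_on_subset[OF contf]) auto
        then show "(\<lambda>\<zeta>. ennreal (norm (f \<zeta>) powr p) * indicator (ball w R) \<zeta>) \<in> borel_measurable lborel"
          unfolding eq by simp
      qed
      also have "\<dots> \<le> ennreal (N powr (1 - p) * r powr (2 - 2 / p)) * ennreal K"
        by (intro mult_left_mono I) auto
      finally have "norm (f z) * (pi * r\<^sup>2) \<le> N powr (1 - p) * r powr (2 - 2 / p) * K"
        using K by (simp flip: ennreal_mult)
      moreover have "r powr (2 - 2 / p) = r\<^sup>2 * r powr (- (2 / p))"
        using r by (simp add: powr_diff powr_minus divide_inverse)
      ultimately have "norm (f z) * pi \<le> N powr (1 - p) * r powr (- (2 / p)) * K"
        using r by (simp add: field_simps)
      then have "r powr (2 / p) * norm (f z) \<le> N powr (1 - p) * K / pi"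
        using r by (simp add: powr_minus field_simps)
      moreover have "g z = 2 powr (2 / p) * (r powr (2 / p) * norm (f z))"
        using r unfolding g_def r_def by (simp add: powr_divide)
      ultimately show ?thesis
        unfolding N_def[symmetric] by (simp add: field_simps)
    qed
  qed (use p R K in \<open>auto simp: g_def\<close>)
  moreover have "g w powr p = norm (f w) powr p * R\<^sup>2"
    using R p by (simp add: g_def powr_mult powr_powr)
  ultimately show ?thesis by simp
qed

text \<open>Large exponents reduce to p \<le> 1 by passing to f^m with m = \<lceil>p\<rceil>, since
  |f|^p = |f^m|^(p/m).\<close>

lemma area_powr_mean:
  fixes p :: real
  assumes "0 < p"
  obtains C where "0 < C" and
    "\<And>f w R K. f holomorphic_on cball w R \<Longrightarrow> 0 < R \<Longrightarrow> 0 \<le> K \<Longrightarrow>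
      (\<integral>\<^sup>+ z. ennreal (norm (f z) powr p) * indicator (ball w R) z \<partial>lborel) \<le> ennreal K \<Longrightarrow>
      norm (f w) powr p * R\<^sup>2 \<le> C * K"
proof -
  define m where "m = nat \<lceil>p\<rceil>"
  have m: "0 < m" "p / m \<le> 1" "0 < p / m"
    using assms by (auto simp: m_def field_simps)
  have pw: "norm (x ^ m) powr (p / m) = norm x powr p" for x :: complex
    using m by (simp add: norm_power powr_powr flip: powr_realpow')
  show thesis
  proof (rule that[of "2 powr (2 / (p / m)) / pi"])
    fix f w R K
    assume *: "f holomorphic_on cball w R" "0 < R" "0 \<le> K"
      "(\<integral>\<^sup>+ z. ennreal (norm (f z :: complex) powr p) * indicator (ball w R) z \<partial>lborel) \<le> ennreal K"
    show "norm (f w) powr p * R\<^sup>2 \<le> 2 powr (2 / (p / m)) / pi * K"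
      using area_powr_mean_aux[of "\<lambda>z. f z ^ m" w R "p / m" K] * m
      by (simp add: pw holomorphic_intros)
  qed (use m in auto)
qed

text \<open>The absorption again, now with circle means and the weight (1 - |z|)^(1/p). As f may be
  unbounded on the disk, the supremum is taken for a dilate F z = f (s z), which is holomorphic on
  the closed disk. The dilation depends on w, but the means of F are means of f, so the constant
  does not.\<close>

lemma hardy_point_aux:
  fixes f :: "complex \<Rightarrow> complex"
  assumes f: "f holomorphic_on disk" and p: "0 < p" "p \<le> 1" and K: "0 \<le> K"
    and mean: "\<And>r. 0 < r \<Longrightarrow> r < 1 \<Longrightarrow> circle_mean (\<lambda>t. ennreal (norm (f (of_real r * cis t)) powr p)) \<le> ennreal K"
    and w: "w \<in> disk"
  shows "norm (f w) powr p * (1 - norm w) \<le> 2 * 2 powr (1 / p) * K"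
proof -
  define s where "s = (1 + norm w) / 2"
  have s: "0 < s" "s < 1" "norm w < s"
    using w by (auto simp: s_def divide_simps add_pos_nonneg)
  define F where "F = (\<lambda>z. f (of_real s * z))"
  have sz: "of_real s * z \<in> disk" if "norm z \<le> 1" for z
    using s that by (simp add: norm_mult) (metis less_le_trans mult.right_neutral mult_le_cancel_left_pos not_le order_less_trans)
  have F: "F holomorphic_on cball 0 1"
    unfolding F_def by (rule holomorphic_on_compose_gen[OF _ f, unfolded o_def])
      (use sz in \<open>auto intro!: holomorphic_intros\<close>)
  define g where "g = (\<lambda>z. (1 - norm z) powr (1 / p) * norm (F z))"
  define N where "N = (SUP z\<in>disk. g z)"
  have contF: "continuous_on (cball 0 1) F"
    using F by (rule holomorphic_on_imp_continuous_on)
  have bdd: "bdd_above (g ` disk)"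
  proof -
    have "compact (F ` cball 0 1)"
      using contF by (intro compact_continuous_image) auto
    then obtain B where B: "\<And>z. z \<in> cball 0 1 \<Longrightarrow> norm (F z) \<le> B"
      by (meson compact_imp_bounded bounded_iff imageI)
    have "g z \<le> 1 powr (1 / p) * B" if "z \<in> disk" for z
      unfolding g_def using that B[of z] p by (intro mult_mono powr_mono2) auto
    then show ?thesis by (auto intro!: bdd_aboveI)
  qed
  have N: "g z \<le> N" if "z \<in> disk" for z
    unfolding N_def using that bdd by (rule cSUP_upper)
  have "g (w / s) powr p \<le> 2 powr (1 / p) * K"
  proof (rule absorb_sup[OF bdd])
    show "g z \<le> 2 powr (1 / p) * K * (SUP z\<in>disk. g z) powr (1 - p)" if z: "z \<in> disk" for z
    proof -
      \<comment> \<open>The circle of radius R lies halfway between z and the unit circle, so that d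
        is both the gap in \<open>circle_mean_ge\<close> and the value of 1 - |.| on that
        circle.\<close>
      define R d where "R = (1 + norm z) / 2" and "d = (1 - norm z) / 2"
      have R: "0 < R" "R < 1" "norm z < R" "0 < d" "1 - R = d" "R - norm z = d"
        using z by (auto simp: R_def d_def field_simps add_pos_nonneg)
      have N0: "0 \<le> N" using N[OF z] z by (smt (verit) g_def mult_nonneg_nonneg norm_ge_zero powr_ge_zero)
      have le: "norm (F (R * cis t)) \<le> N powr (1 - p) * d powr (1 - 1 / p) * norm (F (R * cis t)) powr p" for t
      proof -
        have "g (R * cis t) \<le> N" using R by (intro N) (auto simp: norm_mult)
        then have "norm (F (R * cis t)) \<le> N * d powr (- (1 / p))"
          using R by (simp add: g_def norm_mult powr_minus field_simps)
        then have "norm (F (R * cis t)) \<le> (N * d powr (- (1 / p))) powr (1 - p) * norm (F (R * cis t)) powr p"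
          using p by (intro powr_split) auto
        also have "(N * d powr (- (1 / p))) powr (1 - p) = N powr (1 - p) * d powr (1 - 1 / p)"
        proof -
          have "- (1 / p) * (1 - p) = 1 - 1 / p"
            using p by (simp add: field_simps)
          then show ?thesis
            using N0 R by (simp only: powr_mult powr_powr)
        qed
        finally show ?thesis .
      qed
      have "ennreal (norm (F z) * ((R - dist 0 z) / R)) \<le> circle_mean (\<lambda>t. ennreal (norm (F (0 + R * cis t))))"
        by (rule circle_mean_ge)
          (use F contF R in \<open>auto intro: holomorphic_on_subset continuous_on_subset\<close>)
      also have "\<dots> \<le> circle_mean (\<lambda>t. ennreal (N powr (1 - p) * d powr (1 - 1 / p)) * ennreal (norm (F (R * cis t)) powr p))"
        using le by (intro nn_integral_mono) (auto simp flip: ennreal_mult intro!: ennreal_leI)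
      also have "\<dots> = ennreal (N powr (1 - p) * d powr (1 - 1 / p)) * circle_mean (\<lambda>t. ennreal (norm (F (R * cis t)) powr p))"
      proof (rule nn_integral_cmult)
        have "continuous_on UNIV (\<lambda>t. norm (F (R * cis t)))"
          using R by (intro continuous_intros continuous_on_compose2[OF contF]) (auto simp: norm_mult)
        then have "(\<lambda>t. norm (F (R * cis t))) \<in> borel_measurable borel"
          by (rule borel_measurable_continuous_onI)
        then show "(\<lambda>t. ennreal (norm (F (R * cis t)) powr p)) \<in> borel_measurable (uniform_measure lborel {0..2 * pi})"
          by measurable
      qed
      also have "\<dots> \<le> ennreal (N powr (1 - p) * d powr (1 - 1 / p)) * ennreal K"
        using mean[of "s * R"] s R mult_strict_mono[of s 1 R 1] by (intro mult_left_mono) (auto simp: F_def mult.assoc)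
      finally have "norm (F z) * (d / R) \<le> N powr (1 - p) * d powr (1 - 1 / p) * K"
        using K R by (simp flip: ennreal_mult)
      moreover have "norm (F z) * d \<le> norm (F z) * (d / R)"
        using R by (intro mult_left_mono) (auto simp: pos_le_divide_eq mult_left_le)
      moreover have "d powr (1 - 1 / p) = d * d powr (- (1 / p))"
        using R by (simp add: powr_diff powr_minus divide_inverse)
      ultimately have "norm (F z) * d \<le> N powr (1 - p) * d powr (- (1 / p)) * K * d"
        by (simp add: mult_ac)
      then have "norm (F z) \<le> N powr (1 - p) * d powr (- (1 / p)) * K"
        using R by simp
      then have "d powr (1 / p) * norm (F z) \<le> N powr (1 - p) * K"
        using R by (simp add: powr_minus field_simps)
      moreover have "g z = 2 powr (1 / p) * (d powr (1 / p) * norm (F z))"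
        using R unfolding g_def d_def by (simp add: powr_divide)
      ultimately show ?thesis
        unfolding N_def[symmetric] by (simp add: mult_ac)
    qed
    show "w / s \<in> disk"
      using s by (simp add: norm_divide)
  qed (use p K in \<open>auto simp: g_def\<close>)
  moreover have "g (w / s) powr p = norm (f w) powr p * (1 - norm w / s)"
    using s p by (simp add: g_def F_def powr_mult powr_powr norm_divide)
  \<comment> \<open>Here 1 - |w| / s = (1 - |w|) / (2 s) with s < 1. Returning from the dilate to f
    thus costs the leading factor 2 of the constant.\<close>
  moreover have "(1 - norm w) / 2 \<le> 1 - norm w / s"
  proof -
    have "(1 - norm w) / 2 * s \<le> (1 - norm w) / 2 * 1"
      using s by (intro mult_left_mono) auto
    then show ?thesis
      using s by (simp add: s_def field_simps)
  qed
  ultimately have "norm (f w) powr p * ((1 - norm w) / 2) \<le> 2 powr (1 / p) * K"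
    by (smt (verit) mult_left_mono powr_ge_zero)
  then show ?thesis by simp
qed

lemma hardy_point:
  fixes p :: real
  assumes "0 < p"
  obtains C where "0 < C" and
    "\<And>f w K. f holomorphic_on disk \<Longrightarrow> 0 \<le> K \<Longrightarrow> w \<in> disk \<Longrightarrow>
      (\<And>r. 0 < r \<Longrightarrow> r < 1 \<Longrightarrow> circle_mean (\<lambda>t. ennreal (norm (f (of_real r * cis t)) powr p)) \<le> ennreal K) \<Longrightarrow>
      norm (f w) powr p * (1 - norm w) \<le> C * K"
proof -
  define m where "m = nat \<lceil>p\<rceil>"
  have m: "0 < m" "p / m \<le> 1" "0 < p / m"
    using assms by (auto simp: m_def field_simps)
  have pw: "norm (x ^ m) powr (p / m) = norm x powr p" for x :: complex
    using m by (simp add: norm_power powr_powr flip: powr_realpow')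
  show thesis
  proof (rule that[of "2 * 2 powr (1 / (p / m))"])
    fix f w K
    assume *: "f holomorphic_on disk" "0 \<le> K" "w \<in> disk"
      "\<And>r. 0 < r \<Longrightarrow> r < 1 \<Longrightarrow> circle_mean (\<lambda>t. ennreal (norm (f (of_real r * cis t)) powr p)) \<le> ennreal K"
    show "norm (f w) powr p * (1 - norm w) \<le> 2 * 2 powr (1 / (p / m)) * K"
      using hardy_point_aux[of "\<lambda>z. f z ^ m" "p / m" K w] * m
      by (simp add: pw holomorphic_intros)
  qed (use m in auto)
qed

subsection \<open>The Poisson kernel and a Forelli--Rudin estimate\<close>

text \<open>On the circle this is the Poisson kernel of a; its power \<gamma> is the modulus of the
  test function f_a.\<close>

abbreviation kern :: "complex \<Rightarrow> complex \<Rightarrow> real" where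
  "kern a z \<equiv> (1 - (norm a)\<^sup>2) / (norm (1 - cnj a * z))\<^sup>2"

lemma one_minus_norm_mult_le: "1 - norm a * norm z \<le> norm (1 - cnj a * z)"
  using norm_triangle_ineq2[of 1 "cnj a * z"] by (simp add: norm_mult)

text \<open>For |u| = 1 the real part of (1 + b u) / (1 - b u) is (1 - |b|^2) / |1 - b u|^2, and its
  mean is the value 1 at the origin.\<close>

lemma poisson_mean:
  fixes b :: complex
  assumes b: "norm b < 1"
  shows "circle_mean (\<lambda>t. ennreal (1 / (norm (1 - b * cis t))\<^sup>2)) = ennreal (1 / (1 - (norm b)\<^sup>2))"
proof -
  have nz: "1 - b * u \<noteq> 0" if "norm u \<le> 1" for u
  proof
    assume "1 - b * u = 0"
    then have "norm b * norm u = 1"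
      by (metis norm_mult norm_one right_minus_eq)
    with b that show False
      by (smt (verit) mult_left_le norm_ge_zero)
  qed
  define f where "f = (\<lambda>u. (1 + b * u) / (1 - b * u))"
  have f: "f holomorphic_on cball 0 1"
    unfolding f_def by (intro holomorphic_intros) (use nz in auto)
  have b2: "0 < 1 - (norm b)\<^sup>2"
    using b by (simp add: abs_square_less_1)
  have Re: "Re (f (cis t)) = (1 - (norm b)\<^sup>2) / (norm (1 - b * cis t))\<^sup>2" for t
  proof -
    have "f (cis t) = (1 + b * cis t) * cnj (1 - b * cis t) / of_real ((norm (1 - b * cis t))\<^sup>2)"
      unfolding f_def by (metis complex_div_cnj complex_norm_square of_real_power)
    then have "Re (f (cis t)) = Re ((1 + b * cis t) * cnj (1 - b * cis t)) / (norm (1 - b * cis t))\<^sup>2"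
      by (metis Re_divide_of_real)
    also have "Re ((1 + b * cis t) * cnj (1 - b * cis t)) = 1 - (norm (b * cis t))\<^sup>2"
      unfolding cmod_power2 by (simp add: power2_eq_square algebra_simps)
    finally show ?thesis by (simp add: norm_mult)
  qed
  have "((\<lambda>t. f (0 + of_real 1 * cis t) / (0 + of_real 1 * cis t - 0) * (of_real 1 * cis t)) has_integral 2 * pi * f 0) {0..2 * pi}"
    by (rule Cauchy_has_integral_circle)
      (use f in \<open>auto intro: holomorphic_on_imp_continuous_on holomorphic_on_subset\<close>)
  then have "((\<lambda>t. f (cis t)) has_integral 2 * pi * f 0) {0..2 * pi}"
    by simp
  from has_integral_Re[OF this]
  have "((\<lambda>t. (1 - (norm b)\<^sup>2) / (norm (1 - b * cis t))\<^sup>2) has_integral 2 * pi) {0..2 * pi}"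
    unfolding Re by (simp add: f_def)
  from has_integral_mult_right[OF this, of "1 / (1 - (norm b)\<^sup>2)"]
  have "((\<lambda>t. 1 / (norm (1 - b * cis t))\<^sup>2) has_integral 2 * pi / (1 - (norm b)\<^sup>2)) {0..2 * pi}"
    using b2 by simp
  then show ?thesis
    using nz by (subst circle_mean_eq_integral) (auto intro!: continuous_intros simp: integral_unique)
qed

text \<open>Two measures on the line are compared: the image of area on the disk under the modulus,
  and the density 2 pi r on [0, 1]. They agree on all half-lines \<open>{x<..}\<close>; the clamp
  \<open>min 1 (max 0 x)\<close> puts the cases x < 0 and x \<ge> 1 into the same formula.\<close>

lemma nn_integral_radial:
  fixes \<phi> :: "real \<Rightarrow> ennreal"
  assumes [measurable]: "\<phi> \<in> borel_measurable borel"
  shows "(\<integral>\<^sup>+ z. \<phi> (norm z) * indicator disk z \<partial>(lborel :: complex measure)) =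
         (\<integral>\<^sup>+ r. \<phi> r * (ennreal (2 * pi * r) * indicator {0..1} r) \<partial>lborel)"
proof -
  define M where "M = distr (density lborel (indicator disk)) borel (norm :: complex \<Rightarrow> real)"
  define N where "N = density lborel (\<lambda>r. ennreal (2 * pi * r) * indicator {0..1} r)"
  have M: "emeasure M {x<..} = ennreal (pi * (1 - (min 1 (max 0 x))\<^sup>2))" for x
  proof -
    have [measurable]: "(norm -` {x<..} :: complex set) \<in> sets borel"
      by (intro borel_open open_vimage continuous_intros)
    have "emeasure M {x<..} = emeasure (density lborel (indicator disk)) (norm -` {x<..} :: complex set)"
      unfolding M_def by (subst emeasure_distr) auto
    also have "\<dots> = (\<integral>\<^sup>+ z. indicator disk z * indicator (norm -` {x<..}) z \<partial>(lborel :: complex measure))"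
      by (rule emeasure_density) (auto intro!: borel_measurable_indicator)
    also have "\<dots> = (\<integral>\<^sup>+ z. indicator (disk - cball 0 x) z \<partial>(lborel :: complex measure))"
      by (intro nn_integral_cong) (auto split: split_indicator)
    also have "\<dots> = emeasure lborel (disk - cball 0 x :: complex set)"
      by (rule nn_integral_indicator) auto
    also have "\<dots> = ennreal (pi * (1 - (min 1 (max 0 x))\<^sup>2))"
    proof (cases "x < 0")
      case True
      then show ?thesis by (simp add: emeasure_ball unit_ball_vol_2)
    next
      case x: False
      show ?thesis
      proof (cases "x < 1")
        case True
        then have "cball 0 x \<subseteq> (disk :: complex set)" by auto
        then have "emeasure lborel (disk - cball 0 x :: complex set) = emeasure lborel disk - emeasure lborel (cball 0 x :: complex set)"
          using x by (intro emeasure_Diff) (auto simp: emeasure_cball)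
        also have "\<dots> = ennreal (pi * (1 - x\<^sup>2))"
          using x True by (simp add: emeasure_ball emeasure_cball unit_ball_vol_2 algebra_simps ennreal_minus)
        finally show ?thesis using x True by simp
      next
        case False
        then have "disk - cball 0 x = ({} :: complex set)" by auto
        then have "emeasure lborel (disk - cball 0 x :: complex set) = 0" by (simp only: emeasure_empty)
        then show ?thesis using False by simp
      qed
    qed
    finally show ?thesis .
  qed
  have N: "emeasure N {x<..} = ennreal (pi * (1 - (min 1 (max 0 x))\<^sup>2))" for x
  proof -
    define c where "c = min 1 (max 0 x)"
    have "emeasure N {x<..} = (\<integral>\<^sup>+ r. ennreal (2 * pi * r) * indicator {0..1} r * indicator {x<..} r \<partial>lborel)"
      unfolding N_def by (rule emeasure_density) auto
    also have "\<dots> = (\<integral>\<^sup>+ r. ennreal (2 * pi * r) * indicator {c..1} r \<partial>lborel)"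
      using AE_lborel_singleton[of x] AE_lborel_singleton[of 1]
      by (intro nn_integral_cong_AE, eventually_elim) (auto simp: c_def split: split_indicator)
    also have "\<dots> = ennreal (pi * 1\<^sup>2 - pi * c\<^sup>2)"
      by (rule nn_integral_FTC_Icc) (auto simp: c_def intro!: derivative_eq_intros)
    finally show ?thesis by (simp add: c_def algebra_simps)
  qed
  have eq: "M = N"
    by (rule measure_eqI_lessThan) (simp_all add: M N, simp_all add: M_def N_def)
  have "(\<integral>\<^sup>+ z. \<phi> (norm z) * indicator disk z \<partial>(lborel :: complex measure)) = (\<integral>\<^sup>+ r. \<phi> r \<partial>M)"
  proof -
    have "(\<integral>\<^sup>+ z. \<phi> (norm z) \<partial>density lborel (indicator disk)) = (\<integral>\<^sup>+ z. indicator disk z * \<phi> (norm (z :: complex)) \<partial>lborel)"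
      by (rule nn_integral_density) (auto intro!: borel_measurable_indicator)
    then show ?thesis
      unfolding M_def by (subst nn_integral_distr) (auto simp: mult.commute)
  qed
  also have "\<dots> = (\<integral>\<^sup>+ r. \<phi> r * (ennreal (2 * pi * r) * indicator {0..1} r) \<partial>lborel)"
    unfolding eq N_def by (subst nn_integral_density) (auto simp: mult.commute)
  finally show ?thesis .
qed

lemma nn_integral_powr_0_to:
  fixes a e :: real
  assumes "-1 < a" "0 \<le> e"
  shows "(\<integral>\<^sup>+ t. ennreal (t powr a) * indicator {0..e} t \<partial>lborel) = ennreal (e powr (a + 1) / (a + 1))"
proof -
  have "(\<integral>\<^sup>+ t. ennreal (indicator {0..e} t * t powr a) \<partial>lborel) = ennreal (e powr (a + 1) / (a + 1))"
    using has_integral_powr_from_0[OF assms] by (intro nn_integral_has_integral_lebesgue) auto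
  also have "(\<integral>\<^sup>+ t. ennreal (indicator {0..e} t * t powr a) \<partial>lborel) = (\<integral>\<^sup>+ t. ennreal (t powr a) * indicator {0..e} t \<partial>lborel)"
    by (intro nn_integral_cong) (simp split: split_indicator)
  finally show ?thesis .
qed

lemma nn_integral_powr_to_inf:
  fixes a e :: real
  assumes "a < -1" "0 < e"
  shows "(\<integral>\<^sup>+ t. ennreal (t powr a) * indicator {e..} t \<partial>lborel) = ennreal (- (e powr (a + 1)) / (a + 1))"
proof -
  have "(\<integral>\<^sup>+ t. ennreal (indicator {e..} t * t powr a) \<partial>lborel) = ennreal (- (e powr (a + 1)) / (a + 1))"
    using has_integral_powr_to_inf[OF assms] by (intro nn_integral_has_integral_lebesgue) auto
  also have "(\<integral>\<^sup>+ t. ennreal (indicator {e..} t * t powr a) \<partial>lborel) = (\<integral>\<^sup>+ t. ennreal (t powr a) * indicator {e..} t \<partial>lborel)"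
    by (intro nn_integral_cong) (simp split: split_indicator)
  finally show ?thesis .
qed

text \<open>After the reflection t = 1 - r, the base 1 - \<rho> (1 - t) is at least e = 1 - \<rho>
  and at least t. The exponent -2\<alpha> - 3 is negative, so using e for t \<le> e and t beyond
  leaves pure powers. Their integrals converge, at 0 because \<alpha> > -1 and at infinity because
  -\<alpha> - 3 < -1.\<close>

lemma radial_kernel_bound:
  fixes \<alpha> \<rho> :: real
  assumes \<alpha>: "-1 < \<alpha>" and \<rho>: "0 \<le> \<rho>" "\<rho> < 1"
  shows "(\<integral>\<^sup>+ r. ennreal ((1 - \<rho> * r) powr (- 2 * \<alpha> - 3) * (1 - r) powr \<alpha>) * indicator {0..1} r \<partial>lborel)
    \<le> ennreal ((1 - \<rho>) powr (- \<alpha> - 2) * (1 / (\<alpha> + 1) + 1 / (\<alpha> + 2)))"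
proof -
  define e where "e = 1 - \<rho>"
  have e: "0 < e" "e \<le> 1" using \<rho> by (auto simp: e_def)
  define h where "h = (\<lambda>r. ennreal ((1 - \<rho> * r) powr (- 2 * \<alpha> - 3) * (1 - r) powr \<alpha>) * indicator {0..1} r)"
  have [measurable]: "h \<in> borel_measurable borel"
    unfolding h_def by measurable
  have "(\<integral>\<^sup>+ r. h r \<partial>lborel) = ennreal \<bar>- 1\<bar> * (\<integral>\<^sup>+ t. h (1 + (- 1) * t) \<partial>lborel)"
    by (rule nn_integral_real_affine) auto
  also have "\<dots> = (\<integral>\<^sup>+ t. h (1 - t) \<partial>lborel)"
    by simp
  also have "\<dots> \<le> (\<integral>\<^sup>+ t. ennreal (e powr (- 2 * \<alpha> - 3)) * (ennreal (t powr \<alpha>) * indicator {0..e} t)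
      + ennreal (t powr (- \<alpha> - 3)) * indicator {e..} t \<partial>lborel)"
  proof (intro nn_integral_mono)
    fix t :: real
    show "h (1 - t) \<le> ennreal (e powr (- 2 * \<alpha> - 3)) * (ennreal (t powr \<alpha>) * indicator {0..e} t)
      + ennreal (t powr (- \<alpha> - 3)) * indicator {e..} t"
    proof (cases "t \<in> {0..1}")
      case t: True
      have h: "h (1 - t) = ennreal ((1 - \<rho> * (1 - t)) powr (- 2 * \<alpha> - 3) * t powr \<alpha>)"
        using t by (simp add: h_def)
      have ge: "e \<le> 1 - \<rho> * (1 - t)" "t \<le> 1 - \<rho> * (1 - t)"
        using t \<rho> mult_right_mono[of \<rho> 1 "1 - t"] mult_left_mono[of "1 - t" 1 \<rho>] by (auto simp: e_def algebra_simps)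
      show ?thesis
      proof (cases "t \<le> e")
        case True
        have "h (1 - t) \<le> ennreal (e powr (- 2 * \<alpha> - 3) * t powr \<alpha>)"
          unfolding h using ge e \<alpha> by (intro ennreal_leI mult_right_mono powr_mono2') auto
        also have "\<dots> \<le> ennreal (e powr (- 2 * \<alpha> - 3)) * (ennreal (t powr \<alpha>) * indicator {0..e} t)
      + ennreal (t powr (- \<alpha> - 3)) * indicator {e..} t"
          using True t by (simp add: ennreal_mult)
        finally show ?thesis .
      next
        case False
        then have "(1 - \<rho> * (1 - t)) powr (- 2 * \<alpha> - 3) * t powr \<alpha> \<le> t powr (- 2 * \<alpha> - 3) * t powr \<alpha>"
          using ge e \<alpha> by (intro mult_right_mono powr_mono2') auto
        also have "\<dots> = t powr (- \<alpha> - 3)"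
          by (simp flip: powr_add)
        finally show ?thesis
          using False unfolding h by (simp add: ennreal_leI)
      qed
    next
      case False
      then have "1 - t \<notin> {0..1}" by auto
      then show ?thesis by (simp add: h_def)
    qed
  qed
  also have "\<dots> = ennreal (e powr (- 2 * \<alpha> - 3)) * (\<integral>\<^sup>+ t. ennreal (t powr \<alpha>) * indicator {0..e} t \<partial>lborel)
      + (\<integral>\<^sup>+ t. ennreal (t powr (- \<alpha> - 3)) * indicator {e..} t \<partial>lborel)"
    by (subst nn_integral_add) (auto simp: nn_integral_cmult)
  also have "\<dots> = ennreal (e powr (- 2 * \<alpha> - 3) * (e powr (\<alpha> + 1) / (\<alpha> + 1)) + e powr (- \<alpha> - 2) / (\<alpha> + 2))"
  proof -
    have "- (e powr (- \<alpha> - 3 + 1)) / (- \<alpha> - 3 + 1) = e powr (- \<alpha> - 2) / (\<alpha> + 2)"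
      using \<alpha> by (simp add: field_simps)
    then show ?thesis
      using \<alpha> e nn_integral_powr_0_to[of \<alpha> e] nn_integral_powr_to_inf[of "- \<alpha> - 3" e]
      by (simp add: ennreal_plus flip: ennreal_mult)
  qed
  also have "e powr (- 2 * \<alpha> - 3) * (e powr (\<alpha> + 1) / (\<alpha> + 1)) = e powr (- \<alpha> - 2) / (\<alpha> + 1)"
    by (simp flip: powr_add)
  finally show ?thesis
    by (simp add: h_def e_def algebra_simps)
qed

text \<open>The Poisson mean integrates the angle out, and \<open>radial_kernel_bound\<close> the
  radius. What remains is (1 - |a|^2)^(\<alpha>+2) against (1 - |a|)^(-\<alpha>-2), whose product is
  bounded uniformly in a.\<close>

lemma Forelli_Rudin:
  fixes \<alpha> :: real
  assumes \<alpha>: "-1 < \<alpha>"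
  obtains C where "0 < C" and "\<And>a. a \<in> disk \<Longrightarrow>
    (\<integral>\<^sup>+ z. ennreal (kern a z powr (\<alpha> + 2) * (1 - (norm z)\<^sup>2) powr \<alpha>) * indicator disk z \<partial>lborel)
      \<le> ennreal C"
proof -
  \<comment> \<open>The factors stem from (1 + \<rho>)^(\<alpha>+2), from replacing (1 -
    r^2)^\<alpha> by (1 - r)^\<alpha>, from the radial density 2 pi r, and from the radial
    integral.\<close>
  define C where "C = 2 powr (\<alpha> + 2) * 2 powr \<bar>\<alpha>\<bar> * (2 * pi) * (1 / (\<alpha> + 1) + 1 / (\<alpha> + 2))"
  show thesis
  proof (rule that[of C])
    show "0 < C" using \<alpha> by (auto simp: C_def intro!: mult_pos_pos add_pos_pos)
    fix a :: complex assume a: "a \<in> disk"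
    define \<rho> where "\<rho> = norm a"
    have \<rho>: "0 \<le> \<rho>" "\<rho> < 1" using a by (auto simp: \<rho>_def)
    have \<rho>2: "0 < 1 - \<rho>\<^sup>2" using \<rho> by (simp add: abs_square_less_1)
    have \<rho>r: "0 < 1 - \<rho> * r" if "0 \<le> r" "r \<le> 1" for r
      using mult_left_mono[OF that(2) \<rho>(1)] \<rho> by simp
    have nz: "1 - cnj a * z \<noteq> 0" if "norm z \<le> 1" for z
      using one_minus_norm_mult_le[of a z] \<rho>r[of "norm z"] that by (auto simp: \<rho>_def)
    define F where "F = (\<lambda>z. ennreal (indicator disk z *\<^sub>R (kern a z powr (\<alpha> + 2) * (1 - (norm z)\<^sup>2) powr \<alpha>)))"
    have [measurable]: "disk \<in> sets (borel :: complex measure)"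
      by simp
    have F [measurable]: "F \<in> borel_measurable borel"
      unfolding F_def by measurable
    have "(\<integral>\<^sup>+ z. ennreal (kern a z powr (\<alpha> + 2) * (1 - (norm z)\<^sup>2) powr \<alpha>) * indicator disk z \<partial>lborel)
        = (\<integral>\<^sup>+ z. F z \<partial>lborel)"
      unfolding F_def by (intro nn_integral_cong) (auto split: split_indicator)
    also have "\<dots> = (\<integral>\<^sup>+ z. circle_mean (\<lambda>t. F (cis t * z)) \<partial>lborel)"
      by (rule nn_integral_rotation_mean[symmetric]) measurable
    also have "\<dots> \<le> (\<integral>\<^sup>+ z. ennreal ((1 - \<rho>\<^sup>2) powr (\<alpha> + 2) * (1 - \<rho> * norm z) powr (- 2 * \<alpha> - 3) * (1 - (norm z)\<^sup>2) powr \<alpha>)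
        * indicator disk z \<partial>(lborel :: complex measure))"
    proof (intro nn_integral_mono)
      fix z :: complex
      show "circle_mean (\<lambda>t. F (cis t * z)) \<le> ennreal ((1 - \<rho>\<^sup>2) powr (\<alpha> + 2) * (1 - \<rho> * norm z) powr (- 2 * \<alpha> - 3) * (1 - (norm z)\<^sup>2) powr \<alpha>)
        * indicator disk z"
      proof (cases "z \<in> disk")
        case False
        then have "F (cis t * z) = 0" for t by (simp add: F_def norm_mult)
        then show ?thesis by simp
      next
        case True
        define m where "m = 1 - \<rho> * norm z"
        have m: "0 < m" using True \<rho>r[of "norm z"] by (simp add: m_def)
        define A where "A = (1 - \<rho>\<^sup>2) powr (\<alpha> + 2) / m powr (2 * \<alpha> + 2) * (1 - (norm z)\<^sup>2) powr \<alpha>"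
        have "F (cis t * z) \<le> ennreal A * ennreal (1 / (norm (1 - (cnj a * z) * cis t))\<^sup>2)" for t
        proof -
          define b where "b = norm (1 - (cnj a * z) * cis t)"
          have "m \<le> b"
            using one_minus_norm_mult_le[of a "z * cis t"] by (simp add: m_def b_def \<rho>_def norm_mult mult.assoc)
          then have b: "0 < b" "b\<^sup>2 = b powr 2"
            using m by auto
          have "((1 - \<rho>\<^sup>2) / b\<^sup>2) powr (\<alpha> + 2) = (1 - \<rho>\<^sup>2) powr (\<alpha> + 2) / b powr (2 * (\<alpha> + 2))"
            unfolding b(2) using \<rho>2 by (simp only: powr_divide powr_powr)
          \<comment> \<open>One factor b^2 is kept for the exact Poisson mean; the rest is estimated
            through b \<ge> m, as 2\<alpha> + 2 > 0.\<close>
          also have "b powr (2 * (\<alpha> + 2)) = b powr (2 * \<alpha> + 2) * b\<^sup>2"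
            unfolding b(2) by (simp add: powr_add[symmetric] add.commute)
          also have "(1 - \<rho>\<^sup>2) powr (\<alpha> + 2) / (b powr (2 * \<alpha> + 2) * b\<^sup>2) = (1 - \<rho>\<^sup>2) powr (\<alpha> + 2) / b powr (2 * \<alpha> + 2) * (1 / b\<^sup>2)"
            by simp
          also have "\<dots> \<le> (1 - \<rho>\<^sup>2) powr (\<alpha> + 2) / m powr (2 * \<alpha> + 2) * (1 / b\<^sup>2)"
            using \<open>m \<le> b\<close> m \<alpha> by (intro mult_right_mono divide_left_mono powr_mono2) auto
          finally have "((1 - \<rho>\<^sup>2) / b\<^sup>2) powr (\<alpha> + 2) * (1 - (norm z)\<^sup>2) powr \<alpha>
              \<le> (1 - \<rho>\<^sup>2) powr (\<alpha> + 2) / m powr (2 * \<alpha> + 2) * (1 / b\<^sup>2) * (1 - (norm z)\<^sup>2) powr \<alpha>"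
            by (rule mult_right_mono) simp
          also have "\<dots> = A * (1 / b\<^sup>2)"
            by (simp add: A_def)
          finally have "((1 - \<rho>\<^sup>2) / b\<^sup>2) powr (\<alpha> + 2) * (1 - (norm z)\<^sup>2) powr \<alpha> \<le> A * (1 / b\<^sup>2)" .
          moreover have "A \<ge> 0" by (simp add: A_def)
          moreover have "F (cis t * z) = ennreal (((1 - \<rho>\<^sup>2) / b\<^sup>2) powr (\<alpha> + 2) * (1 - (norm z)\<^sup>2) powr \<alpha>)"
            using True by (simp add: F_def norm_mult b_def \<rho>_def mult.assoc mult.commute[of z])
          ultimately show ?thesis
            by (simp add: ennreal_leI b_def flip: ennreal_mult)
        qed
        then have "circle_mean (\<lambda>t. F (cis t * z)) \<le> circle_mean (\<lambda>t. ennreal A * ennreal (1 / (norm (1 - (cnj a * z) * cis t))\<^sup>2))"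
          by (intro nn_integral_mono)
        also have "\<dots> = ennreal A * circle_mean (\<lambda>t. ennreal (1 / (norm (1 - (cnj a * z) * cis t))\<^sup>2))"
        proof (rule nn_integral_cmult)
          have [measurable]: "cis \<in> borel_measurable borel"
            by (intro borel_measurable_continuous_onI continuous_intros)
          show "(\<lambda>t. ennreal (1 / (norm (1 - (cnj a * z) * cis t))\<^sup>2)) \<in> borel_measurable (uniform_measure lborel {0..2 * pi})"
            by measurable
        qed
        also have "\<dots> = ennreal A * ennreal (1 / (1 - (norm (cnj a * z))\<^sup>2))"
          using m by (subst poisson_mean) (auto simp: norm_mult m_def \<rho>_def)
        also have "\<dots> \<le> ennreal A * ennreal (1 / m)"
        proof (intro mult_left_mono ennreal_leI divide_left_mono)
          have "(\<rho> * norm z) * (\<rho> * norm z) \<le> (\<rho> * norm z) * 1"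
            using m \<rho> by (intro mult_left_mono) (auto simp: m_def)
          then show "m \<le> 1 - (norm (cnj a * z))\<^sup>2"
            by (simp add: m_def \<rho>_def norm_mult power2_eq_square)
          then show "0 < (1 - (norm (cnj a * z))\<^sup>2) * m"
            using m by simp
        qed auto
        also have "\<dots> = ennreal (A * (1 / m))"
          using m by (subst ennreal_mult) (auto simp: A_def)
        also have "A * (1 / m) = (1 - \<rho>\<^sup>2) powr (\<alpha> + 2) * m powr (- 2 * \<alpha> - 3) * (1 - (norm z)\<^sup>2) powr \<alpha>"
        proof -
          have "m powr (- 2 * \<alpha> - 3) = 1 / m powr (2 * \<alpha> + 2 + 1)"
          proof -
            have "- 2 * \<alpha> - 3 = - (2 * \<alpha> + 2 + 1)" by simp
            then show ?thesis by (simp only: powr_minus_divide)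
          qed
          also have "m powr (2 * \<alpha> + 2 + 1) = m powr (2 * \<alpha> + 2) * m"
            using m by (subst powr_add) simp
          finally show ?thesis by (simp add: A_def)
        qed
        finally show ?thesis using True by (simp add: m_def)
      qed
    qed
    also have "\<dots> = (\<integral>\<^sup>+ r. ennreal ((1 - \<rho>\<^sup>2) powr (\<alpha> + 2) * (1 - \<rho> * r) powr (- 2 * \<alpha> - 3) * (1 - r\<^sup>2) powr \<alpha>)
        * (ennreal (2 * pi * r) * indicator {0..1} r) \<partial>lborel)"
      by (rule nn_integral_radial) measurable
    also have "\<dots> \<le> (\<integral>\<^sup>+ r. ennreal ((1 - \<rho>\<^sup>2) powr (\<alpha> + 2) * 2 powr \<bar>\<alpha>\<bar> * (2 * pi)) *
        (ennreal ((1 - \<rho> * r) powr (- 2 * \<alpha> - 3) * (1 - r) powr \<alpha>) * indicator {0..1} r) \<partial>lborel)"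
    proof (intro nn_integral_mono_AE)
      show "AE r in lborel. ennreal ((1 - \<rho>\<^sup>2) powr (\<alpha> + 2) * (1 - \<rho> * r) powr (- 2 * \<alpha> - 3) * (1 - r\<^sup>2) powr \<alpha>)
        * (ennreal (2 * pi * r) * indicator {0..1} r) \<le> ennreal ((1 - \<rho>\<^sup>2) powr (\<alpha> + 2) * 2 powr \<bar>\<alpha>\<bar> * (2 * pi)) *
        (ennreal ((1 - \<rho> * r) powr (- 2 * \<alpha> - 3) * (1 - r) powr \<alpha>) * indicator {0..1} r)"
        using AE_lborel_singleton[of 1]
      proof eventually_elim
        fix r :: real assume "r \<noteq> 1"
        show "ennreal ((1 - \<rho>\<^sup>2) powr (\<alpha> + 2) * (1 - \<rho> * r) powr (- 2 * \<alpha> - 3) * (1 - r\<^sup>2) powr \<alpha>)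
        * (ennreal (2 * pi * r) * indicator {0..1} r) \<le> ennreal ((1 - \<rho>\<^sup>2) powr (\<alpha> + 2) * 2 powr \<bar>\<alpha>\<bar> * (2 * pi)) *
        (ennreal ((1 - \<rho> * r) powr (- 2 * \<alpha> - 3) * (1 - r) powr \<alpha>) * indicator {0..1} r)"
        proof (cases "r \<in> {0..1}")
          case True
          \<comment> \<open>The absolute value covers negative \<alpha>, where (1 + r)^\<alpha> is
            at most 1.\<close>
          have "(1 + r) powr \<alpha> \<le> 2 powr \<bar>\<alpha>\<bar>"
          proof -
            have "(1 + r) powr \<alpha> \<le> (1 + r) powr \<bar>\<alpha>\<bar>" using True by (intro powr_mono) auto
            also have "\<dots> \<le> 2 powr \<bar>\<alpha>\<bar>" using True by (intro powr_mono2) auto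
            finally show ?thesis .
          qed
          moreover have "(1 - r\<^sup>2) powr \<alpha> = (1 + r) powr \<alpha> * (1 - r) powr \<alpha>"
            using True by (subst powr_mult[symmetric]) (auto simp: power2_eq_square algebra_simps)
          ultimately have 1: "(1 - r\<^sup>2) powr \<alpha> \<le> 2 powr \<bar>\<alpha>\<bar> * (1 - r) powr \<alpha>"
            by (simp add: mult_right_mono)
          have "(1 - \<rho>\<^sup>2) powr (\<alpha> + 2) * (1 - \<rho> * r) powr (- 2 * \<alpha> - 3) * (1 - r\<^sup>2) powr \<alpha> * (2 * pi * r)
              \<le> (1 - \<rho>\<^sup>2) powr (\<alpha> + 2) * (1 - \<rho> * r) powr (- 2 * \<alpha> - 3) * (2 powr \<bar>\<alpha>\<bar> * (1 - r) powr \<alpha>) * (2 * pi * 1)"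
            using True 1 by (intro mult_mono mult_nonneg_nonneg) auto
          then show ?thesis
            using True by (auto intro!: ennreal_leI simp: mult_ac simp flip: ennreal_mult)
        qed auto
      qed
    qed
    also have "\<dots> = ennreal ((1 - \<rho>\<^sup>2) powr (\<alpha> + 2) * 2 powr \<bar>\<alpha>\<bar> * (2 * pi)) *
        (\<integral>\<^sup>+ r. ennreal ((1 - \<rho> * r) powr (- 2 * \<alpha> - 3) * (1 - r) powr \<alpha>) * indicator {0..1} r \<partial>lborel)"
      by (rule nn_integral_cmult) measurable
    also have "\<dots> \<le> ennreal ((1 - \<rho>\<^sup>2) powr (\<alpha> + 2) * 2 powr \<bar>\<alpha>\<bar> * (2 * pi)) *
        ennreal ((1 - \<rho>) powr (- \<alpha> - 2) * (1 / (\<alpha> + 1) + 1 / (\<alpha> + 2)))"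
      by (intro mult_left_mono radial_kernel_bound \<alpha> \<rho>) auto
    also have "\<dots> = ennreal ((1 - \<rho>\<^sup>2) powr (\<alpha> + 2) * (1 - \<rho>) powr (- \<alpha> - 2) * (2 powr \<bar>\<alpha>\<bar> * (2 * pi) * (1 / (\<alpha> + 1) + 1 / (\<alpha> + 2))))"
      using \<alpha> by (subst ennreal_mult[symmetric]) (auto simp: mult_ac intro!: mult_nonneg_nonneg add_nonneg_nonneg)
    also have "\<dots> \<le> ennreal (2 powr (\<alpha> + 2) * (2 powr \<bar>\<alpha>\<bar> * (2 * pi) * (1 / (\<alpha> + 1) + 1 / (\<alpha> + 2))))"
    proof (intro ennreal_leI mult_right_mono)
      have "1 - \<rho>\<^sup>2 = (1 + \<rho>) * (1 - \<rho>)" by (simp add: power2_eq_square algebra_simps)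
      then have "(1 - \<rho>\<^sup>2) powr (\<alpha> + 2) * (1 - \<rho>) powr (- \<alpha> - 2) = (1 + \<rho>) powr (\<alpha> + 2) * ((1 - \<rho>) powr (\<alpha> + 2) * (1 - \<rho>) powr (- \<alpha> - 2))"
        using \<rho> by (simp add: powr_mult mult_ac)
      also have "(1 - \<rho>) powr (\<alpha> + 2) * (1 - \<rho>) powr (- \<alpha> - 2) = 1"
        using \<rho> by (simp flip: powr_add)
      also have "(1 + \<rho>) powr (\<alpha> + 2) * 1 \<le> 2 powr (\<alpha> + 2)"
        using \<rho> \<alpha> by (auto intro!: powr_mono2)
      finally show "(1 - \<rho>\<^sup>2) powr (\<alpha> + 2) * (1 - \<rho>) powr (- \<alpha> - 2) \<le> 2 powr (\<alpha> + 2)" .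
    qed (use \<alpha> in \<open>auto intro!: mult_nonneg_nonneg add_nonneg_nonneg\<close>)
    finally show "(\<integral>\<^sup>+ z. ennreal (kern a z powr (\<alpha> + 2) * (1 - (norm z)\<^sup>2) powr \<alpha>) * indicator disk z \<partial>lborel)
      \<le> ennreal C"
      by (simp add: C_def mult_ac)
  qed
qed

subsection \<open>Derivatives of the test functions\<close>

text \<open>Lets explicit recursions stand for iterated derivatives. The open set S may be larger
  than the disk, which later makes derivatives at points of the circle available.\<close>

lemma higher_deriv_eq_seq:
  fixes D :: "nat \<Rightarrow> complex \<Rightarrow> complex"
  assumes S: "open S" and D: "\<And>k z. z \<in> S \<Longrightarrow> (D k has_field_derivative D (Suc k) z) (at z)"
    and f: "\<And>z. z \<in> S \<Longrightarrow> f z = D 0 z" and z: "z \<in> S"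
  shows "(deriv ^^ k) f z = D k z"
  using z
proof (induction k arbitrary: z)
  case (Suc k)
  have "(deriv ^^ Suc k) f z = deriv (D k) z"
    using eventually_nhds_in_open[OF S Suc.prems]
    by (auto intro!: deriv_cong_ev elim!: eventually_mono simp: Suc.IH)
  also have "\<dots> = D (Suc k) z"
    using D[OF Suc.prems] by (rule DERIV_imp_deriv)
  finally show ?case .
qed (simp add: f)

text \<open>Leibniz' rule for (h \<phi>^i) \<phi>: terms with l < i vanish by induction and the top
  term by \<phi> w = 0, so that for order i + 1 only l = i survives. This is the triangular shape
  together with its diagonal.\<close>

lemma higher_deriv_zero_order:
  fixes h \<phi> :: "complex \<Rightarrow> complex"
  assumes S: "open S" "w \<in> S" and h: "h holomorphic_on S" and \<phi>: "\<phi> holomorphic_on S" "\<phi> w = 0"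
  shows "k < i \<Longrightarrow> (deriv ^^ k) (\<lambda>z. h z * \<phi> z ^ i) w = 0"
    and "(deriv ^^ i) (\<lambda>z. h z * \<phi> z ^ i) w = fact i * h w * deriv \<phi> w ^ i"
proof -
  have "(\<forall>k<i. (deriv ^^ k) (\<lambda>z. h z * \<phi> z ^ i) w = 0) \<and>
    (deriv ^^ i) (\<lambda>z. h z * \<phi> z ^ i) w = fact i * h w * deriv \<phi> w ^ i"
  proof (induction i)
    case (Suc i)
    let ?g = "\<lambda>z. h z * \<phi> z ^ i"
    have L: "(deriv ^^ k) (\<lambda>z. h z * \<phi> z ^ Suc i) w =
       (\<Sum>l = 0..k. of_nat (k choose l) * (deriv ^^ l) ?g w * (deriv ^^ (k - l)) \<phi> w)" for k
    proof -
      have "(\<lambda>z. h z * \<phi> z ^ Suc i) = (\<lambda>z. ?g z * \<phi> z)"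
        by (auto simp: mult_ac)
      moreover have "?g holomorphic_on S"
        by (intro holomorphic_intros h \<phi>)
      ultimately show ?thesis
        using higher_deriv_mult[of ?g S \<phi> w k] S \<phi>(1) by (simp only:)
    qed
    have "(deriv ^^ k) (\<lambda>z. h z * \<phi> z ^ Suc i) w = 0" if "k < Suc i" for k
      unfolding L
    proof (rule sum.neutral, rule ballI)
      fix l assume "l \<in> {0..k}"
      then show "of_nat (k choose l) * (deriv ^^ l) ?g w * (deriv ^^ (k - l)) \<phi> w = 0"
        using Suc.IH that \<phi>(2) by (cases "l < i") auto
    qed
    moreover have "(deriv ^^ Suc i) (\<lambda>z. h z * \<phi> z ^ Suc i) w = fact (Suc i) * h w * deriv \<phi> w ^ Suc i"
    proof -
      have "(\<Sum>l = 0..Suc i. of_nat (Suc i choose l) * (deriv ^^ l) ?g w * (deriv ^^ (Suc i - l)) \<phi> w)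
        = (\<Sum>l\<in>{i}. of_nat (Suc i choose l) * (deriv ^^ l) ?g w * (deriv ^^ (Suc i - l)) \<phi> w)"
      proof (rule sum.mono_neutral_right)
        show "\<forall>l\<in>{0..Suc i} - {i}. of_nat (Suc i choose l) * (deriv ^^ l) ?g w * (deriv ^^ (Suc i - l)) \<phi> w = 0"
        proof
          fix l assume "l \<in> {0..Suc i} - {i}"
          then have "l < i \<or> l = Suc i" by auto
          then show "of_nat (Suc i choose l) * (deriv ^^ l) ?g w * (deriv ^^ (Suc i - l)) \<phi> w = 0"
            using Suc.IH \<phi>(2) by auto
        qed
      qed auto
      then show ?thesis
        unfolding L using Suc.IH by (simp add: algebra_simps)
    qed
    ultimately show ?case by blast
  qed simp
  then show "k < i \<Longrightarrow> (deriv ^^ k) (\<lambda>z. h z * \<phi> z ^ i) w = 0"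
    and "(deriv ^^ i) (\<lambda>z. h z * \<phi> z ^ i) w = fact i * h w * deriv \<phi> w ^ i"
    by blast+
qed

section \<open>Triangular linear systems\<close>

text \<open>The ratio Q = 1 + C / \<kappa> is chosen so that the geometric sum closes up: C times
  the bounds for the later unknowns adds up to B (Q^(n-i) - 1), and the given B completes it to B
  Q^(n-i).\<close>

lemma backward_gronwall:
  fixes x :: "nat \<Rightarrow> real"
  assumes \<kappa>: "0 < \<kappa>" and C: "0 < C"
    and le: "\<And>i. i \<le> n \<Longrightarrow> \<kappa> * x i \<le> B + C * (\<Sum>k\<in>{i<..n}. x k)" and "i \<le> n"
  shows "x i \<le> B / \<kappa> * (1 + C / \<kappa>) ^ (n - i)"
  using \<open>i \<le> n\<close>
proof (induction "n - i" arbitrary: i rule: less_induct)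
  case less
  define Q where "Q = 1 + C / \<kappa>"
  have Q: "Q \<noteq> 1" using \<kappa> C by (simp add: Q_def)
  have "(\<Sum>k\<in>{i<..n}. x k) \<le> (\<Sum>k\<in>{i<..n}. B / \<kappa> * Q ^ (n - k))"
    unfolding Q_def using less.prems by (intro sum_mono less.hyps) auto
  also have "\<dots> = B / \<kappa> * (\<Sum>k\<in>{i<..n}. Q ^ (n - k))"
    by (simp add: sum_distrib_left)
  also have "(\<Sum>k\<in>{i<..n}. Q ^ (n - k)) = (\<Sum>m<n - i. Q ^ m)"
    by (rule sum.reindex_bij_witness[of _ "\<lambda>m. n - m" "\<lambda>k. n - k"]) auto
  also have "\<dots> = (Q ^ (n - i) - 1) / (Q - 1)"
    using Q by (rule geometric_sum)
  finally have "C * (\<Sum>k\<in>{i<..n}. x k) \<le> C * (B / \<kappa> * ((Q ^ (n - i) - 1) / (Q - 1)))"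
    using C by (intro mult_left_mono) auto
  also have "\<dots> = B * (Q ^ (n - i) - 1)"
    using C \<kappa> by (simp add: Q_def)
  finally have "\<kappa> * x i \<le> B * Q ^ (n - i)"
    using le[OF less.prems] by (simp add: algebra_simps)
  then show ?case
    using \<kappa> by (simp add: Q_def field_simps)
qed

text \<open>In the unknowns |c_k| s^k the diagonal is at least \<kappa> and the entries to its right
  are at most C, whatever s is. Hence the constant does not depend on s, which will be 1/\<delta>
  for the test functions and the exponent m for the monomials.\<close>

lemma triangular_bound:
  fixes c :: "nat \<Rightarrow> complex" and G :: "nat \<Rightarrow> nat \<Rightarrow> complex"
  assumes \<kappa>: "0 < \<kappa>" and C: "0 < C" and s: "0 < s"
    and zero: "\<And>i k. k < i \<Longrightarrow> i \<le> n \<Longrightarrow> G i k = 0"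
    and diag: "\<And>i. i \<le> n \<Longrightarrow> \<kappa> * s ^ i \<le> norm (G i i)"
    and up: "\<And>i k. i < k \<Longrightarrow> k \<le> n \<Longrightarrow> norm (G i k) \<le> C * s ^ k"
    and B: "\<And>i. i \<le> n \<Longrightarrow> norm (\<Sum>k\<le>n. c k * G i k) \<le> B" and k: "k \<le> n"
  shows "norm (c k) * s ^ k \<le> (1 + C / \<kappa>) ^ n / \<kappa> * B"
proof -
  have B0: "0 \<le> B" using B[of 0] norm_ge_zero order_trans by blast
  have "\<kappa> * (norm (c i) * s ^ i) \<le> B + C * (\<Sum>k\<in>{i<..n}. norm (c k) * s ^ k)" if i: "i \<le> n" for i
  proof -
    have "(\<Sum>k\<le>n. c k * G i k) = (\<Sum>k\<in>insert i {i<..n}. c k * G i k)"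
    proof (rule sum.mono_neutral_right)
      show "\<forall>k\<in>{..n} - insert i {i<..n}. c k * G i k = 0"
        using zero i by auto
    qed (use i in auto)
    also have "\<dots> = c i * G i i + (\<Sum>k\<in>{i<..n}. c k * G i k)"
      by simp
    finally have "norm (c i * G i i) = norm ((\<Sum>k\<le>n. c k * G i k) - (\<Sum>k\<in>{i<..n}. c k * G i k))"
      by simp
    also have "\<dots> \<le> B + (\<Sum>k\<in>{i<..n}. norm (c k * G i k))"
      using B[OF i] norm_sum[of "\<lambda>k. c k * G i k" "{i<..n}"]
      by (intro order_trans[OF norm_triangle_ineq4]) auto
    also have "(\<Sum>k\<in>{i<..n}. norm (c k * G i k)) \<le> (\<Sum>k\<in>{i<..n}. norm (c k) * (C * s ^ k))"
      using up by (intro sum_mono) (auto simp: norm_mult intro!: mult_left_mono)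
    also have "\<dots> = C * (\<Sum>k\<in>{i<..n}. norm (c k) * s ^ k)"
      by (simp add: sum_distrib_left mult_ac)
    finally have "norm (c i) * norm (G i i) \<le> B + C * (\<Sum>k\<in>{i<..n}. norm (c k) * s ^ k)"
      by (simp add: norm_mult)
    moreover have "norm (c i) * (\<kappa> * s ^ i) \<le> norm (c i) * norm (G i i)"
      using diag[OF i] by (rule mult_left_mono) simp
    ultimately show ?thesis by (simp add: mult_ac)
  qed
  then have "norm (c k) * s ^ k \<le> B / \<kappa> * (1 + C / \<kappa>) ^ (n - k)"
    using backward_gronwall[of \<kappa> C n "\<lambda>k. norm (c k) * s ^ k" B k] \<kappa> C k by blast
  also have "\<dots> \<le> B / \<kappa> * (1 + C / \<kappa>) ^ n"
    using B0 \<kappa> C by (intro mult_left_mono power_increasing) auto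
  finally show ?thesis by (simp add: mult_ac)
qed

text \<open>
  The \<open>k\<close>-th \<open>z\<close>-derivative of \<open>(a - z)\<^sup>j (1 - cnj a * z)\<^sup>-\<^sup>s\<close>. The recursion yields joint continuity and
  the bounds by induction, without Cauchy estimates near the circle.
\<close>

fun dtest :: "nat \<Rightarrow> nat \<Rightarrow> real \<Rightarrow> complex \<Rightarrow> complex \<Rightarrow> complex" where
  "dtest 0 j s a z = (a - z) ^ j * (1 - cnj a * z) powr - of_real s"
| "dtest (Suc k) j s a z = - of_nat j * dtest k (j - 1) s a z + of_real s * cnj a * dtest k j (s + 1) a z"

lemma Re_pos_not_nonpos: "0 < Re z \<Longrightarrow> z \<notin> \<real>\<^sub>\<le>\<^sub>0"
  by (auto simp: complex_nonpos_Reals_iff)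

text \<open>The hypothesis puts \<open>1 - cnj a * z\<close> into the right half-plane, off the
  branch cut of the principal power.\<close>

lemma dtest_has_derivative:
  assumes "Re (cnj a * z) < 1"
  shows "(dtest k j s a has_field_derivative dtest (Suc k) j s a z) (at z)"
proof (induction k arbitrary: j s)
  case 0
  have nz: "1 - cnj a * z \<notin> \<real>\<^sub>\<le>\<^sub>0"
    using assms by (intro Re_pos_not_nonpos) simp
  have 1: "((\<lambda>z. (1 - cnj a * z) powr - of_real s) has_field_derivative of_real s * cnj a * (1 - cnj a * z) powr - of_real (s + 1)) (at z)"
  proof -
    have i: "((\<lambda>z. 1 - cnj a * z) has_field_derivative - cnj a) (at z)"
      by (auto intro!: derivative_eq_intros)
    have e: "- of_real (s + 1) = - of_real s - (1 :: complex)"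
      by simp
    show ?thesis
      using DERIV_chain2[OF has_field_derivative_powr[OF nz, of "- of_real s"] i] by (simp add: e mult_ac)
  qed
  have "((\<lambda>z. (a - z) ^ j * (1 - cnj a * z) powr - of_real s) has_field_derivative
      of_nat j * (a - z) ^ (j - 1) * (0 - 1) * (1 - cnj a * z) powr - of_real s
      + of_real s * cnj a * (1 - cnj a * z) powr - of_real (s + 1) * (a - z) ^ j) (at z)"
    by (rule DERIV_mult[OF _ 1]) (auto intro!: derivative_eq_intros)
  then show ?case by (simp add: algebra_simps)
next
  case (Suc k)
  have eq: "dtest (Suc k) j s a = (\<lambda>z. - of_nat j * dtest k (j - 1) s a z + of_real s * cnj a * dtest k j (s + 1) a z)"
    by (rule ext) simp
  show ?case
    unfolding dtest.simps(2)[of "Suc k"] eq by (intro DERIV_add DERIV_cmult Suc)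
qed

text \<open>Continuity in the parameter a, with z allowed on the circle; this permits restricting
  suprema over a to a dense set.\<close>

lemma continuous_dtest_param:
  assumes "norm z \<le> 1"
  shows "continuous_on disk (\<lambda>a. dtest k j s a z)"
proof (induction k arbitrary: j s)
  case 0
  have pos: "0 < Re (1 - cnj a * z)" if "a \<in> disk" for a
  proof -
    have "norm (cnj a * z) < 1"
      using assms that mult_left_mono[of "norm z" 1 "norm a"] by (simp add: norm_mult)
    then show ?thesis
      using complex_Re_le_cmod[of "cnj a * z"] by simp
  qed
  have P: "continuous_on {w. 0 < Re w} (\<lambda>w::complex. w powr - of_real s)"
    by (rule DERIV_continuous_on[OF has_field_derivative_at_within[OF has_field_derivative_powr]])
      (auto intro!: Re_pos_not_nonpos)
  have c: "continuous_on disk (\<lambda>a. (1 - cnj a * z) powr - of_real s)"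
    by (rule continuous_on_compose2[OF P]) (use pos in \<open>auto intro!: continuous_intros\<close>)
  show ?case
    unfolding dtest.simps by (rule continuous_on_mult[OF _ c]) (intro continuous_intros)
next
  case (Suc k)
  show ?case
    unfolding dtest.simps by (intro continuous_intros Suc)
qed

text \<open>A degree count in |1 - cnj a * z|: the factor a - z has degree at least one by
  hypothesis, the power has degree -s, and both terms of the recursion for the next derivative have
  degree one lower.\<close>

lemma dtest_bound:
  shows "0 \<le> s \<Longrightarrow> \<exists>C>0. \<forall>a z. norm a \<le> 1 \<longrightarrow> Re (cnj a * z) < 1 \<longrightarrow> norm (a - z) \<le> norm (1 - cnj a * z) \<longrightarrow>
    norm (dtest k j s a z) \<le> C * norm (1 - cnj a * z) powr (real j - s - real k)"
proof (induction k arbitrary: j s)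
  case 0
  show ?case
  proof (intro exI[of _ 1] conjI allI impI)
    fix a z assume *: "norm (a - z) \<le> norm (1 - cnj a * z)" "Re (cnj a * z) < 1"
    have pos: "0 < norm (1 - cnj a * z)"
      using *(2) by (metis less_irrefl one_complex.simps(1) right_minus_eq zero_less_norm_iff)
    have "norm (dtest 0 j s a z) = norm (a - z) ^ j * norm (1 - cnj a * z) powr - s"
      by (simp add: norm_mult norm_power norm_powr_real_powr')
    also have "\<dots> \<le> norm (1 - cnj a * z) ^ j * norm (1 - cnj a * z) powr - s"
      using * by (intro mult_right_mono power_mono) auto
    also have "\<dots> = norm (1 - cnj a * z) powr (real j - s)"
      using pos by (simp add: powr_diff powr_minus powr_realpow divide_inverse)
    finally show "norm (dtest 0 j s a z) \<le> 1 * norm (1 - cnj a * z) powr (real j - s - real 0)"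
      by simp
  qed simp
next
  case (Suc k)
  obtain C1 where C1: "0 < C1" "\<And>a z. norm a \<le> 1 \<Longrightarrow> Re (cnj a * z) < 1 \<Longrightarrow> norm (a - z) \<le> norm (1 - cnj a * z) \<Longrightarrow>
    norm (dtest k (j - 1) s a z) \<le> C1 * norm (1 - cnj a * z) powr (real (j - 1) - s - real k)"
    using Suc.IH[OF Suc.prems, of "j - 1"] by blast
  have "0 \<le> s + 1" using Suc.prems by simp
  then obtain C2 where C2: "0 < C2" "\<And>a z. norm a \<le> 1 \<Longrightarrow> Re (cnj a * z) < 1 \<Longrightarrow> norm (a - z) \<le> norm (1 - cnj a * z) \<Longrightarrow>
    norm (dtest k j (s + 1) a z) \<le> C2 * norm (1 - cnj a * z) powr (real j - (s + 1) - real k)"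
    using Suc.IH by blast
  show ?case
  proof (intro exI[of _ "real j * C1 + s * C2 + 1"] conjI allI impI)
    fix a z :: complex assume *: "norm a \<le> 1" "Re (cnj a * z) < 1" "norm (a - z) \<le> norm (1 - cnj a * z)"
    define b where "b = norm (1 - cnj a * z) powr (real j - s - real (Suc k))"
    \<comment> \<open>For j = 0 the truncated j - 1 would give the wrong exponent, but the factor j
      is then 0.\<close>
    have 1: "real j * norm (dtest k (j - 1) s a z) \<le> real j * (C1 * b)"
    proof (cases j)
      case (Suc j')
      have "real (j - 1) - s - real k = real j - s - real (Suc k)" using Suc by simp
      then have "norm (dtest k (j - 1) s a z) \<le> C1 * b"
        using C1(2)[OF *] unfolding b_def by (simp only:)
      then show ?thesis by (rule mult_left_mono) simp
    qed simp
    have "real j - (s + 1) - real k = real j - s - real (Suc k)" by simp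
    then have 2: "norm (dtest k j (s + 1) a z) \<le> C2 * b"
      using C2(2)[OF *] unfolding b_def by (simp only:)
    have "norm (dtest (Suc k) j s a z) \<le> real j * norm (dtest k (j - 1) s a z) + s * norm a * norm (dtest k j (s + 1) a z)"
      using Suc.prems by (simp, intro order_trans[OF norm_triangle_ineq4] order_trans[OF norm_triangle_ineq]) (auto simp: norm_mult)
    also have "\<dots> \<le> real j * (C1 * b) + s * 1 * (C2 * b)"
    proof (rule add_mono[OF 1])
      show "s * norm a * norm (dtest k j (s + 1) a z) \<le> s * 1 * (C2 * b)"
        using 2 Suc.prems *(1) by (intro mult_mono) auto
    qed
    also have "\<dots> \<le> (real j * C1 + s * C2 + 1) * b"
      by (simp add: algebra_simps b_def)
    finally show "norm (dtest (Suc k) j s a z) \<le> (real j * C1 + s * C2 + 1) * norm (1 - cnj a * z) powr (real j - s - real (Suc k))"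
      by (simp add: b_def)
  qed (use C1(1) C2(1) Suc.prems in \<open>auto intro!: add_nonneg_pos mult_nonneg_nonneg add_nonneg_nonneg\<close>)
qed

text \<open>With Re B > 0 the argument of B stays within pi/2, so Ln (A / B^2) = ln A - 2 Ln B
  without a multiple of 2 pi \<i>. The principal power of the quotient therefore splits into powers
  of A and B.\<close>

lemma test_fun_sigma_eq:
  assumes a: "norm a < 1" and z: "Re (cnj a * z) < 1"
  shows "test_fun \<gamma> a z * sigma a z ^ j = of_real ((1 - (norm a)\<^sup>2) powr \<gamma>) * dtest 0 j (2 * \<gamma> + real j) a z"
proof -
  define A B where "A = 1 - (norm a)\<^sup>2" and "B = 1 - cnj a * z"
  have A: "0 < A" using a by (simp add: A_def abs_square_less_1)
  have B: "0 < Re B" using z by (simp add: B_def)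
  then have B0: "B \<noteq> 0" by auto
  have Im: "\<bar>Im (Ln B)\<bar> < pi / 2" using B by (rule Re_Ln_pos_lt_imp)
  have Ln: "Ln (of_real A / B\<^sup>2) = of_real (ln A) - 2 * Ln B"
  proof (rule Ln_unique)
    have "exp (of_real (ln A) - 2 * Ln B) = exp (of_real (ln A)) / (exp (Ln B))\<^sup>2"
      by (simp add: exp_diff exp_double)
    moreover have "exp (of_real (ln A)) = (of_real A :: complex)"
      using A by (metis exp_ln exp_of_real)
    ultimately show "exp (of_real (ln A) - 2 * Ln B) = of_real A / B\<^sup>2"
      using B0 by simp
  qed (use Im in auto)
  have "test_fun \<gamma> a z = exp (of_real \<gamma> * (of_real (ln A) - 2 * Ln B))"
    using A B0 by (simp add: test_fun_def powr_def Ln flip: A_def B_def)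
  also have "\<dots> = of_real (A powr \<gamma>) * exp (- (2 * of_real \<gamma> * Ln B))"
  proof -
    have "of_real (A powr \<gamma>) = exp (of_real \<gamma> * of_real (ln A) :: complex)"
      using A by (simp add: powr_def exp_of_real[symmetric])
    then show ?thesis
      by (simp add: exp_add[symmetric] algebra_simps)
  qed
  finally have t: "test_fun \<gamma> a z = of_real (A powr \<gamma>) * exp (- (2 * of_real \<gamma> * Ln B))" .
  have "sigma a z ^ j = (a - z) ^ j / exp (of_nat j * Ln B)"
    using B0 by (simp add: sigma_def power_divide exp_of_nat_mult flip: B_def)
  also have "\<dots> = (a - z) ^ j * exp (- (of_nat j * Ln B))"
    by (simp add: exp_minus divide_inverse)
  finally have "test_fun \<gamma> a z * sigma a z ^ j =
      of_real (A powr \<gamma>) * ((a - z) ^ j * (exp (- (2 * of_real \<gamma> * Ln B)) * exp (- (of_nat j * Ln B))))"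
    unfolding t by simp
  also have "exp (- (2 * of_real \<gamma> * Ln B)) * exp (- (of_nat j * Ln B)) = B powr - of_real (2 * \<gamma> + real j)"
    using B0 by (simp add: powr_def exp_add[symmetric] algebra_simps)
  finally show ?thesis
    by (simp add: A_def B_def)
qed


text \<open>These are the coefficients of (x - y)^i in powers of x, so test functions vanishing to
  order i are combinations of the given ones with total weight at most 2^n.\<close>

lemma binomial_weights_le:
  fixes y :: complex
  assumes y: "norm y \<le> 1" and i: "i \<le> n"
  shows "(\<Sum>j\<le>i. norm (of_nat (i choose j) * (- y) ^ (i - j))) \<le> 2 ^ n"
proof -
  have "(\<Sum>j\<le>i. norm (of_nat (i choose j) * (- y) ^ (i - j))) \<le> (\<Sum>j\<le>i. real (i choose j))"
    using y by (intro sum_mono) (auto simp: norm_mult norm_power mult_left_le power_le_one)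
  also have "\<dots> = 2 ^ i"
    by (metis choose_row_sum of_nat_numeral of_nat_power of_nat_sum)
  also have "\<dots> \<le> 2 ^ n" using i by (intro power_increasing) auto
  finally show ?thesis .
qed

lemma norm_combination_le:
  fixes x \<beta> :: "nat \<Rightarrow> complex"
  assumes x: "\<And>j. j \<le> i \<Longrightarrow> norm (x j) \<le> N" and L: "(\<Sum>j\<le>i. norm (\<beta> j)) \<le> L" and N: "0 \<le> N"
  shows "norm (\<Sum>j\<le>i. \<beta> j * x j) \<le> L * N"
proof -
  have "norm (\<Sum>j\<le>i. \<beta> j * x j) \<le> (\<Sum>j\<le>i. norm (\<beta> j) * norm (x j))"
    unfolding norm_mult[symmetric] by (rule norm_sum)
  also have "\<dots> \<le> (\<Sum>j\<le>i. norm (\<beta> j) * N)"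
    using x by (intro sum_mono mult_left_mono) auto
  also have "\<dots> = (\<Sum>j\<le>i. norm (\<beta> j)) * N"
    by (simp add: sum_distrib_right)
  also have "\<dots> \<le> L * N"
    using L N by (rule mult_right_mono)
  finally show ?thesis .
qed

text \<open>
  \<open>ptest \<gamma> j k a\<close> is the \<open>k\<close>-th derivative of \<open>f\<^sub>a (\<sigma>\<^sub>a)\<^sup>j\<close>, continued to the half-plane \<open>Re (cnj a * z) < 1\<close>,
  which contains the closed disk.
\<close>

definition ptest :: "real \<Rightarrow> nat \<Rightarrow> nat \<Rightarrow> complex \<Rightarrow> complex \<Rightarrow> complex" where
  "ptest \<gamma> j k a z = of_real ((1 - (norm a)\<^sup>2) powr \<gamma>) * dtest k j (2 * \<gamma> + real j) a z"

lemma open_test_domain: "open {z. Re (cnj a * z) < 1}"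
  by (intro open_Collect_less continuous_intros)

lemma test_domain:
  assumes "norm a < 1" "norm z \<le> 1"
  shows "Re (cnj a * z) < 1"
proof -
  have "norm (cnj a * z) < 1"
    using assms mult_left_mono[of "norm z" 1 "norm a"] by (simp add: norm_mult)
  then show ?thesis
    using complex_Re_le_cmod[of "cnj a * z"] by simp
qed

lemma ptest_has_derivative:
  assumes "Re (cnj a * z) < 1"
  shows "(ptest \<gamma> j k a has_field_derivative ptest \<gamma> j (Suc k) a z) (at z)"
  unfolding ptest_def[abs_def] by (intro DERIV_cmult dtest_has_derivative assms)

text \<open>Test functions and monomials continue past the circle. Their radial limits are then
  values of the continuation G, with which F need only agree on the disk and at w itself.\<close>

lemma bv_eq:
  assumes "isCont G w" "norm w \<le> 1" "\<And>z. z \<in> disk \<union> {w} \<Longrightarrow> F z = G z"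
  shows "bv F w = G w" and "has_bv F w"
proof -
  have "bv F w = G w \<and> has_bv F w"
  proof (cases "w \<in> disk")
    case True
    then show ?thesis using assms(3) by (simp add: bv_def has_bv_def)
  next
    case False
    then have w: "norm w = 1" using assms(2) by simp
    have "((\<lambda>r. G (of_real r * w)) \<longlongrightarrow> G (of_real 1 * w)) (at_left (1::real))"
      by (intro isCont_tendsto_compose[where g = G] tendsto_intros) (use assms(1) in auto)
    moreover have "\<forall>\<^sub>F r in at_left (1::real). F (of_real r * w) = G (of_real r * w)"
    proof (rule eventually_at_leftI[of 0])
      fix r :: real assume "r \<in> {0<..<1}"
      then show "F (of_real r * w) = G (of_real r * w)"
        using w by (intro assms(3)) (auto simp: norm_mult)
    qed simp
    ultimately have lim: "radial_limit F w (G w)"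
      unfolding radial_limit_def by (simp add: tendsto_cong)
    moreover have "l = G w" if "radial_limit F w l" for l
      using lim that unfolding radial_limit_def by (intro tendsto_unique[of "at_left (1::real)"]) auto
    ultimately have "(THE l. radial_limit F w l) = G w" by blast
    then show ?thesis using lim w by (auto simp: bv_def has_bv_def)
  qed
  then show "bv F w = G w" and "has_bv F w" by auto
qed

section \<open>Size of the test functions and their derivatives\<close>

text \<open>Divided by |1 - cnj a * z|^2, the identity is the classical formula for 1 -
  |\<sigma>_a(z)|^2.\<close>

lemma sigma_cross_le:
  assumes "norm a \<le> 1" "norm z \<le> 1"
  shows "(1 - (norm a)\<^sup>2) * (1 - (norm z)\<^sup>2) = (norm (1 - cnj a * z))\<^sup>2 - (norm (a - z))\<^sup>2"
    and "norm (a - z) \<le> norm (1 - cnj a * z)"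
proof -
  show eq: "(1 - (norm a)\<^sup>2) * (1 - (norm z)\<^sup>2) = (norm (1 - cnj a * z))\<^sup>2 - (norm (a - z))\<^sup>2"
    unfolding cmod_power2 by (simp add: power2_eq_square algebra_simps)
  have "0 \<le> (1 - (norm a)\<^sup>2) * (1 - (norm z)\<^sup>2)"
    using assms by (intro mult_nonneg_nonneg) (auto simp: power_le_one)
  then have "(norm (a - z))\<^sup>2 \<le> (norm (1 - cnj a * z))\<^sup>2"
    unfolding eq by (simp only: diff_ge_0_iff_ge)
  then show "norm (a - z) \<le> norm (1 - cnj a * z)"
    by (rule power2_le_imp_le) simp
qed

lemma one_minus_norm_sq_le:
  assumes "norm a < 1" "norm z \<le> 1"
  shows "1 - (norm a)\<^sup>2 \<le> 2 * norm (1 - cnj a * z)" and "1 - (norm z)\<^sup>2 \<le> 2 * norm (1 - cnj a * z)"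
    and "0 < norm (1 - cnj a * z)"
proof -
  have sq: "1 - x\<^sup>2 \<le> 2 * (1 - x)" for x :: real
    using zero_le_power2[of "1 - x"] by (simp add: power2_eq_square algebra_simps)
  have "norm a * norm z \<le> norm a" "norm a * norm z \<le> norm z"
    using assms by (auto intro: mult_left_le mult_right_le_one_le mult_left_le_one_le)
  then have "1 - norm a \<le> norm (1 - cnj a * z)" "1 - norm z \<le> norm (1 - cnj a * z)"
    using one_minus_norm_mult_le[of a z] by linarith+
  note le0 = this
  then have le: "2 * (1 - norm a) \<le> 2 * norm (1 - cnj a * z)" "2 * (1 - norm z) \<le> 2 * norm (1 - cnj a * z)"
    by simp_all
  show "1 - (norm a)\<^sup>2 \<le> 2 * norm (1 - cnj a * z)"
    using sq le(1) by (rule order_trans)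
  show "1 - (norm z)\<^sup>2 \<le> 2 * norm (1 - cnj a * z)"
    using sq le(2) by (rule order_trans)
  show "0 < norm (1 - cnj a * z)"
    using assms(1) by (intro less_le_trans[OF _ le0(1)]) simp
qed

text \<open>With b = |1 - cnj a * z|, the factor (1 - |a|^2)^\<gamma> is at most (2 b)^\<gamma>, and
  \<open>dtest\<close> with s = 2\<gamma> + j has degree -2\<gamma> - k. The power j cancels, so
  every (\<sigma>_a)^j obeys the same exponent.\<close>

lemma ptest_bound:
  assumes "0 \<le> \<gamma>"
  shows "\<exists>C>0. \<forall>a z. norm a < 1 \<longrightarrow> norm z \<le> 1 \<longrightarrow>
    norm (ptest \<gamma> j k a z) \<le> C * norm (1 - cnj a * z) powr - (real k + \<gamma>)"
proof -
  have "0 \<le> 2 * \<gamma> + real j" using assms by simp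
  then obtain C where C: "C > 0" "\<And>a z. norm a \<le> 1 \<Longrightarrow> Re (cnj a * z) < 1 \<Longrightarrow> norm (a - z) \<le> norm (1 - cnj a * z) \<Longrightarrow>
    norm (dtest k j (2 * \<gamma> + real j) a z) \<le> C * norm (1 - cnj a * z) powr (real j - (2 * \<gamma> + real j) - real k)"
    using dtest_bound[of "2 * \<gamma> + real j" k j] by blast
  show ?thesis
  proof (intro exI[of _ "2 powr \<gamma> * C"] conjI allI impI)
    fix a z :: complex assume az: "norm a < 1" "norm z \<le> 1"
    define b where "b = norm (1 - cnj a * z)"
    have b: "0 < b" "1 - (norm a)\<^sup>2 \<le> 2 * b"
      using one_minus_norm_sq_le[OF az] by (auto simp: b_def)
    have "(1 - (norm a)\<^sup>2) powr \<gamma> \<le> (2 * b) powr \<gamma>"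
      using b az assms by (intro powr_mono2) (auto simp: power_le_one)
    also have "\<dots> = 2 powr \<gamma> * b powr \<gamma>"
      using b by (simp add: powr_mult)
    finally have 1: "(1 - (norm a)\<^sup>2) powr \<gamma> \<le> 2 powr \<gamma> * b powr \<gamma>" .
    have "norm (dtest k j (2 * \<gamma> + real j) a z) \<le> C * b powr (real j - (2 * \<gamma> + real j) - real k)"
      unfolding b_def using az by (intro C(2) test_domain sigma_cross_le(2)) auto
    with 1 have "norm (ptest \<gamma> j k a z) \<le> (2 powr \<gamma> * b powr \<gamma>) * (C * b powr (real j - (2 * \<gamma> + real j) - real k))"
      unfolding ptest_def norm_mult by (intro mult_mono) auto
    also have "\<dots> = 2 powr \<gamma> * C * (b powr \<gamma> * b powr (real j - (2 * \<gamma> + real j) - real k))"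
      by simp
    also have "b powr \<gamma> * b powr (real j - (2 * \<gamma> + real j) - real k) = b powr - (real k + \<gamma>)"
      by (subst powr_add[symmetric]) (simp add: algebra_simps)
    finally show "norm (ptest \<gamma> j k a z) \<le> 2 powr \<gamma> * C * b powr - (real k + \<gamma>)" .
  qed (use C(1) in simp)
qed

lemma ptest_bound_uniform:
  assumes "0 \<le> \<gamma>"
  obtains C where "0 < C" "\<And>j k a z. j \<le> n \<Longrightarrow> k \<le> n \<Longrightarrow> norm a < 1 \<Longrightarrow> norm z \<le> 1 \<Longrightarrow>
    norm (ptest \<gamma> j k a z) \<le> C * norm (1 - cnj a * z) powr - (real k + \<gamma>)"
proof -
  have "\<forall>jk. \<exists>C>0. \<forall>a z. norm a < 1 \<longrightarrow> norm z \<le> 1 \<longrightarrow>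
    norm (ptest \<gamma> (fst jk) (snd jk) a z) \<le> C * norm (1 - cnj a * z) powr - (real (snd jk) + \<gamma>)"
    by (intro allI ptest_bound[OF assms])
  from choice[OF this] obtain C where C': "\<forall>jk. 0 < C jk \<and> (\<forall>a z. norm a < 1 \<longrightarrow> norm z \<le> 1 \<longrightarrow>
    norm (ptest \<gamma> (fst jk) (snd jk) a z) \<le> C jk * norm (1 - cnj a * z) powr - (real (snd jk) + \<gamma>))" ..
  have C: "norm (ptest \<gamma> j k a z) \<le> C (j, k) * norm (1 - cnj a * z) powr - (real k + \<gamma>)"
    if "norm a < 1" "norm z \<le> 1" for j k a z
    using C'[THEN spec, of "(j, k)", THEN conjunct2] that unfolding fst_conv snd_conv by blast
  have C0: "0 < C jk" for jk
    using C' by blast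
  define K where "K = (\<Sum>jk\<in>{..n} \<times> {..n}. C jk)"
  have "0 < K"
    unfolding K_def by (rule sum_pos) (simp_all add: C0)
  moreover have "norm (ptest \<gamma> j k a z) \<le> K * norm (1 - cnj a * z) powr - (real k + \<gamma>)"
    if "j \<le> n" "k \<le> n" "norm a < 1" "norm z \<le> 1" for j k a z
  proof -
    have "C (j, k) \<le> K"
      unfolding K_def using that C0 by (intro member_le_sum) (auto intro: less_imp_le)
    from C[OF that(3,4)] show ?thesis
      by (rule order_trans[OF _ mult_right_mono[OF \<open>C (j, k) \<le> K\<close>]]) simp
  qed
  ultimately show thesis by (rule that)
qed

subsection \<open>Recovering the coefficients from the test functions\<close>

text \<open>\<open>Q_fun\<close> with the numbers u_k(z) and \<tau>(z) replaced by independent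
  variables, so that the estimates concern one coefficient vector and one point of the closed
  disk.\<close>

definition Q_val :: "real \<Rightarrow> (nat \<Rightarrow> complex) \<Rightarrow> complex \<Rightarrow> nat \<Rightarrow> ennreal" where
  "Q_val \<gamma> c w k = ennreal (norm (c k)) /
     (if real k + \<gamma> = 0 then 1 else ennreal ((1 - (norm w)\<^sup>2) powr (real k + \<gamma>)))"

lemma Q_val_disk:
  assumes "norm w < 1"
  shows "Q_val \<gamma> c w k = ennreal (norm (c k) * (1 - (norm w)\<^sup>2) powr - (real k + \<gamma>))"
proof -
  define d e where "d = 1 - (norm w)\<^sup>2" and "e = real k + \<gamma>"
  have d: "0 < d" using assms by (simp add: abs_square_less_1 d_def)
  show ?thesis
  proof (cases "e = 0")
    case True
    then show ?thesis
      using d unfolding Q_val_def e_def[symmetric] d_def[symmetric] by (simp flip: ennreal_1 add: divide_ennreal)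
  next
    case False
    then show ?thesis
      using d unfolding Q_val_def e_def[symmetric] d_def[symmetric] by (simp add: divide_ennreal powr_minus_divide)
  qed
qed

text \<open>On the circle the weight degenerates: finiteness becomes the vanishing of c k, unless k
  + \<gamma> = 0.\<close>

lemma Q_val_circle:
  assumes "norm w = 1"
  shows "Q_val \<gamma> c w k = (if real k + \<gamma> = 0 then ennreal (norm (c k)) else if c k = 0 then 0 else top)"
  using assms by (auto simp: Q_val_def ennreal_divide_zero ennreal_top_divide divide_ennreal_def)

lemma one_div_powr: "(1 / d) powr e = d powr - e" if "0 < d" for d e :: real
  using that by (simp add: powr_minus_divide powr_divide)

lemma mult_powr_bounded_imp_zero:
  fixes x A e :: real
  assumes "0 < e" "0 \<le> x" and le: "\<And>T. \<exists>t\<ge>T. 0 < t \<and> x * t powr e \<le> A"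
  shows "x = 0"
proof (rule ccontr)
  assume "x \<noteq> 0"
  then have x: "0 < x" using assms by simp
  define T where "T = ((\<bar>A\<bar> + 1) / x) powr (1 / e)"
  obtain t where t: "T \<le> t" "x * t powr e \<le> A" using le by blast
  have "(\<bar>A\<bar> + 1) / x = T powr e"
    using x assms by (simp add: T_def powr_powr)
  also have "\<dots> \<le> t powr e"
    using t assms by (intro powr_mono2) (auto simp: T_def)
  finally have "\<bar>A\<bar> + 1 \<le> x * t powr e"
    using x by (simp add: field_simps)
  then show False using t by linarith
qed

text \<open>Put a = r w and \<delta> = \<open>1 - cnj a * w\<close>, a positive number. From r^2
  \<le> r follows 1 - |a|^2 \<ge> \<delta>, hence |\<sigma>_a'(w)| = (1 - |a|^2) / \<delta>^2 \<ge>
  1/\<delta> and |f_a(w)| \<ge> \<delta>^(-\<gamma>). So \<open>triangular_bound\<close> applies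
  with \<kappa> = 1 and s = 1/\<delta>. The radius r is kept free because a = w is not allowed when
  |w| = 1.\<close>

lemma Q_val_le_test_aux:
  assumes \<gamma>: "0 \<le> \<gamma>"
  obtains K where "0 < K" "\<And>c w r M k. norm w \<le> 1 \<Longrightarrow> 0 \<le> r \<Longrightarrow> r \<le> 1 \<Longrightarrow> r * norm w < 1 \<Longrightarrow>
    (\<And>j a. j \<le> n \<Longrightarrow> norm a < 1 \<Longrightarrow> norm (\<Sum>k\<le>n. c k * ptest \<gamma> j k a w) \<le> M) \<Longrightarrow> k \<le> n \<Longrightarrow>
    norm (c k) * (1 / (1 - r * (norm w)\<^sup>2)) powr (real k + \<gamma>) \<le> K * M"
proof -
  obtain C where C: "0 < C" "\<And>j k a z. j \<le> n \<Longrightarrow> k \<le> n \<Longrightarrow> norm a < 1 \<Longrightarrow> norm z \<le> 1 \<Longrightarrow>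
    norm (ptest \<gamma> j k a z) \<le> C * norm (1 - cnj a * z) powr - (real k + \<gamma>)"
    using ptest_bound_uniform[OF \<gamma>] by metis
  \<comment> \<open>The mass 2^n of the binomial weights enters twice: here for the matrix entries,
    and in K for the right-hand side.\<close>
  define C' where "C' = 2 ^ n * C"
  have C': "0 < C'" using C(1) by (simp add: C'_def)
  define K where "K = (1 + C' / 1) ^ n / 1 * 2 ^ n"
  have "0 < K" using C' by (simp add: K_def)
  moreover have "norm (c k) * (1 / (1 - r * (norm w)\<^sup>2)) powr (real k + \<gamma>) \<le> K * M"
    if w: "norm w \<le> 1" and r: "0 \<le> r" "r \<le> 1" "r * norm w < 1"
      and M: "\<And>j a. j \<le> n \<Longrightarrow> norm a < 1 \<Longrightarrow> norm (\<Sum>k\<le>n. c k * ptest \<gamma> j k a w) \<le> M" and k: "k \<le> n"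
    for c w r M k
  proof -
    define a where "a = of_real r * w"
    have a: "norm a < 1" using r by (simp add: a_def norm_mult)
    define \<delta> where "\<delta> = 1 - r * (norm w)\<^sup>2"
    have B: "1 - cnj a * w = of_real \<delta>"
    proof -
      have "cnj w * w = of_real ((norm w)\<^sup>2)"
        by (metis complex_norm_square mult.commute of_real_power)
      then show ?thesis by (simp add: a_def \<delta>_def mult.assoc)
    qed
    have rw: "r * (norm w)\<^sup>2 \<le> r * norm w"
      using w r by (intro mult_left_mono) (auto simp: power2_eq_square mult_left_le)
    then have \<delta>: "0 < \<delta>" using r by (simp add: \<delta>_def)
    have a2: "\<delta> \<le> 1 - (norm a)\<^sup>2"
    proof -
      have "r\<^sup>2 * (norm w)\<^sup>2 \<le> r * (norm w)\<^sup>2"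
        using r by (intro mult_right_mono) (auto simp: power2_eq_square mult_left_le)
      then show ?thesis by (simp add: \<delta>_def a_def norm_mult power_mult_distrib)
    qed
    \<comment> \<open>A half-plane instead of the disk: it is open and contains w even when |w| =
      1.\<close>
    define H where "H = {z. Re (cnj a * z) < 1}"
    have H: "open H" "w \<in> H"
      unfolding H_def using open_test_domain[of a] test_domain[OF a w] by simp_all
    have nzp: "1 - cnj a * z \<notin> \<real>\<^sub>\<le>\<^sub>0" if "z \<in> H" for z
      using that by (intro Re_pos_not_nonpos) (simp add: H_def)
    have nzH: "1 - cnj a * z \<noteq> 0" if "z \<in> H" for z
      using nzp[OF that] by (metis nonpos_Reals_zero_I)
    define y where "y = sigma a w"
    have y: "norm y \<le> 1"
      using sigma_cross_le(2)[of a w] a w one_minus_norm_sq_le(3)[OF a w]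
      by (simp add: y_def sigma_def norm_divide)
    define h where "h = (\<lambda>z. of_real ((1 - (norm a)\<^sup>2) powr \<gamma>) * dtest 0 0 (2 * \<gamma> + real 0) a z)"
    have h_eq: "test_fun \<gamma> a z = h z" if "z \<in> H" for z
      using test_fun_sigma_eq[OF a, of z \<gamma> 0] that by (simp add: h_def H_def)
    have hol_h: "h holomorphic_on H"
      unfolding h_def dtest.simps by (intro holomorphic_intros) (use nzp in auto)
    have hol_s: "sigma a holomorphic_on H"
      unfolding sigma_def[abs_def] by (intro holomorphic_intros) (use nzH in auto)
    \<comment> \<open>Row i belongs to f_a (\<sigma>_a - \<sigma>_a(w))^i, expanded binomially so
      that only derivatives of the given test functions occur.\<close>
    define G where "G = (\<lambda>i k. \<Sum>j\<le>i. of_nat (i choose j) * (- y) ^ (i - j) * ptest \<gamma> j k a w)"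
    have G: "(deriv ^^ k) (\<lambda>z. h z * (sigma a z - y) ^ i) w = G i k" for i k
      unfolding G_def
    proof (rule higher_deriv_eq_seq[OF H(1), where D = "\<lambda>k z. \<Sum>j\<le>i. of_nat (i choose j) * (- y) ^ (i - j) * ptest \<gamma> j k a z"])
      fix k z assume z: "z \<in> H"
      show "((\<lambda>z. \<Sum>j\<le>i. of_nat (i choose j) * (- y) ^ (i - j) * ptest \<gamma> j k a z) has_field_derivative
        (\<Sum>j\<le>i. of_nat (i choose j) * (- y) ^ (i - j) * ptest \<gamma> j (Suc k) a z)) (at z)"
        using z by (intro DERIV_sum DERIV_cmult ptest_has_derivative) (simp add: H_def)
      have p: "ptest \<gamma> j 0 a z = h z * sigma a z ^ j" for j
        using test_fun_sigma_eq[OF a, of z \<gamma> j] z h_eq[OF z] unfolding ptest_def H_def by simp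
      show "h z * (sigma a z - y) ^ i = (\<Sum>j\<le>i. of_nat (i choose j) * (- y) ^ (i - j) * ptest \<gamma> j 0 a z)"
        unfolding p using binomial_ring[of "sigma a z" "- y" i]
        by (simp add: sum_distrib_left mult_ac)
    qed (rule H(2))
    have d_sigma: "norm (deriv (\<lambda>z. sigma a z - y) w) \<ge> 1 / \<delta>"
    proof -
      have "((\<lambda>z. sigma a z - y) has_field_derivative ((0 - 1) * (1 - cnj a * w) - (a - w) * (0 - cnj a * 1)) / ((1 - cnj a * w) * (1 - cnj a * w)) - 0) (at w)"
        unfolding sigma_def[abs_def] using nzH[OF H(2)] by (auto intro!: derivative_eq_intros simp: field_simps)
      then have "deriv (\<lambda>z. sigma a z - y) w = ((0 - 1) * (1 - cnj a * w) - (a - w) * (0 - cnj a * 1)) / ((1 - cnj a * w) * (1 - cnj a * w)) - 0"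
        by (rule DERIV_imp_deriv)
      also have "\<dots> = - of_real (1 - (norm a)\<^sup>2) / of_real (\<delta> * \<delta>)"
      proof -
        have aa: "a * cnj a = of_real ((norm a)\<^sup>2)"
          by (metis complex_norm_square of_real_power)
        have num: "(0 - 1) * (1 - cnj a * w) - (a - w) * (0 - cnj a * 1) = - (1 - a * cnj a)"
          by (simp add: algebra_simps)
        show ?thesis
          unfolding num aa unfolding B by simp
      qed
      finally have "norm (deriv (\<lambda>z. sigma a z - y) w) = (1 - (norm a)\<^sup>2) / (\<delta> * \<delta>)"
        using a2 \<delta> by (simp add: norm_divide del: of_real_mult of_real_diff of_real_power)
      moreover have "\<delta> / (\<delta> * \<delta>) \<le> (1 - (norm a)\<^sup>2) / (\<delta> * \<delta>)"
        using a2 \<delta> by (intro divide_right_mono) auto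
      ultimately show ?thesis using \<delta> by simp
    qed
    have h_w: "norm (h w) \<ge> \<delta> powr - \<gamma>"
    proof -
      have "norm (h w) = (1 - (norm a)\<^sup>2) powr \<gamma> * \<delta> powr - (2 * \<gamma>)"
        using \<delta> by (simp add: h_def norm_mult B norm_powr_real_powr')
      moreover have "\<delta> powr \<gamma> * \<delta> powr - (2 * \<gamma>) \<le> (1 - (norm a)\<^sup>2) powr \<gamma> * \<delta> powr - (2 * \<gamma>)"
        using a2 \<delta> \<gamma> by (intro mult_right_mono powr_mono2) auto
      moreover have "\<delta> powr \<gamma> * \<delta> powr - (2 * \<gamma>) = \<delta> powr - \<gamma>"
        by (subst powr_add[symmetric]) simp
      ultimately show ?thesis by simp
    qed
    \<comment> \<open>The factor \<delta>^\<gamma> removes \<gamma> from the exponents, leaving the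
      scaling (1/\<delta>)^k.\<close>
    define G' where "G' = (\<lambda>i k. of_real (\<delta> powr \<gamma>) * G i k)"
    have dd: "\<delta> powr \<gamma> * \<delta> powr - \<gamma> = 1" using \<delta> by (simp flip: powr_add)
    have hol_sy: "(\<lambda>z. sigma a z - y) holomorphic_on H"
      using hol_s by (intro holomorphic_intros)
    have y0: "(\<lambda>z. sigma a z - y) w = 0" by (simp add: y_def)
    have "norm (c k) * (1 / \<delta>) ^ k \<le> (1 + C' / 1) ^ n / 1 * (\<delta> powr \<gamma> * (2 ^ n * M))"
    proof (rule triangular_bound[where G = G'])
      fix i k assume "k < i" "i \<le> n"
      then show "G' i k = 0"
        using higher_deriv_zero_order(1)[OF H hol_h hol_sy y0, of k i] by (simp add: G G'_def)
    next
      fix i assume "i \<le> n"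
      have "1 * (1 / \<delta>) ^ i \<le> (\<delta> powr \<gamma> * \<delta> powr - \<gamma>) * (fact i * (1 / \<delta>) ^ i)"
        unfolding dd using \<delta> fact_ge_1[of i, where 'a = real] by (simp add: field_simps)
      also have "\<dots> = \<delta> powr \<gamma> * (fact i * \<delta> powr - \<gamma> * (1 / \<delta>) ^ i)"
        by simp
      also have "\<dots> \<le> \<delta> powr \<gamma> * (fact i * norm (h w) * norm (deriv (\<lambda>z. sigma a z - y) w) ^ i)"
        using h_w d_sigma \<delta> by (intro mult_left_mono mult_mono power_mono) auto
      also have "\<dots> = norm (G' i i)"
        using higher_deriv_zero_order(2)[OF H hol_h hol_sy y0, of i]
        by (simp add: G G'_def norm_mult norm_power)
      finally show "1 * (1 / \<delta>) ^ i \<le> norm (G' i i)" .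
    next
      fix i k assume k: "i < k" "k \<le> n"
      have "norm (G i k) \<le> 2 ^ n * (C * \<delta> powr - (real k + \<gamma>))"
        unfolding G_def
      proof (rule norm_combination_le[OF _ binomial_weights_le[OF y]])
        fix j assume "j \<le> i"
        then show "norm (ptest \<gamma> j k a w) \<le> C * \<delta> powr - (real k + \<gamma>)"
          using C(2)[OF _ k(2) a w, of j] k \<delta> by (simp add: B)
      qed (use k C(1) in auto)
      then have "\<delta> powr \<gamma> * norm (G i k) \<le> \<delta> powr \<gamma> * (2 ^ n * (C * \<delta> powr - (real k + \<gamma>)))"
        by (rule mult_left_mono) simp
      also have "\<dots> = C' * (\<delta> powr \<gamma> * \<delta> powr - (real k + \<gamma>))"
        by (simp add: C'_def)
      also have "\<delta> powr \<gamma> * \<delta> powr - (real k + \<gamma>) = \<delta> powr - real k"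
        by (subst powr_add[symmetric]) simp
      also have "\<dots> = (1 / \<delta>) ^ k"
        using \<delta> by (simp add: powr_minus powr_realpow power_divide divide_inverse power_inverse)
      finally show "norm (G' i k) \<le> C' * (1 / \<delta>) ^ k"
        by (simp add: G'_def norm_mult)
    next
      fix i assume i: "i \<le> n"
      have "0 \<le> M" using M[of 0 a] a norm_ge_zero order_trans by blast
      have eq: "(\<Sum>k\<le>n. c k * G i k) = (\<Sum>j\<le>i. of_nat (i choose j) * (- y) ^ (i - j) * (\<Sum>k\<le>n. c k * ptest \<gamma> j k a w))"
        unfolding G_def sum_distrib_left by (subst sum.swap) (simp add: mult_ac)
      have "norm (\<Sum>k\<le>n. c k * G i k) \<le> 2 ^ n * M"
        unfolding eq by (rule norm_combination_le[OF _ binomial_weights_le[OF y i] \<open>0 \<le> M\<close>]) (use M a i in auto)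
      then have "\<delta> powr \<gamma> * norm (\<Sum>k\<le>n. c k * G i k) \<le> \<delta> powr \<gamma> * (2 ^ n * M)"
        by (rule mult_left_mono) simp
      moreover have "(\<Sum>k\<le>n. c k * G' i k) = of_real (\<delta> powr \<gamma>) * (\<Sum>k\<le>n. c k * G i k)"
        by (simp add: G'_def sum_distrib_left mult_ac)
      ultimately show "norm (\<Sum>k\<le>n. c k * G' i k) \<le> \<delta> powr \<gamma> * (2 ^ n * M)"
        by (simp add: norm_mult)
    qed (use C' \<delta> k in auto)
    then have "norm (c k) * (1 / \<delta>) ^ k * \<delta> powr - \<gamma> \<le> (1 + C' / 1) ^ n / 1 * (\<delta> powr \<gamma> * (2 ^ n * M)) * \<delta> powr - \<gamma>"
      by (rule mult_right_mono) simp
    also have "\<dots> = K * M * (\<delta> powr \<gamma> * \<delta> powr - \<gamma>)"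
      by (simp add: K_def)
    also have "\<dots> = K * M" by (simp only: dd mult_1_right)
    also have "norm (c k) * (1 / \<delta>) ^ k * \<delta> powr - \<gamma> = norm (c k) * (1 / \<delta>) powr (real k + \<gamma>)"
    proof -
      have "(1 / \<delta>) powr real k = (1 / \<delta>) ^ k"
        using \<delta> by (intro powr_realpow) simp
      then show ?thesis
        by (simp only: powr_add one_div_powr[OF \<delta>, of \<gamma>] mult.assoc)
    qed
    finally show ?thesis by (simp add: \<delta>_def)
  qed
  ultimately show thesis by (rule that)
qed

text \<open>Inside the disk r = 1 produces the weight of Q_k itself. On the circle 1 / (1 - r) is
  unbounded as r tends to 1, which forces c k = 0 when k + \<gamma> > 0; in the remaining case r = 0
  is enough.\<close>

lemma Q_val_le_test:
  assumes \<gamma>: "0 \<le> \<gamma>"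
  obtains K where "0 < K" "\<And>c w M k. norm w \<le> 1 \<Longrightarrow>
    (\<And>j a. j \<le> n \<Longrightarrow> norm a < 1 \<Longrightarrow> norm (\<Sum>k\<le>n. c k * ptest \<gamma> j k a w) \<le> M) \<Longrightarrow> k \<le> n \<Longrightarrow>
    Q_val \<gamma> c w k \<le> ennreal (K * M)"
proof -
  obtain K where K: "0 < K" "\<And>c w r M k. norm w \<le> 1 \<Longrightarrow> 0 \<le> r \<Longrightarrow> r \<le> 1 \<Longrightarrow> r * norm w < 1 \<Longrightarrow>
    (\<And>j a. j \<le> n \<Longrightarrow> norm a < 1 \<Longrightarrow> norm (\<Sum>k\<le>n. c k * ptest \<gamma> j k a w) \<le> M) \<Longrightarrow> k \<le> n \<Longrightarrow>
    norm (c k) * (1 / (1 - r * (norm w)\<^sup>2)) powr (real k + \<gamma>) \<le> K * M"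
    by (rule Q_val_le_test_aux[OF \<gamma>, of n]) blast
  show thesis
  proof (rule that[OF K(1)])
    fix c w M k
    assume w: "norm w \<le> 1" and M: "\<And>j a. j \<le> n \<Longrightarrow> norm a < 1 \<Longrightarrow> norm (\<Sum>k\<le>n. c k * ptest \<gamma> j k a w) \<le> M" and k: "k \<le> n"
    show "Q_val \<gamma> c w k \<le> ennreal (K * M)"
    proof (cases "norm w < 1")
      case True
      then have "0 < 1 - (norm w)\<^sup>2" by (simp add: abs_square_less_1)
      moreover have "norm (c k) * (1 / (1 - 1 * (norm w)\<^sup>2)) powr (real k + \<gamma>) \<le> K * M"
        using True M k by (intro K(2)) auto
      ultimately show ?thesis
        unfolding Q_val_disk[OF True] by (intro ennreal_leI) (simp only: one_div_powr mult_1)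
    next
      case False
      then have w1: "norm w = 1" using w by simp
      have le: "norm (c k) * (1 / (1 - r)) powr (real k + \<gamma>) \<le> K * M" if "0 \<le> r" "r < 1" for r
        using K(2)[of w r c M k] that M k w1 by simp
      show ?thesis
      proof (cases "real k + \<gamma> = 0")
        case True
        then show ?thesis using le[of 0] w1 by (simp add: Q_val_circle ennreal_leI)
      next
        case False
        have "norm (c k) = 0"
        proof (rule mult_powr_bounded_imp_zero)
          show "0 < real k + \<gamma>" using False \<gamma> by linarith
          fix T :: real
          \<comment> \<open>For r = 1 - 1/t the base 1 / (1 - r) equals t; t \<ge> 1 keeps r in [0,
            1).\<close>
          define t where "t = max T 1"
          have t: "T \<le> t" "1 \<le> t" by (auto simp: t_def)
          have "norm (c k) * (1 / (1 - (1 - 1 / t))) powr (real k + \<gamma>) \<le> K * M"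
            using t by (intro le) auto
          then show "\<exists>t\<ge>T. 0 < t \<and> norm (c k) * t powr (real k + \<gamma>) \<le> K * M"
            using t by (intro exI[of _ t]) auto
        qed simp
        then show ?thesis using w1 False by (simp add: Q_val_circle)
      qed
    qed
  qed
qed

subsection \<open>Growth estimates and test functions in the four spaces\<close>

text \<open>Cauchy's inequality on the circle of radius \<rho> = (1 - |w|) / 2 about w, where 1 -
  |z|^2 \<ge> \<rho>. The power of 4 comes from \<rho> \<ge> (1 - |w|^2) / 4.\<close>

lemma growth_higher_deriv:
  fixes \<gamma> :: real
  assumes \<gamma>: "0 \<le> \<gamma>"
  obtains K where "0 < K" "\<And>f A k w. f holomorphic_on disk \<Longrightarrow> 0 \<le> A \<Longrightarrow>
    (\<And>z. z \<in> disk \<Longrightarrow> norm (f z) \<le> A * (1 - (norm z)\<^sup>2) powr - \<gamma>) \<Longrightarrow> k \<le> n \<Longrightarrow> w \<in> disk \<Longrightarrow>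
    norm ((deriv ^^ k) f w) \<le> K * A * (1 - (norm w)\<^sup>2) powr - (real k + \<gamma>)"
proof (rule that[of "fact n * 4 powr (real n + \<gamma>)"])
  fix f A k w
  assume f: "f holomorphic_on disk" and A: "0 \<le> A" and k: "k \<le> n" and w: "w \<in> disk"
    and le: "\<And>z. z \<in> disk \<Longrightarrow> norm (f z :: complex) \<le> A * (1 - (norm z)\<^sup>2) powr - \<gamma>"
  define \<rho> d where "\<rho> = (1 - norm w) / 2" and "d = 1 - (norm w)\<^sup>2"
  have \<rho>: "0 < \<rho>" "norm w + \<rho> < 1"
    using w by (auto simp: \<rho>_def field_simps)
  have d: "0 < d" "d / 4 \<le> \<rho>"
  proof -
    show "0 < d" using w by (simp add: d_def abs_square_less_1)
    have "d = (1 - norm w) * (1 + norm w)" by (simp add: d_def power2_eq_square algebra_simps)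
    also have "\<dots> \<le> (1 - norm w) * 2" using w by (intro mult_left_mono) auto
    finally show "d / 4 \<le> \<rho>" by (simp add: \<rho>_def)
  qed
  have sub: "cball w \<rho> \<subseteq> disk"
  proof
    fix z assume "z \<in> cball w \<rho>"
    then have "norm z \<le> norm w + \<rho>"
      using norm_triangle_ineq2[of z w] by (simp add: dist_norm norm_minus_commute)
    then show "z \<in> disk" using \<rho> by simp
  qed
  have "norm ((deriv ^^ k) f w) \<le> fact k * (A * \<rho> powr - \<gamma>) / \<rho> ^ k"
  proof (rule Cauchy_inequality)
    show "f holomorphic_on ball w \<rho>" "continuous_on (cball w \<rho>) f"
      using f sub ball_subset_cball by (blast intro: holomorphic_on_subset holomorphic_on_imp_continuous_on)+
    fix z assume z: "norm (w - z) = \<rho>"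
    then have zd: "z \<in> disk" using sub by (auto simp: dist_norm)
    have "norm z \<le> norm w + \<rho>"
      using norm_triangle_ineq2[of z w] z by (simp add: norm_minus_commute)
    then have "\<rho> \<le> 1 - norm z" unfolding \<rho>_def by argo
    also have "\<dots> \<le> 1 - (norm z)\<^sup>2"
      using zd by (simp add: power2_eq_square mult_left_le)
    finally have "(1 - (norm z)\<^sup>2) powr - \<gamma> \<le> \<rho> powr - \<gamma>"
      using \<rho> \<gamma> by (intro powr_mono2') auto
    then show "norm (f z) \<le> A * \<rho> powr - \<gamma>"
      using le[OF zd] A by (meson mult_left_mono order_trans)
  qed (use \<rho> in auto)
  also have "\<dots> = fact k * A * (\<rho> powr - \<gamma> * \<rho> powr - real k)"
    using \<rho> by (simp add: powr_minus powr_realpow divide_inverse)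
  also have "\<rho> powr - \<gamma> * \<rho> powr - real k = \<rho> powr - (real k + \<gamma>)"
    by (subst powr_add[symmetric]) (simp add: algebra_simps)
  also have "fact k * A * \<rho> powr - (real k + \<gamma>) \<le> fact n * A * (4 powr (real n + \<gamma>) * d powr - (real k + \<gamma>))"
  proof (intro mult_mono)
    have "\<rho> powr - (real k + \<gamma>) \<le> (d / 4) powr - (real k + \<gamma>)"
      using d \<gamma> by (intro powr_mono2') auto
    also have "\<dots> = 4 powr (real k + \<gamma>) * d powr - (real k + \<gamma>)"
      by (simp only: powr_divide powr_minus_divide) simp
    also have "\<dots> \<le> 4 powr (real n + \<gamma>) * d powr - (real k + \<gamma>)"
      using k by (intro mult_right_mono powr_mono) auto
    finally show "\<rho> powr - (real k + \<gamma>) \<le> 4 powr (real n + \<gamma>) * d powr - (real k + \<gamma>)" .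
    show "(fact k :: real) \<le> fact n" using k by (rule fact_mono)
  qed (use A in auto)
  finally show "norm ((deriv ^^ k) f w) \<le> fact n * 4 powr (real n + \<gamma>) * A * (1 - (norm w)\<^sup>2) powr - (real k + \<gamma>)"
    by (simp add: d_def mult_ac)
qed auto

section \<open>Unit balls as integral conditions\<close>

text \<open>Frees the unit ball conditions of the outer root 1/p.\<close>

lemma enn_powr_le_1_iff:
  assumes "0 < s"
  shows "enn_powr x s \<le> 1 \<longleftrightarrow> x \<le> 1"
proof (cases x)
  case (real r)
  have "r powr s \<le> 1 \<longleftrightarrow> r \<le> 1"
  proof (cases "r \<le> 1")
    case True
    then show ?thesis using assms real by (simp add: powr_le1)
  next
    case False
    then have "1 < r powr s" using assms gr_one_powr[of r s] by simp
    with False show ?thesis by (simp add: not_le)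
  qed
  then show ?thesis
    using real by (simp add: enn_powr_def ennreal_le_1)
qed (simp add: enn_powr_def)

lemma weighted_area_eq:
  "weighted_area \<alpha> = density lborel (\<lambda>z. indicator disk z * ennreal ((\<alpha> + 1) / pi * (1 - (norm z)\<^sup>2) powr \<alpha>))"
proof -
  have [measurable]: "disk \<in> sets (borel :: complex measure)" by simp
  have [measurable]: "(\<lambda>z::complex. indicator disk z / emeasure lborel disk :: ennreal) \<in> borel_measurable borel"
    by measurable
  have "weighted_area \<alpha> = density lborel (\<lambda>z. indicator disk z / emeasure lborel disk * ennreal ((\<alpha> + 1) * (1 - (norm z)\<^sup>2) powr \<alpha>))"
    unfolding weighted_area_def uniform_measure_def by (subst density_density_eq) auto
  also have "(\<lambda>z. indicator disk z / emeasure lborel disk * ennreal ((\<alpha> + 1) * (1 - (norm z)\<^sup>2) powr \<alpha>))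
    = (\<lambda>z::complex. indicator disk z * ennreal ((\<alpha> + 1) / pi * (1 - (norm z)\<^sup>2) powr \<alpha>))"
  proof
    fix z :: complex
    have e: "emeasure lborel (disk :: complex set) = ennreal pi"
      by (simp add: emeasure_ball unit_ball_vol_2)
    have "ennreal ((\<alpha> + 1) / pi * (1 - (norm z)\<^sup>2) powr \<alpha>) = ennreal (1 / pi * ((\<alpha> + 1) * (1 - (norm z)\<^sup>2) powr \<alpha>))"
      by simp
    also have "\<dots> = ennreal (1 / pi) * ennreal ((\<alpha> + 1) * (1 - (norm z)\<^sup>2) powr \<alpha>)"
      by (rule ennreal_mult') simp
    also have "ennreal (1 / pi) = 1 / ennreal pi"
      using divide_ennreal[of 1 pi] by simp
    finally show "indicator disk z / emeasure lborel disk * ennreal ((\<alpha> + 1) * (1 - (norm z)\<^sup>2) powr \<alpha>)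
      = indicator disk z * ennreal ((\<alpha> + 1) / pi * (1 - (norm z)\<^sup>2) powr \<alpha>)"
      unfolding e by (simp split: split_indicator)
  qed
  finally show ?thesis .
qed

text \<open>Values off the disk are arbitrary, so measurability is asked only of the function cut
  off by the indicator; the uncut one agrees with it almost everywhere.\<close>

lemma nn_integral_weighted_area:
  assumes [measurable]: "(\<lambda>z. indicator disk z * g z) \<in> borel_measurable borel"
  shows "(\<integral>\<^sup>+ z. g z \<partial>weighted_area \<alpha>) = (\<integral>\<^sup>+ z. indicator disk z * g z * ennreal ((\<alpha> + 1) / pi * (1 - (norm z)\<^sup>2) powr \<alpha>) \<partial>lborel)"
proof -
  have [measurable]: "disk \<in> sets (borel :: complex measure)" by simp
  have "(\<integral>\<^sup>+ z. g z \<partial>weighted_area \<alpha>) = (\<integral>\<^sup>+ z. indicator disk z * g z \<partial>weighted_area \<alpha>)"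
  proof (rule nn_integral_cong_AE)
    show "AE z in weighted_area \<alpha>. g z = indicator disk z * g z"
      unfolding weighted_area_eq by (subst AE_density) (auto split: split_indicator)
  qed
  also have "\<dots> = (\<integral>\<^sup>+ z. indicator disk z * ennreal ((\<alpha> + 1) / pi * (1 - (norm z)\<^sup>2) powr \<alpha>) * (indicator disk z * g z) \<partial>lborel)"
    unfolding weighted_area_eq by (rule nn_integral_density) auto
  also have "\<dots> = (\<integral>\<^sup>+ z. indicator disk z * g z * ennreal ((\<alpha> + 1) / pi * (1 - (norm z)\<^sup>2) powr \<alpha>) \<partial>lborel)"
    by (intro nn_integral_cong) (auto split: split_indicator simp: mult.commute)
  finally show ?thesis .
qed

definition admissible_space :: "fspace \<Rightarrow> bool" where
  "admissible_space X \<longleftrightarrow> (case X of Hinf \<Rightarrow> True | Growth \<alpha> \<Rightarrow> 0 < \<alpha> | Bergman p \<alpha> \<Rightarrow> 0 < p \<and> -1 < \<alpha> | Hardy p \<Rightarrow> 0 < p)"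

lemma gam_nonneg: "admissible_space X \<Longrightarrow> 0 \<le> gam X"
  by (cases X) (auto simp: admissible_space_def)

lemma measurable_indicator_holomorphic_powr:
  fixes f :: "complex \<Rightarrow> complex"
  assumes f: "f holomorphic_on disk"
  shows "(\<lambda>z. indicator disk z * ennreal (norm (f z) powr p)) \<in> borel_measurable borel"
proof -
  have "(\<lambda>z. indicator disk z *\<^sub>R norm (f z)) \<in> borel_measurable borel"
    using f by (intro borel_measurable_continuous_on_indicator continuous_intros holomorphic_on_imp_continuous_on) auto
  then have [measurable]: "(\<lambda>z. indicator disk z *\<^sub>R norm (f z)) \<in> borel_measurable borel" .
  have [measurable]: "disk \<in> sets (borel :: complex measure)" by simp
  have "(\<lambda>z. indicator disk z * ennreal ((indicator disk z *\<^sub>R norm (f z)) powr p)) \<in> borel_measurable borel"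
    by measurable
  also have "(\<lambda>z. indicator disk z * ennreal ((indicator disk z *\<^sub>R norm (f z)) powr p)) = (\<lambda>z. indicator disk z * ennreal (norm (f z) powr p))"
    by (auto split: split_indicator)
  finally show ?thesis .
qed

lemma le_powr_inverse:
  fixes x y p :: real
  assumes "0 < p" "0 \<le> x" "x powr p \<le> y"
  shows "x \<le> y powr (1 / p)"
proof -
  have "x = (x powr p) powr (1 / p)"
    using assms by (simp add: powr_powr)
  also have "\<dots> \<le> y powr (1 / p)"
    using assms by (intro powr_mono2) auto
  finally show ?thesis .
qed

lemma one_minus_norm_bounds:
  assumes "norm w < 1"
  shows "0 < 1 - (norm w)\<^sup>2" and "1 - (norm w)\<^sup>2 \<le> 2 * (1 - norm w)" and "1 - norm w \<le> 1 - (norm w)\<^sup>2"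
proof -
  show "0 < 1 - (norm w)\<^sup>2" using assms by (simp add: abs_square_less_1)
  show "1 - (norm w)\<^sup>2 \<le> 2 * (1 - norm w)"
    using zero_le_power2[of "1 - norm w"] by (simp add: power2_eq_square algebra_simps)
  show "1 - norm w \<le> 1 - (norm w)\<^sup>2"
    using assms by (simp add: power2_eq_square mult_left_le)
qed

section \<open>Growth of functions in the unit balls\<close>

lemma hardy_growth:
  assumes p: "0 < p"
  obtains A where "0 < A" "\<And>f z. f \<in> unit_ball (Hardy p) \<Longrightarrow> z \<in> disk \<Longrightarrow> norm (f z) \<le> A * (1 - (norm z)\<^sup>2) powr - (1 / p)"
proof -
  obtain C where C: "0 < C" "\<And>f w K. f holomorphic_on disk \<Longrightarrow> 0 \<le> K \<Longrightarrow> w \<in> disk \<Longrightarrow>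
      (\<And>r. 0 < r \<Longrightarrow> r < 1 \<Longrightarrow> circle_mean (\<lambda>t. ennreal (norm (f (of_real r * cis t)) powr p)) \<le> ennreal K) \<Longrightarrow>
      norm (f w) powr p * (1 - norm w) \<le> C * K"
    by (rule hardy_point[OF p]) blast
  show thesis
  proof (rule that[of "(2 * C) powr (1 / p)"])
    fix f z assume f: "f \<in> unit_ball (Hardy p)" and z: "z \<in> disk"
    define d where "d = 1 - (norm z)\<^sup>2"
    have d: "0 < d" "d \<le> 2 * (1 - norm z)"
      using one_minus_norm_bounds[of z] z by (auto simp: d_def)
    have "(SUP r\<in>{0<..<1}. circle_mean (\<lambda>t. ennreal (norm (f (of_real r * cis t)) powr p))) \<le> 1"
      using f p by (simp add: unit_ball_def enn_powr_le_1_iff)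
    then have "circle_mean (\<lambda>t. ennreal (norm (f (of_real r * cis t)) powr p)) \<le> ennreal 1" if "0 < r" "r < 1" for r
      using that by (auto simp: SUP_le_iff)
    then have "norm (f z) powr p * (1 - norm z) \<le> C * 1"
      using f z by (intro C(2)) (auto simp: unit_ball_def carrier_of_def)
    then have "norm (f z) powr p * d \<le> 2 * C"
      using mult_left_mono[OF d(2), of "norm (f z) powr p"] mult_left_mono[of "norm (f z) powr p * (1 - norm z)" "C * 1" 2]
      unfolding mult.left_commute[of _ 2] by (simp only: powr_ge_zero simp_thms mult_1_right zero_le_numeral) argo
    then have "norm (f z) powr p \<le> 2 * C / d"
      using d by (simp add: field_simps)
    then have "norm (f z) \<le> (2 * C / d) powr (1 / p)"
      using p by (intro le_powr_inverse) auto
    also have "\<dots> = (2 * C) powr (1 / p) * d powr - (1 / p)"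
      using C d by (simp add: powr_divide powr_minus_divide)
    finally show "norm (f z) \<le> (2 * C) powr (1 / p) * (1 - (norm z)\<^sup>2) powr - (1 / p)"
      by (simp add: d_def)
  qed (use C(1) in simp)
qed

text \<open>On the disk of radius \<rho> = (1 - |w|) / 2 about w one has \<rho> \<le> 1 - |z|^2
  \<le> 6 \<rho>, so the weight is comparable with \<rho>^\<alpha> and the unweighted estimate
  applies. The weight contributes \<rho>^(-\<alpha>), the area \<rho>^(-2); together they give the
  exponent (\<alpha> + 2) / p.\<close>

lemma bergman_growth:
  assumes p: "0 < p" and \<alpha>: "-1 < \<alpha>"
  obtains A where "0 < A" "\<And>f z. f \<in> unit_ball (Bergman p \<alpha>) \<Longrightarrow> z \<in> disk \<Longrightarrow> norm (f z) \<le> A * (1 - (norm z)\<^sup>2) powr - ((\<alpha> + 2) / p)"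
proof -
  obtain C where C: "0 < C" "\<And>f w R K. f holomorphic_on cball w R \<Longrightarrow> 0 < R \<Longrightarrow> 0 \<le> K \<Longrightarrow>
      (\<integral>\<^sup>+ z. ennreal (norm (f z) powr p) * indicator (ball w R) z \<partial>lborel) \<le> ennreal K \<Longrightarrow>
      norm (f w) powr p * R\<^sup>2 \<le> C * K"
    by (rule area_powr_mean[OF p]) blast
  \<comment> \<open>The first factor pays for the variation of the weight over the disk, and pi /
    (\<alpha> + 1) undoes the normalisation of the measure.\<close>
  define L where "L = 6 powr \<bar>\<alpha>\<bar> * pi / (\<alpha> + 1)"
  have L: "0 < L" using \<alpha> by (simp add: L_def)
  define A where "A = (C * L * 4 powr (\<alpha> + 2)) powr (1 / p)"
  show thesis
  proof (rule that[of A])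
    fix f w assume f: "f \<in> unit_ball (Bergman p \<alpha>)" and w: "w \<in> disk"
    have hol: "f holomorphic_on disk" using f by (simp add: unit_ball_def carrier_of_def)
    define d where "d = 1 - (norm w)\<^sup>2"
    define \<rho> where "\<rho> = (1 - norm w) / 2"
    have d: "0 < d" "d / 4 \<le> \<rho>"
      using one_minus_norm_bounds[of w] w by (auto simp: d_def \<rho>_def)
    have \<rho>: "0 < \<rho>" using d by argo
    have ring: "\<rho> \<le> 1 - (norm z)\<^sup>2" "1 - (norm z)\<^sup>2 \<le> 6 * \<rho>" "norm z < 1" if "z \<in> cball w \<rho>" for z
    proof -
      have "\<bar>norm z - norm w\<bar> \<le> \<rho>"
        using that norm_triangle_ineq3[of z w] by (simp add: dist_norm norm_minus_commute)
      then have "norm z - norm w \<le> \<rho>" "norm w - norm z \<le> \<rho>" by (auto simp: abs_le_iff)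
      then have n: "\<rho> \<le> 1 - norm z" "1 - norm z \<le> 3 * \<rho>" unfolding \<rho>_def by argo+
      then show nz: "norm z < 1" using \<rho> by argo
      show "\<rho> \<le> 1 - (norm z)\<^sup>2" using n one_minus_norm_bounds[OF nz] by argo
      show "1 - (norm z)\<^sup>2 \<le> 6 * \<rho>" using n one_minus_norm_bounds[OF nz] by argo
    qed
    have I: "(\<integral>\<^sup>+ z. indicator disk z * ennreal (norm (f z) powr p) * ennreal ((\<alpha> + 1) / pi * (1 - (norm z)\<^sup>2) powr \<alpha>) \<partial>lborel) \<le> 1"
      using f p by (simp add: unit_ball_def enn_powr_le_1_iff nn_integral_weighted_area[OF measurable_indicator_holomorphic_powr[OF hol]])
    have key: "1 \<le> L * \<rho> powr - \<alpha> * ((\<alpha> + 1) / pi * (1 - (norm z)\<^sup>2) powr \<alpha>)" if "z \<in> ball w \<rho>" for z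
    proof -
      define y where "y = 1 - (norm z)\<^sup>2"
      have y: "\<rho> \<le> y" "y \<le> 6 * \<rho>" "0 < y" using ring[of z] that \<rho> by (auto simp: y_def)
      have "\<rho> powr \<alpha> \<le> 6 powr \<bar>\<alpha>\<bar> * y powr \<alpha>"
      \<comment> \<open>The power is increasing or decreasing according to the sign of \<alpha>, so
        either \<rho> \<le> y or y \<le> 6 \<rho> is the inequality that helps.\<close>
      proof (cases "0 \<le> \<alpha>")
        case True
        then have "\<rho> powr \<alpha> \<le> y powr \<alpha>" using y \<rho> by (intro powr_mono2) auto
        also have "\<dots> \<le> 6 powr \<bar>\<alpha>\<bar> * y powr \<alpha>"
          using True ge_one_powr_ge_zero[of 6 \<alpha>] mult_right_mono[of 1 "6 powr \<alpha>" "y powr \<alpha>"] by simp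
        finally show ?thesis .
      next
        case False
        then have "(6 * \<rho>) powr \<alpha> \<le> y powr \<alpha>" using y by (intro powr_mono2') auto
        then have "6 powr - \<alpha> * (6 powr \<alpha> * \<rho> powr \<alpha>) \<le> 6 powr - \<alpha> * y powr \<alpha>"
          using \<rho> by (intro mult_left_mono) (auto simp: powr_mult)
        then show ?thesis using False by (simp add: mult.assoc[symmetric] powr_add[symmetric])
      qed
      then have "\<rho> powr - \<alpha> * \<rho> powr \<alpha> \<le> \<rho> powr - \<alpha> * (6 powr \<bar>\<alpha>\<bar> * y powr \<alpha>)"
        by (rule mult_left_mono) simp
      moreover have "\<rho> powr - \<alpha> * \<rho> powr \<alpha> = 1" using \<rho> by (simp flip: powr_add)
      moreover have "L * \<rho> powr - \<alpha> * ((\<alpha> + 1) / pi * y powr \<alpha>) = \<rho> powr - \<alpha> * (6 powr \<bar>\<alpha>\<bar> * y powr \<alpha>)"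
        using \<alpha> by (simp add: L_def)
      ultimately show ?thesis by (simp add: y_def)
    qed
    have "(\<integral>\<^sup>+ z. ennreal (norm (f z) powr p) * indicator (ball w \<rho>) z \<partial>lborel)
        \<le> (\<integral>\<^sup>+ z. ennreal (L * \<rho> powr - \<alpha>) * (indicator disk z * ennreal (norm (f z) powr p) * ennreal ((\<alpha> + 1) / pi * (1 - (norm z)\<^sup>2) powr \<alpha>)) \<partial>lborel)"
    proof (intro nn_integral_mono)
      fix z
      show "ennreal (norm (f z) powr p) * indicator (ball w \<rho>) z \<le> ennreal (L * \<rho> powr - \<alpha>) * (indicator disk z * ennreal (norm (f z) powr p) * ennreal ((\<alpha> + 1) / pi * (1 - (norm z)\<^sup>2) powr \<alpha>))"
      proof (cases "z \<in> ball w \<rho>")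
        case True
        then have zd: "z \<in> disk" using ring(3)[of z] by simp
        have "norm (f z) powr p * 1 \<le> norm (f z) powr p * (L * \<rho> powr - \<alpha> * ((\<alpha> + 1) / pi * (1 - (norm z)\<^sup>2) powr \<alpha>))"
          using key[OF True] by (rule mult_left_mono) simp
        then have "ennreal (norm (f z) powr p) \<le> ennreal (L * \<rho> powr - \<alpha> * (norm (f z) powr p * ((\<alpha> + 1) / pi * (1 - (norm z)\<^sup>2) powr \<alpha>)))"
          by (intro ennreal_leI) (simp add: mult_ac)
        also have "\<dots> = ennreal (L * \<rho> powr - \<alpha>) * (ennreal (norm (f z) powr p) * ennreal ((\<alpha> + 1) / pi * (1 - (norm z)\<^sup>2) powr \<alpha>))"
        proof -
          have em: "ennreal (x * (y * z)) = ennreal x * (ennreal y * ennreal z)" if "0 \<le> x" "0 \<le> y" "0 \<le> z" for x y z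
            using that by (simp add: ennreal_mult)
          show ?thesis by (rule em) (use L \<alpha> in auto)
        qed
        finally show ?thesis using True zd by (simp del: mem_ball)
      qed simp
    qed
    also have "\<dots> = ennreal (L * \<rho> powr - \<alpha>) * (\<integral>\<^sup>+ z. indicator disk z * ennreal (norm (f z) powr p) * ennreal ((\<alpha> + 1) / pi * (1 - (norm z)\<^sup>2) powr \<alpha>) \<partial>lborel)"
    proof (rule nn_integral_cmult)
      note [measurable] = measurable_indicator_holomorphic_powr[OF hol, of p]
      show "(\<lambda>z. indicator disk z * ennreal (norm (f z) powr p) * ennreal ((\<alpha> + 1) / pi * (1 - (norm z)\<^sup>2) powr \<alpha>)) \<in> borel_measurable lborel"
        by measurable
    qed
    also have "\<dots> \<le> ennreal (L * \<rho> powr - \<alpha>) * 1"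
      using I by (rule mult_left_mono) simp
    finally have "norm (f w) powr p * \<rho>\<^sup>2 \<le> C * (L * \<rho> powr - \<alpha>)"
      using \<rho> L ring(3) by (intro C(2) holomorphic_on_subset[OF hol]) (auto simp del: mem_cball)
    then have "norm (f w) powr p \<le> C * (L * \<rho> powr - \<alpha>) / \<rho>\<^sup>2"
      using \<rho> by (simp add: field_simps)
    also have "\<dots> = C * L * (\<rho> powr - \<alpha> / \<rho> powr 2)"
      using \<rho> by simp
    also have "\<rho> powr - \<alpha> / \<rho> powr 2 = \<rho> powr (- \<alpha> - 2)"
      by (rule powr_diff[symmetric])
    also have "\<dots> \<le> (d / 4) powr (- \<alpha> - 2)"
      using d \<alpha> by (intro powr_mono2') auto
    also have "(d / 4) powr (- \<alpha> - 2) = d powr - (\<alpha> + 2) * 4 powr (\<alpha> + 2)"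
    proof -
      have "- \<alpha> - 2 = - (\<alpha> + 2)" by simp
      then show ?thesis using d by (simp only: powr_divide powr_minus_divide) simp
    qed
    finally have "norm (f w) powr p \<le> C * L * 4 powr (\<alpha> + 2) * d powr - (\<alpha> + 2)"
      using C(1) L by (simp add: mult_ac)
    then have "norm (f w) \<le> (C * L * 4 powr (\<alpha> + 2) * d powr - (\<alpha> + 2)) powr (1 / p)"
      using p by (intro le_powr_inverse) auto
    also have "\<dots> = A * (d powr - (\<alpha> + 2)) powr (1 / p)"
      unfolding A_def by (rule powr_mult)
    also have "(d powr - (\<alpha> + 2)) powr (1 / p) = d powr - ((\<alpha> + 2) / p)"
    proof -
      have "- (\<alpha> + 2) * (1 / p) = - ((\<alpha> + 2) / p)"
        by (simp only: mult_minus_left times_divide_eq_right mult_1_right minus_divide_left)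
      then show ?thesis by (simp only: powr_powr)
    qed
    finally show "norm (f w) \<le> A * (1 - (norm w)\<^sup>2) powr - ((\<alpha> + 2) / p)"
      by (simp add: d_def)
  qed (use C(1) L in \<open>simp add: A_def\<close>)
qed

lemma space_growth:
  assumes "admissible_space X"
  obtains A where "0 < A" "\<And>f z. f \<in> unit_ball X \<Longrightarrow> z \<in> disk \<Longrightarrow> norm (f z) \<le> A * (1 - (norm z)\<^sup>2) powr - gam X"
proof (cases X)
  case Hinf
  show ?thesis
  proof (rule that[of 1])
    fix f z assume "f \<in> unit_ball X" and z: "z \<in> disk"
    then have "ennreal (norm (f z)) \<le> 1"
      using Hinf by (auto simp: unit_ball_def SUP_le_iff)
    then show "norm (f z) \<le> 1 * (1 - (norm z)\<^sup>2) powr - gam X"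
      using Hinf one_minus_norm_bounds[of z] z by (simp add: ennreal_le_1)
  qed simp
next
  case (Growth \<alpha>)
  show ?thesis
  proof (rule that[of 1])
    fix f z assume "f \<in> unit_ball X" and z: "z \<in> disk"
    then have "ennreal ((1 - (norm z)\<^sup>2) powr \<alpha> * norm (f z)) \<le> 1"
      using Growth by (auto simp: unit_ball_def SUP_le_iff)
    then show "norm (f z) \<le> 1 * (1 - (norm z)\<^sup>2) powr - gam X"
      using Growth one_minus_norm_bounds[of z] z by (simp add: ennreal_le_1 powr_minus field_simps)
  qed simp
next
  case (Bergman p \<alpha>)
  then show ?thesis
    using assms bergman_growth[of p \<alpha>] that by (auto simp: admissible_space_def)
next
  case (Hardy p)
  then show ?thesis
    using assms hardy_growth[of p] that by (auto simp: admissible_space_def)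
qed


section \<open>Test functions in the unit balls\<close>

lemma test_fun_norm:
  assumes "norm a < 1" "norm z \<le> 1"
  shows "norm (test_fun \<gamma> a z) = kern a z powr \<gamma>"
  using one_minus_norm_bounds(1)[OF assms(1)] unfolding test_fun_def
  by (subst norm_powr_real_powr') (auto simp: norm_divide norm_power simp del: of_real_diff of_real_power)

lemma sigma_norm_le:
  assumes "norm a < 1" "norm z \<le> 1"
  shows "norm (sigma a z) \<le> 1"
  using sigma_cross_le(2)[of a z] one_minus_norm_sq_le(3)[OF assms] assms
  by (simp add: sigma_def norm_divide)

lemma test_holomorphic:
  assumes "norm a < 1"
  shows "(\<lambda>z. test_fun \<gamma> a z * sigma a z ^ j) holomorphic_on disk"
proof -
  have "ptest \<gamma> j 0 a holomorphic_on disk"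
  proof (rule holomorphic_on_subset)
    show "ptest \<gamma> j 0 a holomorphic_on {z. Re (cnj a * z) < 1}"
      unfolding holomorphic_on_open[OF open_test_domain] using ptest_has_derivative by blast
    show "disk \<subseteq> {z. Re (cnj a * z) < 1}"
      using test_domain[OF assms] by (auto simp del: times_complex.sel)
  qed
  then show ?thesis
  proof (rule holomorphic_transform)
    fix z assume "z \<in> disk"
    then have "norm z \<le> 1" by simp
    then show "ptest \<gamma> j 0 a z = test_fun \<gamma> a z * sigma a z ^ j"
      unfolding ptest_def by (rule test_fun_sigma_eq[OF assms test_domain[OF assms], symmetric])
  qed
qed

lemma test_norm_le:
  assumes "norm a < 1" "norm z \<le> 1"
  shows "norm (test_fun \<gamma> a z * sigma a z ^ j) \<le> kern a z powr \<gamma>"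
  using mult_left_mono[OF power_le_one[OF norm_ge_zero sigma_norm_le[OF assms], of j], of "norm (test_fun \<gamma> a z)"]
  by (simp add: norm_mult norm_power test_fun_norm[OF assms])

text \<open>The scalar is carried along because in general only a multiple of the test function lies
  in the unit ball.\<close>

lemma bv_higher_deriv_ctest:
  assumes "norm a < 1" "norm w \<le> 1"
  shows "bv ((deriv ^^ k) (\<lambda>w. c * (test_fun \<gamma> a w * sigma a w ^ j))) w = c * ptest \<gamma> j k a w"
proof (rule bv_eq(1)[OF _ assms(2)])
  show "isCont (\<lambda>w. c * ptest \<gamma> j k a w) w"
    by (intro continuous_intros DERIV_isCont[OF ptest_has_derivative[OF test_domain[OF assms]]])
  fix z assume "z \<in> disk \<union> {w}"
  then have z: "norm z \<le> 1" using assms by auto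
  show "(deriv ^^ k) (\<lambda>w. c * (test_fun \<gamma> a w * sigma a w ^ j)) z = c * ptest \<gamma> j k a z"
  proof (rule higher_deriv_eq_seq[OF open_test_domain[of a], where D = "\<lambda>k z. c * ptest \<gamma> j k a z"])
    fix k z assume "z \<in> {z. Re (cnj a * z) < 1}"
    then have z: "Re (cnj a * z) < 1" by blast
    show "((\<lambda>z. c * ptest \<gamma> j k a z) has_field_derivative c * ptest \<gamma> j (Suc k) a z) (at z)"
      by (intro DERIV_cmult ptest_has_derivative[OF z])
    show "c * (test_fun \<gamma> a z * sigma a z ^ j) = c * ptest \<gamma> j 0 a z"
      unfolding ptest_def test_fun_sigma_eq[OF assms(1) z] ..
  qed (use test_domain[OF assms(1) z] in blast)
qed

lemma unit_ballI:
  assumes "f holomorphic_on disk" "space_norm X f \<le> 1"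
  shows "f \<in> unit_ball X"
  using assms by (auto simp: unit_ball_def carrier_of_def intro: le_less_trans)

text \<open>Since \<gamma> p = 1, |f_a|^p is \<open>kern a\<close>, whose mean over |z| = r is (1 -
  |a|^2) / (1 - r^2 |a|^2) \<le> 1. The factor (\<sigma>_a)^j only decreases the modulus.\<close>

lemma hardy_test:
  assumes p: "0 < p" and a: "norm a < 1"
  shows "(\<lambda>z. test_fun (1 / p) a z * sigma a z ^ j) \<in> unit_ball (Hardy p)"
proof (rule unit_ballI[OF test_holomorphic[OF a]])
  have "circle_mean (\<lambda>t. ennreal (norm (test_fun (1 / p) a (of_real r * cis t) * sigma a (of_real r * cis t) ^ j) powr p)) \<le> 1"
    if r: "0 < r" "r < 1" for r
  proof -
    have "circle_mean (\<lambda>t. ennreal (norm (test_fun (1 / p) a (of_real r * cis t) * sigma a (of_real r * cis t) ^ j) powr p))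
      \<le> circle_mean (\<lambda>t. ennreal (1 - (norm a)\<^sup>2) * ennreal (1 / (norm (1 - (cnj a * of_real r) * cis t))\<^sup>2))"
    proof (intro nn_integral_mono)
      fix t
      define y where "y = (1 - (norm a)\<^sup>2) / (norm (1 - cnj a * (of_real r * cis t)))\<^sup>2"
      have y: "0 \<le> y" using one_minus_norm_bounds(1)[OF a] by (simp add: y_def)
      have "norm (test_fun (1 / p) a (of_real r * cis t) * sigma a (of_real r * cis t) ^ j) powr p \<le> (y powr (1 / p)) powr p"
        unfolding y_def using r p a by (intro powr_mono2 test_norm_le) (auto simp: norm_mult)
      also have "\<dots> = y" using y p by (simp add: powr_powr)
      also have "\<dots> = (1 - (norm a)\<^sup>2) * (1 / (norm (1 - (cnj a * of_real r) * cis t))\<^sup>2)"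
        by (simp add: y_def mult.assoc)
      finally show "ennreal (norm (test_fun (1 / p) a (of_real r * cis t) * sigma a (of_real r * cis t) ^ j) powr p)
        \<le> ennreal (1 - (norm a)\<^sup>2) * ennreal (1 / (norm (1 - (cnj a * of_real r) * cis t))\<^sup>2)"
        using one_minus_norm_bounds(1)[OF a] by (subst ennreal_mult[symmetric]) (auto intro: ennreal_leI)
    qed
    also have "\<dots> = ennreal (1 - (norm a)\<^sup>2) * circle_mean (\<lambda>t. ennreal (1 / (norm (1 - (cnj a * of_real r) * cis t))\<^sup>2))"
    proof (rule nn_integral_cmult)
      have [measurable]: "cis \<in> borel_measurable borel"
        by (intro borel_measurable_continuous_onI continuous_intros)
      show "(\<lambda>t. ennreal (1 / (norm (1 - (cnj a * of_real r) * cis t))\<^sup>2)) \<in> borel_measurable (uniform_measure lborel {0..2 * pi})"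
        by measurable
    qed
    also have "\<dots> = ennreal (1 - (norm a)\<^sup>2) * ennreal (1 / (1 - (norm (cnj a * of_real r))\<^sup>2))"
    proof (subst poisson_mean)
      show "norm (cnj a * of_real r) < 1"
        using a r mult_strict_mono[of "norm a" 1 r 1] by (simp add: norm_mult)
    qed simp
    also have "\<dots> \<le> ennreal 1"
    proof -
      have "norm (cnj a * of_real r) \<le> norm a"
        using r by (simp add: norm_mult mult_left_le)
      then have "(norm (cnj a * of_real r))\<^sup>2 \<le> (norm a)\<^sup>2" by (rule power_mono) simp
      then have le: "1 - (norm a)\<^sup>2 \<le> 1 - (norm (cnj a * of_real r))\<^sup>2" by simp
      then have pos: "0 < 1 - (norm (cnj a * of_real r))\<^sup>2"
        by (rule less_le_trans[OF one_minus_norm_bounds(1)[OF a]])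
      have "ennreal (1 - (norm a)\<^sup>2) * ennreal (1 / (1 - (norm (cnj a * of_real r))\<^sup>2))
          = ennreal ((1 - (norm a)\<^sup>2) * (1 / (1 - (norm (cnj a * of_real r))\<^sup>2)))"
        using one_minus_norm_bounds(1)[OF a] pos by (intro ennreal_mult[symmetric]) (auto intro: less_imp_le)
      also have "\<dots> \<le> ennreal 1"
        using le pos by (intro ennreal_leI) (simp add: pos_divide_le_eq)
      finally show ?thesis .
    qed
    finally show ?thesis by simp
  qed
  then show "space_norm (Hardy p) (\<lambda>z. test_fun (1 / p) a z * sigma a z ^ j) \<le> 1"
    using p by (auto simp: enn_powr_le_1_iff SUP_le_iff)
qed

text \<open>Since \<gamma> p = \<alpha> + 2, the p-th power of the norm is at most a Forelli-Rudin
  integral times (\<alpha> + 1) / pi. The scalar c is its normalisation and works for all a and j at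
  once.\<close>

lemma bergman_test:
  assumes p: "0 < p" and \<alpha>: "-1 < \<alpha>"
  obtains c where "0 < c" "\<And>a j. norm a < 1 \<Longrightarrow>
    (\<lambda>z. of_real c * (test_fun ((\<alpha> + 2) / p) a z * sigma a z ^ j)) \<in> unit_ball (Bergman p \<alpha>)"
proof -
  obtain C where C: "0 < C" "\<And>a. a \<in> disk \<Longrightarrow>
    (\<integral>\<^sup>+ z. ennreal (kern a z powr (\<alpha> + 2) * (1 - (norm z)\<^sup>2) powr \<alpha>) * indicator disk z \<partial>lborel)
      \<le> ennreal C"
    by (rule Forelli_Rudin[OF \<alpha>]) blast
  define B where "B = (\<alpha> + 1) / pi"
  have B: "0 < B" using \<alpha> by (simp add: B_def)
  define c where "c = (1 / (C * B)) powr (1 / p)"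
  have c: "0 < c" using C B by (simp add: c_def)
  have cp: "c powr p * (B * C) = 1"
    using C B p by (simp add: c_def powr_powr)
  show thesis
  proof (rule that[OF c])
    fix a :: complex and j assume a: "norm a < 1"
    define f where "f = (\<lambda>z. of_real c * (test_fun ((\<alpha> + 2) / p) a z * sigma a z ^ j))"
    have f: "f holomorphic_on disk"
      unfolding f_def by (intro holomorphic_intros test_holomorphic a)
    have "(\<integral>\<^sup>+ z. ennreal (norm (f z) powr p) \<partial>weighted_area \<alpha>) =
      (\<integral>\<^sup>+ z. indicator disk z * ennreal (norm (f z) powr p) * ennreal (B * (1 - (norm z)\<^sup>2) powr \<alpha>) \<partial>lborel)"
      unfolding B_def by (rule nn_integral_weighted_area[OF measurable_indicator_holomorphic_powr[OF f]])
    also have "\<dots> \<le> (\<integral>\<^sup>+ z. ennreal (c powr p * B) *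
      (ennreal (kern a z powr (\<alpha> + 2) * (1 - (norm z)\<^sup>2) powr \<alpha>) * indicator disk z) \<partial>lborel)"
    proof (intro nn_integral_mono)
      fix z :: complex
      define y where "y = (1 - (norm a)\<^sup>2) / (norm (1 - cnj a * z))\<^sup>2"
      show "indicator disk z * ennreal (norm (f z) powr p) * ennreal (B * (1 - (norm z)\<^sup>2) powr \<alpha>)
        \<le> ennreal (c powr p * B) * (ennreal (y powr (\<alpha> + 2) * (1 - (norm z)\<^sup>2) powr \<alpha>) * indicator disk z)"
      proof (cases "z \<in> disk")
        case True
        then have "norm (f z) \<le> c * y powr ((\<alpha> + 2) / p)"
          unfolding f_def y_def norm_mult[of "of_real c"] using c a by (auto intro!: mult_left_mono test_norm_le)
        then have "norm (f z) powr p \<le> (c * y powr ((\<alpha> + 2) / p)) powr p"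
          using p by (intro powr_mono2) auto
        also have "\<dots> = c powr p * y powr (\<alpha> + 2)"
          using c p by (simp add: powr_mult powr_powr)
        finally have "norm (f z) powr p * (B * (1 - (norm z)\<^sup>2) powr \<alpha>) \<le> c powr p * y powr (\<alpha> + 2) * (B * (1 - (norm z)\<^sup>2) powr \<alpha>)"
          using B by (intro mult_right_mono) auto
        then have "ennreal (norm (f z) powr p * (B * (1 - (norm z)\<^sup>2) powr \<alpha>)) \<le> ennreal (c powr p * B * (y powr (\<alpha> + 2) * (1 - (norm z)\<^sup>2) powr \<alpha>))"
          by (intro ennreal_leI) (simp add: mult_ac)
        then show ?thesis
          using True B c by (simp add: ennreal_mult del: mem_ball)
      qed simp
    qed
    also have "\<dots> = ennreal (c powr p * B) *
      (\<integral>\<^sup>+ z. ennreal (kern a z powr (\<alpha> + 2) * (1 - (norm z)\<^sup>2) powr \<alpha>) * indicator disk z \<partial>lborel)"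
    proof (rule nn_integral_cmult)
      have [measurable]: "disk \<in> sets (borel :: complex measure)" by simp
      show "(\<lambda>z. ennreal (kern a z powr (\<alpha> + 2) * (1 - (norm z)\<^sup>2) powr \<alpha>) * indicator disk z) \<in> borel_measurable lborel"
        by measurable
    qed
    also have "\<dots> \<le> ennreal (c powr p * B) * ennreal C"
      using a by (intro mult_left_mono C(2)) auto
    also have "\<dots> = ennreal 1"
      using B C(1) cp by (subst ennreal_mult[symmetric]) (auto simp: mult.assoc)
    finally have "space_norm (Bergman p \<alpha>) f \<le> 1"
      using p by (simp add: enn_powr_le_1_iff)
    then show "(\<lambda>z. of_real c * (test_fun ((\<alpha> + 2) / p) a z * sigma a z ^ j)) \<in> unit_ball (Bergman p \<alpha>)"
      using unit_ballI[OF f] by (simp add: f_def)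
  qed
qed

lemma space_test:
  assumes "admissible_space X"
  obtains c where "0 < c" "\<And>a j. norm a < 1 \<Longrightarrow>
    (\<lambda>z. of_real c * (test_fun (gam X) a z * sigma a z ^ j)) \<in> unit_ball X"
proof (cases X)
  case Hinf
  show ?thesis
  proof (rule that[of 1])
    fix a :: complex and j assume a: "norm a < 1"
    have "ennreal (norm (test_fun 0 a z * sigma a z ^ j)) \<le> 1" if "z \<in> disk" for z
    proof -
      have "norm (test_fun 0 a z * sigma a z ^ j) \<le> kern a z powr 0"
        using that a by (intro test_norm_le) auto
      also have "\<dots> \<le> 1" by simp
      finally show ?thesis by (simp add: ennreal_le_1)
    qed
    then show "(\<lambda>z. of_real 1 * (test_fun (gam X) a z * sigma a z ^ j)) \<in> unit_ball X"
      using Hinf by (auto intro!: unit_ballI test_holomorphic a simp: SUP_le_iff)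
  qed simp
next
  case (Growth \<alpha>)
  show ?thesis
  proof (rule that[of 1])
    fix a :: complex and j assume a: "norm a < 1"
    have "ennreal ((1 - (norm z)\<^sup>2) powr \<alpha> * norm (test_fun \<alpha> a z * sigma a z ^ j)) \<le> 1" if z: "z \<in> disk" for z
    proof -
      have z1: "norm z < 1" using z by simp
      define b where "b = norm (1 - cnj a * z)"
      have b: "0 < b" using one_minus_norm_sq_le(3)[of a z] a z1 by (simp add: b_def)
      have "(1 - (norm z)\<^sup>2) powr \<alpha> * norm (test_fun \<alpha> a z * sigma a z ^ j)
        \<le> (1 - (norm z)\<^sup>2) powr \<alpha> * ((1 - (norm a)\<^sup>2) / b\<^sup>2) powr \<alpha>"
        unfolding b_def using z a by (intro mult_left_mono test_norm_le) auto
      also have "\<dots> = ((1 - (norm z)\<^sup>2) * ((1 - (norm a)\<^sup>2) / b\<^sup>2)) powr \<alpha>"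
        by (rule powr_mult[symmetric])
      also have "\<dots> \<le> 1 powr \<alpha>"
      proof (rule powr_mono2)
        \<comment> \<open>By the identity in \<open>sigma_cross_le\<close>, the base of the power is
          1 - |\<sigma>_a(z)|^2.\<close>
        have "(1 - (norm a)\<^sup>2) * (1 - (norm z)\<^sup>2) \<le> b\<^sup>2"
          using sigma_cross_le(1)[of a z] a z1 by (simp add: b_def)
        then show "(1 - (norm z)\<^sup>2) * ((1 - (norm a)\<^sup>2) / b\<^sup>2) \<le> 1"
          using b by (simp add: field_simps)
      qed (use assms Growth one_minus_norm_bounds(1)[OF a] one_minus_norm_bounds(1)[OF z1] in \<open>auto simp: admissible_space_def\<close>)
      finally show ?thesis by (simp add: ennreal_le_1)
    qed
    then show "(\<lambda>z. of_real 1 * (test_fun (gam X) a z * sigma a z ^ j)) \<in> unit_ball X"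
      using Growth by (auto intro!: unit_ballI test_holomorphic a simp: SUP_le_iff)
  qed simp
next
  case (Bergman p \<alpha>)
  then have "0 < p" "-1 < \<alpha>" using assms by (auto simp: admissible_space_def)
  then show ?thesis
    using Bergman bergman_test[of p \<alpha>] that by (metis gam.simps(3))
next
  case (Hardy p)
  then show ?thesis
    using assms hardy_test[of p] that[of 1] by (auto simp: admissible_space_def)
qed

subsection \<open>Monomials\<close>

text \<open>The k-th derivative of z^m. For k > m the product contains the factor m - m = 0, so
  truncated subtraction gives the correct value 0.\<close>

definition dmono :: "nat \<Rightarrow> nat \<Rightarrow> complex \<Rightarrow> complex" where
  "dmono k m z = of_nat (\<Prod>i<k. m - i) * z ^ (m - k)"

lemma dmono_has_derivative: "(dmono k m has_field_derivative dmono (Suc k) m z) (at z)"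
  unfolding dmono_def[abs_def] by (auto intro!: derivative_eq_intros simp: mult_ac)

lemma higher_deriv_mono: "(deriv ^^ k) (\<lambda>w. w ^ m) z = dmono k m z"
  by (rule higher_deriv_eq_seq[where S = UNIV and D = "\<lambda>k. dmono k m"]; (rule dmono_has_derivative | simp add: dmono_def))

lemma dmono_bound:
  assumes "norm z \<le> 1"
  shows "norm (dmono k m z) \<le> real m ^ k"
proof -
  have "(\<Prod>i<k. m - i) \<le> (\<Prod>i<k. m)" by (rule prod_mono) auto
  then have "real (\<Prod>i<k. m - i) \<le> real m ^ k" by (metis card_lessThan of_nat_le_iff of_nat_power prod_constant)
  moreover have "norm z ^ (m - k) \<le> 1" using assms by (simp add: power_le_one)
  ultimately have "real (\<Prod>i<k. m - i) * norm z ^ (m - k) \<le> real m ^ k * 1"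
    by (intro mult_mono) auto
  then show ?thesis by (simp add: dmono_def norm_mult norm_power del: of_nat_prod)
qed

lemma bv_higher_deriv_mono:
  assumes "norm w \<le> 1"
  shows "bv ((deriv ^^ k) (\<lambda>w. w ^ m)) w = dmono k m w"
  by (rule bv_eq(1)[OF _ assms]) (auto simp: higher_deriv_mono intro: DERIV_isCont dmono_has_derivative)

definition mono_weight :: "real \<Rightarrow> nat \<Rightarrow> real" where
  "mono_weight \<gamma> m = (if m = 0 then 1 else real m powr \<gamma>)"

lemma mono_weight_pos: "0 < mono_weight \<gamma> m"
  by (simp add: mono_weight_def)

text \<open>Row i belongs to z^l (z^m - w^m)^i, a binomial combination of the monomials z^(l + m j).
  Its diagonal entry i! w^l (m w^(m-1))^i has size at least a multiple of m^i as long as the powers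
  of |w| stay above 1/2, so the scale in \<open>triangular_bound\<close> is s = m.\<close>

lemma monomial_combination_bound:
  fixes c :: "nat \<Rightarrow> complex"
  assumes \<gamma>: "0 \<le> \<gamma>" and w: "norm w \<le> 1" and m: "0 < m" and l: "l \<le> m"
    and wl: "1 / 2 \<le> norm w ^ l" and wm: "1 / 2 \<le> norm w ^ (m - 1)"
    and wt: "\<And>j. real m powr \<gamma> \<le> mono_weight \<gamma> (l + m * j)"
    and M: "\<And>m. mono_weight \<gamma> m * norm (\<Sum>k\<le>n. c k * dmono k m w) \<le> M" and k: "k \<le> n"
  shows "norm (c k) * real m powr (real k + \<gamma>) \<le> (1 + 2 ^ n * (real n + 1) ^ n * 2 ^ (n + 1)) ^ n * 2 ^ (n + 1) * 2 ^ n * M"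
proof -
  \<comment> \<open>A diagonal entry contains i + 1 \<le> n + 1 factors 1/2. In C, 2^n is the
    binomial mass, and (n + 1)^n comes from exponents l + m j \<le> (n + 1) m.\<close>
  define \<kappa> C where "\<kappa> = 1 / (2 :: real) ^ (n + 1)" and "C = 2 ^ n * (real n + 1) ^ n"
  define y where "y = w ^ m"
  define G where "G = (\<lambda>i k. \<Sum>j\<le>i. of_nat (i choose j) * (- y) ^ (i - j) * dmono k (l + m * j) w)"
  have y: "norm y \<le> 1" using w by (simp add: y_def norm_power power_le_one)
  have M0: "0 \<le> M" using M[of 0] mono_weight_pos[of \<gamma> 0] by (meson less_imp_le mult_nonneg_nonneg norm_ge_zero order_trans)
  have G: "(deriv ^^ k) (\<lambda>z. z ^ l * (z ^ m - y) ^ i) w = G i k" for i k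
    unfolding G_def
  proof (rule higher_deriv_eq_seq[where S = UNIV and D = "\<lambda>k z. \<Sum>j\<le>i. of_nat (i choose j) * (- y) ^ (i - j) * dmono k (l + m * j) z"])
    fix k z
    show "((\<lambda>z. \<Sum>j\<le>i. of_nat (i choose j) * (- y) ^ (i - j) * dmono k (l + m * j) z) has_field_derivative
        (\<Sum>j\<le>i. of_nat (i choose j) * (- y) ^ (i - j) * dmono (Suc k) (l + m * j) z)) (at z)"
      by (intro DERIV_sum DERIV_cmult dmono_has_derivative)
    have p: "dmono 0 (l + m * j) z = z ^ l * (z ^ m) ^ j" for j
      by (simp add: dmono_def power_add power_mult)
    show "z ^ l * (z ^ m - y) ^ i = (\<Sum>j\<le>i. of_nat (i choose j) * (- y) ^ (i - j) * dmono 0 (l + m * j) z)"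
      unfolding p using binomial_ring[of "z ^ m" "- y" i] by (simp add: sum_distrib_left mult_ac)
  qed auto
  have hol: "(\<lambda>z. z ^ l) holomorphic_on UNIV" "(\<lambda>z. z ^ m - y) holomorphic_on UNIV"
    by (intro holomorphic_intros)+
  have y0: "(\<lambda>z. z ^ m - y) w = 0" by (simp add: y_def)
  have "norm (c k) * real m ^ k \<le> (1 + C / \<kappa>) ^ n / \<kappa> * (2 ^ n * (M * real m powr - \<gamma>))"
  proof (rule triangular_bound[where G = G])
    fix i k assume "k < i" "i \<le> n"
    then show "G i k = 0"
      using higher_deriv_zero_order(1)[OF open_UNIV UNIV_I hol y0, of k i] by (simp add: G)
  next
    fix i assume i: "i \<le> n"
    have d: "deriv (\<lambda>z. z ^ m - y) w = of_nat m * w ^ (m - 1)"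
      by (rule DERIV_imp_deriv) (auto intro!: derivative_eq_intros)
    have "\<kappa> * real m ^ i \<le> 1 / 2 ^ (i + 1) * real m ^ i"
      unfolding \<kappa>_def using i by (intro mult_right_mono divide_left_mono power_increasing) auto
    also have "\<dots> = 1 * (1 / 2) * (real m * (1 / 2)) ^ i"
      by (simp add: power_mult_distrib power_divide)
    also have "\<dots> \<le> fact i * norm w ^ l * (real m * norm w ^ (m - 1)) ^ i"
      using wl wm m fact_ge_1[of i, where 'a = real] by (intro mult_mono power_mono mult_left_mono) auto
    also have "\<dots> = norm (G i i)"
      using higher_deriv_zero_order(2)[OF open_UNIV UNIV_I hol y0, of i]
      by (simp add: G d norm_mult norm_power power_mult_distrib)
    finally show "\<kappa> * real m ^ i \<le> norm (G i i)" .
  next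
    fix i k assume k: "i < k" "k \<le> n"
    have "norm (G i k) \<le> 2 ^ n * ((real n + 1) ^ n * real m ^ k)"
      unfolding G_def
    proof (rule norm_combination_le[OF _ binomial_weights_le[OF y]])
      fix j assume j: "j \<le> i"
      have "m * j \<le> m * n" using j k by (intro mult_le_mono2) auto
      from add_mono[OF l this] have "l + m * j \<le> m * (n + 1)" by simp
      then have "real (l + m * j) \<le> (real n + 1) * real m"
        by (metis mult.commute of_nat_1 of_nat_add of_nat_le_iff of_nat_mult)
      then have "real (l + m * j) ^ k \<le> ((real n + 1) * real m) ^ k"
        by (rule power_mono) simp
      also have "\<dots> \<le> (real n + 1) ^ n * real m ^ k"
        unfolding power_mult_distrib using k by (intro mult_right_mono power_increasing) auto
      finally show "norm (dmono k (l + m * j) w) \<le> (real n + 1) ^ n * real m ^ k"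
        using dmono_bound[OF w, of k "l + m * j"] by (rule order_trans[rotated])
    qed (use k in auto)
    then show "norm (G i k) \<le> C * real m ^ k"
      by (simp add: C_def mult_ac)
  next
    fix i assume i: "i \<le> n"
    have S: "norm (\<Sum>k\<le>n. c k * dmono k (l + m * j) w) \<le> M * real m powr - \<gamma>" for j
    proof -
      have "real m powr \<gamma> * norm (\<Sum>k\<le>n. c k * dmono k (l + m * j) w) \<le> mono_weight \<gamma> (l + m * j) * norm (\<Sum>k\<le>n. c k * dmono k (l + m * j) w)"
        using wt by (rule mult_right_mono) simp
      also have "\<dots> \<le> M" by (rule M)
      finally show ?thesis using m by (simp add: powr_minus_divide field_simps)
    qed
    have eq: "(\<Sum>k\<le>n. c k * G i k) = (\<Sum>j\<le>i. of_nat (i choose j) * (- y) ^ (i - j) * (\<Sum>k\<le>n. c k * dmono k (l + m * j) w))"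
      unfolding G_def sum_distrib_left by (subst sum.swap) (simp add: mult_ac)
    show "norm (\<Sum>k\<le>n. c k * G i k) \<le> 2 ^ n * (M * real m powr - \<gamma>)"
      unfolding eq by (rule norm_combination_le[OF S binomial_weights_le[OF y i]]) (use M0 in auto)
  qed (use m k in \<open>auto simp: \<kappa>_def C_def intro!: mult_pos_pos zero_less_power\<close>)
  then have "norm (c k) * real m ^ k * real m powr \<gamma> \<le> (1 + C / \<kappa>) ^ n / \<kappa> * (2 ^ n * (M * real m powr - \<gamma>)) * real m powr \<gamma>"
    by (rule mult_right_mono) simp
  also have "\<dots> = (1 + C / \<kappa>) ^ n / \<kappa> * 2 ^ n * M * (real m powr - \<gamma> * real m powr \<gamma>)"
    by simp
  also have "real m powr - \<gamma> * real m powr \<gamma> = 1"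
    using m by (simp flip: powr_add)
  also have "norm (c k) * real m ^ k * real m powr \<gamma> = norm (c k) * real m powr (real k + \<gamma>)"
    using m by (simp add: powr_add powr_realpow)
  finally show ?thesis by (simp add: \<kappa>_def C_def)
qed

text \<open>The exponent m must be small enough for |w|^m \<ge> 1/2 and large enough for m (1 -
  |w|^2) \<ge> 1/4; then m^(k+\<gamma>) replaces the weight of Q_k up to a power of 4. On the circle
  every m satisfies the first condition, and letting m grow forces c k = 0 when k + \<gamma> >
  0.\<close>

lemma Q_val_le_monomial:
  assumes \<gamma>: "0 \<le> \<gamma>"
  obtains K where "0 < K" "\<And>c w M k. norm w \<le> 1 \<Longrightarrow>
    (\<And>m. mono_weight \<gamma> m * norm (\<Sum>k\<le>n. c k * dmono k m w) \<le> M) \<Longrightarrow> k \<le> n \<Longrightarrow>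
    Q_val \<gamma> c w k \<le> ennreal (K * M)"
proof -
  define K0 where "K0 = (1 + 2 ^ n * (real n + 1) ^ n * 2 ^ (n + 1)) ^ n * 2 ^ (n + 1) * (2 ^ n :: real)"
  have K0: "0 < K0"
    unfolding K0_def by (intro mult_pos_pos zero_less_power add_pos_nonneg) auto
  define K where "K = K0 * 4 powr (real n + \<gamma>)"
  have K: "0 < K" "K0 \<le> K"
    using K0 \<gamma> ge_one_powr_ge_zero[of 4 "real n + \<gamma>"] by (auto simp: K_def mult_le_cancel_left1)
  show thesis
  proof (rule that[OF K(1)])
    fix c w M k
    assume w: "norm w \<le> 1" and M: "\<And>m. mono_weight \<gamma> m * norm (\<Sum>k\<le>n. c k * dmono k m w) \<le> M" and k: "k \<le> n"
    have M0: "0 \<le> M" using M[of 0] mono_weight_pos[of \<gamma> 0] by (meson less_imp_le mult_nonneg_nonneg norm_ge_zero order_trans)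
    define e where "e = real k + \<gamma>"
    have e: "0 \<le> e" "e \<le> real n + \<gamma>" using \<gamma> k by (auto simp: e_def)
    \<comment> \<open>The choice l = m avoids the monomial of degree 0, whose weight is 1 instead of
      m^\<gamma>.\<close>
    have large: "norm (c k) * real m powr e \<le> K0 * M" if m: "0 < m" "1 / 2 \<le> norm w ^ m" for m
      unfolding e_def K0_def
    proof (rule monomial_combination_bound[OF \<gamma> w m(1) order_refl m(2) _ _ M k])
      show "1 / 2 \<le> norm w ^ (m - 1)"
        using m(2) w power_decreasing[of "m - 1" m "norm w"] by (simp add: order_trans)
      show "real m powr \<gamma> \<le> mono_weight \<gamma> (m + m * j)" for j
        using m(1) \<gamma> by (auto simp: mono_weight_def intro!: powr_mono2)
    qed
    \<comment> \<open>With m = 1 and l = 0 only w^0 enters the diagonal, so w may be arbitrarily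
      small; and 1^\<gamma> = 1 agrees with the weight of the constant monomial.\<close>
    have small: "norm (c k) * real 1 powr e \<le> K0 * M"
      unfolding e_def K0_def
    proof (rule monomial_combination_bound[OF \<gamma> w _ _ _ _ _ M k, where l = 0])
      show "real 1 powr \<gamma> \<le> mono_weight \<gamma> (0 + 1 * j)" for j
        using \<gamma> by (auto simp: mono_weight_def intro!: ge_one_powr_ge_zero)
    qed auto
    show "Q_val \<gamma> c w k \<le> ennreal (K * M)"
    proof (cases "norm w < 1")
      case True
      define d where "d = 1 - (norm w)\<^sup>2"
      have d: "0 < d" "1 - norm w \<le> d"
        using one_minus_norm_bounds[OF True] by (auto simp: d_def)
      obtain m :: nat where m: "1 / 4 \<le> real m * d" "norm (c k) * real m powr e \<le> K0 * M" "0 < m"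
      proof (cases "norm w \<le> 1 / 2")
        case True
        then have "1 / 4 \<le> real 1 * d" using d by simp
        with small show thesis by (intro that[of 1]) auto
      next
        case False
        \<comment> \<open>For the integer part m of x, Bernoulli's inequality yields |w|^m \<ge> 1 -
          m (1 - |w|) \<ge> 1/2, while x \<ge> 1 implies m \<ge> x / 2 and hence m (1 - |w|^2) \<ge>
          1/4.\<close>
        define x where "x = 1 / (2 * (1 - norm w))"
        define m where "m = nat \<lfloor>x\<rfloor>"
        have x: "1 \<le> x" using False True by (simp add: x_def field_simps)
        have m: "real m \<le> x" "x < real m + 1" "1 \<le> m"
          using x by (auto simp: m_def le_nat_floor of_nat_floor)
        have xx: "x * (1 - norm w) = 1 / 2" using True by (simp add: x_def)
        have "x \<le> 2 * real m" using m by simp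
        then have "x * (1 - norm w) \<le> 2 * real m * (1 - norm w)" using True by (intro mult_right_mono) auto
        also have "\<dots> \<le> 2 * real m * d" using d by (intro mult_left_mono) auto
        finally have 1: "1 / 4 \<le> real m * d" using xx by simp
        have "real m * (1 - norm w) \<le> x * (1 - norm w)" using m True by (intro mult_right_mono) auto
        then have "1 / 2 \<le> 1 + real m * (norm w - 1)" using xx by (simp add: algebra_simps)
        also have "\<dots> \<le> (1 + (norm w - 1)) ^ m" by (rule Bernoulli_inequality) simp
        finally have 2: "1 / 2 \<le> norm w ^ m" by simp
        show thesis using that[of m] 1 large[OF _ 2] m(3) by simp
      qed
      have "1 / d \<le> 4 * real m" using m(1) d by (simp add: field_simps)
      then have "(1 / d) powr e \<le> (4 * real m) powr e" using d e by (intro powr_mono2) auto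
      also have "\<dots> = 4 powr e * real m powr e" by (rule powr_mult)
      also have "\<dots> \<le> 4 powr (real n + \<gamma>) * real m powr e" using e by (intro mult_right_mono powr_mono) auto
      finally have "norm (c k) * (1 / d) powr e \<le> norm (c k) * (4 powr (real n + \<gamma>) * real m powr e)"
        by (rule mult_left_mono) simp
      also have "\<dots> = norm (c k) * real m powr e * 4 powr (real n + \<gamma>)" by simp
      also have "\<dots> \<le> K0 * M * 4 powr (real n + \<gamma>)" using m(2) by (rule mult_right_mono) simp
      finally have "norm (c k) * d powr - e \<le> K * M"
        unfolding one_div_powr[OF d(1)] by (simp add: K_def mult_ac)
      then show ?thesis
        unfolding Q_val_disk[OF True] d_def[symmetric] e_def[symmetric] by (rule ennreal_leI)
    next
      case False
      then have w1: "norm w = 1" using w by simp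
      show ?thesis
      proof (cases "e = 0")
        case True
        have "norm (c k) \<le> K0 * M" using small by simp
        also have "\<dots> \<le> K * M" using K M0 by (intro mult_right_mono) auto
        finally show ?thesis using w1 True by (simp add: Q_val_circle ennreal_leI e_def)
      next
        case False
        have "norm (c k) = 0"
        proof (rule mult_powr_bounded_imp_zero)
          show "0 < e" using False e by simp
          fix T :: real
          obtain m :: nat where m: "T < real m" using reals_Archimedean2 by blast
          have "norm (c k) * real (Suc m) powr e \<le> K0 * M"
            using w1 by (intro large) auto
          then show "\<exists>t\<ge>T. 0 < t \<and> norm (c k) * t powr e \<le> K0 * M"
            using m by (intro exI[of _ "real (Suc m)"]) auto
        qed simp
        then show ?thesis using w1 False by (simp add: Q_val_circle e_def)
      qed
    qed
  qed
qed

section \<open>Growth of the weighted monomials\<close>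

text \<open>Raise y \<le> exp y at y = x / \<gamma> to the power \<gamma>. The summand 1 covers
  \<gamma> = 0, where \<open>\<gamma> powr \<gamma>\<close> is 0.\<close>

lemma powr_le_exp:
  fixes x \<gamma> :: real
  assumes "0 \<le> x" "0 \<le> \<gamma>"
  shows "x powr \<gamma> \<le> (\<gamma> powr \<gamma> + 1) * exp x"
proof (cases "\<gamma> = 0")
  case True
  then show ?thesis using assms by (simp add: one_le_exp_iff)
next
  case False
  then have \<gamma>: "0 < \<gamma>" using assms by simp
  have "x / \<gamma> \<le> exp (x / \<gamma>)" using exp_ge_add_one_self[of "x / \<gamma>"] by argo
  then have "(x / \<gamma>) powr \<gamma> \<le> exp (x / \<gamma>) powr \<gamma>"
    using assms by (intro powr_mono2) auto
  also have "\<dots> = exp x" using \<gamma> by (simp add: powr_def)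
  finally have "x powr \<gamma> / \<gamma> powr \<gamma> \<le> exp x" by (simp only: powr_divide)
  then have "x powr \<gamma> \<le> \<gamma> powr \<gamma> * exp x" using \<gamma> by (simp add: field_simps)
  also have "\<dots> \<le> (\<gamma> powr \<gamma> + 1) * exp x" by (intro mult_right_mono) auto
  finally show ?thesis .
qed

text \<open>With x = m (1 - |z|), |z|^m is at most exp (-x) and m^\<gamma> (1 - |z|^2)^\<gamma> is
  at most (2 x)^\<gamma>; the product is bounded independently of m.\<close>

lemma monomial_growth:
  fixes z :: complex
  assumes \<gamma>: "0 \<le> \<gamma>" and z: "norm z < 1"
  shows "mono_weight \<gamma> m * norm z ^ m \<le> 2 powr \<gamma> * (\<gamma> powr \<gamma> + 1) * (1 - (norm z)\<^sup>2) powr - \<gamma>"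
proof -
  define d where "d = 1 - (norm z)\<^sup>2"
  have d: "0 < d" "d \<le> 2 * (1 - norm z)" "d \<le> 1" using one_minus_norm_bounds[OF z] by (auto simp: d_def)
  define x where "x = real m * (1 - norm z)"
  have x: "0 \<le> x" using z by (simp add: x_def)
  have g: "1 \<le> 2 powr \<gamma> * (\<gamma> powr \<gamma> + 1)"
    using mult_mono[of 1 "2 powr \<gamma>" 1 "\<gamma> powr \<gamma> + 1"] ge_one_powr_ge_zero[of 2 \<gamma>] \<gamma> by simp
  have "mono_weight \<gamma> m * norm z ^ m * d powr \<gamma> \<le> 2 powr \<gamma> * (\<gamma> powr \<gamma> + 1)"
  proof (cases "m = 0")
    case True
    have "d powr \<gamma> \<le> 1" using d \<gamma> by (intro powr_le1) auto
    with g show ?thesis using True by (simp add: mono_weight_def)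
  next
    case False
    have "norm z \<le> exp (norm z - 1)" using exp_ge_add_one_self[of "norm z - 1"] by simp
    then have "norm z ^ m \<le> exp (norm z - 1) ^ m" by (rule power_mono) simp
    also have "\<dots> = exp (- x)" by (simp add: x_def exp_of_nat_mult[symmetric] algebra_simps)
    finally have 1: "norm z ^ m \<le> exp (- x)" .
    have "real m powr \<gamma> * d powr \<gamma> \<le> real m powr \<gamma> * (2 * (1 - norm z)) powr \<gamma>"
      using d \<gamma> by (intro mult_left_mono powr_mono2) auto
    also have "\<dots> = 2 powr \<gamma> * x powr \<gamma>" unfolding x_def powr_mult by (simp only: mult_ac)
    also have "\<dots> \<le> 2 powr \<gamma> * ((\<gamma> powr \<gamma> + 1) * exp x)" using powr_le_exp[OF x \<gamma>] by (rule mult_left_mono) simp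
    finally have "real m powr \<gamma> * d powr \<gamma> * norm z ^ m \<le> 2 powr \<gamma> * ((\<gamma> powr \<gamma> + 1) * exp x) * exp (- x)"
      by (rule mult_mono[OF _ 1]) simp_all
    also have "\<dots> = 2 powr \<gamma> * (\<gamma> powr \<gamma> + 1) * (exp x * exp (- x))" by simp
    also have "exp x * exp (- x) = 1" by (simp add: exp_minus)
    finally show ?thesis using False by (simp add: mono_weight_def mult_ac)
  qed
  then show ?thesis using d by (simp add: powr_minus_divide d_def field_simps)
qed

lemma monomial_deriv_bound:
  assumes \<gamma>: "0 \<le> \<gamma>"
  obtains C where "0 < C" "\<And>k m (w :: complex). k \<le> n \<Longrightarrow> norm w < 1 \<Longrightarrow>
    norm (of_real (mono_weight \<gamma> m) * dmono k m w) \<le> C * (1 - (norm w)\<^sup>2) powr - (real k + \<gamma>)"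
proof -
  obtain K where K: "0 < K" "\<And>f A k w. f holomorphic_on disk \<Longrightarrow> 0 \<le> A \<Longrightarrow>
    (\<And>z. z \<in> disk \<Longrightarrow> norm (f z) \<le> A * (1 - (norm z)\<^sup>2) powr - \<gamma>) \<Longrightarrow> k \<le> n \<Longrightarrow> w \<in> disk \<Longrightarrow>
    norm ((deriv ^^ k) f w) \<le> K * A * (1 - (norm w)\<^sup>2) powr - (real k + \<gamma>)"
    by (rule growth_higher_deriv[OF \<gamma>, of n]) blast
  define A where "A = 2 powr \<gamma> * (\<gamma> powr \<gamma> + 1)"
  have A: "0 < A" by (simp add: A_def add_nonneg_pos)
  show thesis
  proof (rule that[of "K * A"])
    fix k m and w :: complex
    assume k: "k \<le> n" and w: "norm w < 1"
    have pos: "0 < mono_weight \<gamma> m" by (rule mono_weight_pos)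
    have "norm ((deriv ^^ k) (\<lambda>z. z ^ m) w) \<le> K * (A / mono_weight \<gamma> m) * (1 - (norm w)\<^sup>2) powr - (real k + \<gamma>)"
    proof (rule K(2))
      fix z assume "z \<in> disk"
      then show "norm (z ^ m) \<le> A / mono_weight \<gamma> m * (1 - (norm z)\<^sup>2) powr - \<gamma>"
        using monomial_growth[OF \<gamma>, of z m] pos by (simp add: A_def norm_power field_simps)
    qed (use A pos k w in \<open>auto intro!: holomorphic_intros\<close>)
    then show "norm (of_real (mono_weight \<gamma> m) * dmono k m w) \<le> K * A * (1 - (norm w)\<^sup>2) powr - (real k + \<gamma>)"
      using pos by (simp add: higher_deriv_mono norm_mult field_simps)
  qed (use A K in simp)
qed

text \<open>Common to test functions, monomials and the whole unit ball; D k stands for the k-th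
  derivative at w. On the circle a term with k + \<gamma> > 0 has c k = 0 or an infinite right-hand
  side, so boundary information enters only through D 0 with \<gamma> = 0.\<close>

lemma sum_le_Q_val:
  assumes \<gamma>: "0 \<le> \<gamma>" and w: "norm w \<le> 1" and C: "0 < C"
    and inside: "\<And>k. norm w < 1 \<Longrightarrow> k \<le> n \<Longrightarrow> norm (D k) \<le> C * (1 - (norm w)\<^sup>2) powr - (real k + \<gamma>)"
    and boundary: "norm w = 1 \<Longrightarrow> \<gamma> = 0 \<Longrightarrow> c 0 \<noteq> 0 \<Longrightarrow> norm (D 0) \<le> C"
  shows "ennreal (norm (\<Sum>k\<le>n. c k * D k)) \<le> ennreal C * (\<Sum>k\<le>n. Q_val \<gamma> c w k)"
proof -
  have "ennreal (norm (\<Sum>k\<le>n. c k * D k)) \<le> ennreal (\<Sum>k\<le>n. norm (c k * D k))"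
    by (intro ennreal_leI norm_sum)
  also have "\<dots> = (\<Sum>k\<le>n. ennreal (norm (c k * D k)))"
    by (rule sum_ennreal[symmetric]) simp
  also have "\<dots> \<le> (\<Sum>k\<le>n. ennreal C * Q_val \<gamma> c w k)"
  proof (rule sum_mono)
    fix k assume k: "k \<in> {..n}"
    show "ennreal (norm (c k * D k)) \<le> ennreal C * Q_val \<gamma> c w k"
    proof (cases "norm w < 1")
      case True
      have "norm (c k) * norm (D k) \<le> norm (c k) * (C * (1 - (norm w)\<^sup>2) powr - (real k + \<gamma>))"
        using inside[OF True] k by (intro mult_left_mono) auto
      then have "norm (c k * D k) \<le> C * (norm (c k) * (1 - (norm w)\<^sup>2) powr - (real k + \<gamma>))"
        by (simp add: norm_mult mult_ac)
      then have "ennreal (norm (c k * D k)) \<le> ennreal (C * (norm (c k) * (1 - (norm w)\<^sup>2) powr - (real k + \<gamma>)))"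
        by (rule ennreal_leI)
      then show ?thesis
        unfolding Q_val_disk[OF True] using C by (subst ennreal_mult[symmetric]) auto
    next
      case False
      then have w1: "norm w = 1" using w by simp
      show ?thesis
      proof (cases "real k + \<gamma> = 0")
        case True
        then have k0: "k = 0" "\<gamma> = 0" using \<gamma> by (auto simp: add_nonneg_eq_0_iff)
        have "norm (c 0 * D 0) \<le> C * norm (c 0)"
          using boundary[OF w1 k0(2)] mult_left_mono[of "norm (D 0)" C "norm (c 0)"]
          by (cases "c 0 = 0") (auto simp: norm_mult mult.commute)
        then show ?thesis
          using w1 k0 C by (simp add: Q_val_circle ennreal_leI flip: ennreal_mult)
      next
        case False
        then show ?thesis
          using w1 C by (simp add: Q_val_circle ennreal_mult_top)
      qed
    qed
  qed
  also have "\<dots> = ennreal C * (\<Sum>k\<le>n. Q_val \<gamma> c w k)"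
    by (simp add: sum_distrib_left)
  finally show ?thesis .
qed

subsection \<open>Integrability and measurability\<close>

lemma enn_powr_mono:
  assumes "x \<le> y" "0 \<le> s"
  shows "enn_powr x s \<le> enn_powr y s"
proof (cases "y = top")
  case False
  then have "x \<noteq> top" using assms(1) top.extremum_uniqueI by blast
  then show ?thesis
    using False assms by (auto simp: enn_powr_def intro!: ennreal_leI powr_mono2 enn2real_mono simp: less_top)
qed (simp add: enn_powr_def)

lemma enn_powr_cmult:
  assumes "0 < c"
  shows "enn_powr (ennreal c * x) s = ennreal (c powr s) * enn_powr x s"
proof (cases x)
  case (real r)
  then show ?thesis
    using assms by (simp add: enn_powr_def powr_mult flip: ennreal_mult)
next
  case top
  then show ?thesis
    using assms by (simp add: enn_powr_def ennreal_mult_top)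
qed

lemma measurable_enn_powr [measurable]:
  assumes [measurable]: "F \<in> borel_measurable M"
  shows "(\<lambda>z. enn_powr (F z) s) \<in> borel_measurable M"
  unfolding enn_powr_def by measurable

lemma in_Lq_dominated:
  assumes G: "in_Lq q \<mu> G" and F: "F \<in> borel_measurable \<mu>" and C: "0 < C" and q: "0 < q"
    and le: "AE z in \<mu>. F z \<le> ennreal C * G z"
  shows "in_Lq q \<mu> F"
proof -
  have [measurable]: "G \<in> borel_measurable \<mu>" using G by (simp add: in_Lq_def)
  have "(\<integral>\<^sup>+ z. enn_powr (F z) q \<partial>\<mu>) \<le> (\<integral>\<^sup>+ z. ennreal (C powr q) * enn_powr (G z) q \<partial>\<mu>)"
  proof (rule nn_integral_mono_AE)
    show "AE z in \<mu>. enn_powr (F z) q \<le> ennreal (C powr q) * enn_powr (G z) q"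
      using le
    proof eventually_elim
      case (elim z)
      then show ?case
        using enn_powr_mono[of "F z" "ennreal C * G z" q] q by (simp add: enn_powr_cmult[OF C])
    qed
  qed
  also have "\<dots> = ennreal (C powr q) * (\<integral>\<^sup>+ z. enn_powr (G z) q \<partial>\<mu>)"
    by (rule nn_integral_cmult) measurable
  also have "\<dots> < \<infinity>"
    using G by (simp add: in_Lq_def ennreal_mult_less_top)
  finally show ?thesis
    using F by (simp add: in_Lq_def)
qed

text \<open>Comparison of the sum with n + 1 times its largest term works for all q > 0, also for q
  < 1 where the triangle inequality in L^q fails.\<close>

lemma in_Lq_sum:
  assumes "\<And>k. k \<le> n \<Longrightarrow> in_Lq q \<mu> (F k)" and q: "0 < q"
  shows "in_Lq q \<mu> (\<lambda>z. \<Sum>k\<le>(n::nat). F k z)"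
proof -
  have [measurable]: "F k \<in> borel_measurable \<mu>" if "k \<in> {..n}" for k
    using assms(1)[of k] that by (simp add: in_Lq_def)
  have le: "enn_powr (\<Sum>k\<le>n. F k z) q \<le> ennreal ((real n + 1) powr q) * (\<Sum>k\<le>n. enn_powr (F k z) q)" for z
  proof -
    define M where "M = Max ((\<lambda>k. F k z) ` {..n})"
    have "M \<in> (\<lambda>k. F k z) ` {..n}" unfolding M_def by (rule Max_in) auto
    then obtain i where i: "i \<le> n" "M = F i z" by auto
    have "(\<Sum>k\<le>n. F k z) \<le> (\<Sum>k\<le>n. M)"
      unfolding M_def by (intro sum_mono Max_ge) auto
    also have "\<dots> = ennreal (real n + 1) * M"
      by (simp add: ennreal_of_nat_eq_real_of_nat[symmetric] ennreal_plus add.commute)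
    finally have "enn_powr (\<Sum>k\<le>n. F k z) q \<le> enn_powr (ennreal (real n + 1) * M) q"
      using q by (intro enn_powr_mono) auto
    also have "\<dots> = ennreal ((real n + 1) powr q) * enn_powr (F i z) q"
      by (subst enn_powr_cmult) (auto simp: i)
    also have "\<dots> \<le> ennreal ((real n + 1) powr q) * (\<Sum>k\<le>n. enn_powr (F k z) q)"
      using i by (intro mult_left_mono member_le_sum) auto
    finally show ?thesis .
  qed
  have "(\<integral>\<^sup>+ z. enn_powr (\<Sum>k\<le>n. F k z) q \<partial>\<mu>) \<le> (\<integral>\<^sup>+ z. ennreal ((real n + 1) powr q) * (\<Sum>k\<le>n. enn_powr (F k z) q) \<partial>\<mu>)"
    by (intro nn_integral_mono le)
  also have "\<dots> = ennreal ((real n + 1) powr q) * (\<Sum>k\<le>n. \<integral>\<^sup>+ z. enn_powr (F k z) q \<partial>\<mu>)"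
    by (subst nn_integral_cmult) (auto simp: nn_integral_sum)
  also have "\<dots> < \<infinity>"
    using assms by (auto simp: in_Lq_def ennreal_mult_less_top)
  finally show ?thesis
    by (simp add: in_Lq_def)
qed

lemma in_Lq_finite_AE:
  assumes "in_Lq q \<mu> F"
  shows "AE z in \<mu>. F z \<noteq> top"
proof -
  have [measurable]: "F \<in> borel_measurable \<mu>" using assms by (simp add: in_Lq_def)
  have "AE z in \<mu>. enn_powr (F z) q \<noteq> \<infinity>"
    using assms by (intro nn_integral_PInf_AE) (auto simp: in_Lq_def)
  then show ?thesis
    by eventually_elim (auto simp: enn_powr_def)
qed

section \<open>Measurability of boundary values\<close>

text \<open>On the circle, the limit along one sequence of radii gives the value wherever the radial
  limit exists. The set of existence is the issue: it involves uncountably many radii, which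
  continuity of F in the disk reduces to rational ones.\<close>

lemma measurable_bv:
  assumes F: "continuous_on disk F" and S: "S = disk \<or> S = circle"
  shows "bv F \<in> borel_measurable (restrict_space borel S)"
  using S
proof
  assume S: "S = disk"
  have "F \<in> borel_measurable (restrict_space borel disk)"
    using F by (rule borel_measurable_continuous_on_restrict)
  moreover have "bv F z = F z" if "z \<in> space (restrict_space borel disk)" for z
    using that by (simp add: bv_def space_restrict_space)
  ultimately show ?thesis
    unfolding S by (subst measurable_cong[where g = F]) auto
next
  assume S: "S = circle"
  define M where "M = restrict_space borel circle"
  have sp: "space M = circle" by (simp add: M_def space_restrict_space)
  have Fr: "(\<lambda>z. F (of_real r * z)) \<in> borel_measurable M" if "0 < r" "r < 1" for r
    unfolding M_def
    by (intro borel_measurable_continuous_on_restrict continuous_on_compose2[OF F] continuous_intros)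
      (use that in \<open>auto simp: norm_mult\<close>)
  define \<rho> where "\<rho> = (\<lambda>m::nat. 1 - inverse (real (Suc (Suc m))))"
  have \<rho>: "0 < \<rho> m" "\<rho> m < 1" for m
    by (auto simp: \<rho>_def inverse_less_1_iff)
  have \<rho>_lim: "\<rho> \<longlonglongrightarrow> 1"
  proof -
    have "(\<lambda>m. 1 - inverse (real (Suc (Suc m)))) \<longlonglongrightarrow> 1 - 0"
      by (intro tendsto_intros LIMSEQ_Suc[OF LIMSEQ_inverse_real_of_nat])
    then show ?thesis by (simp add: \<rho>_def)
  qed
  have \<rho>_left: "filterlim \<rho> (at_left 1) sequentially"
    by (rule tendsto_imp_filterlim_at_left[OF \<rho>_lim]) (simp add: \<rho>)
  \<comment> \<open>Where this sequence diverges \<open>lim\<close> is unspecified; no radial limit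
    exists there and P fails.\<close>
  define L where "L = (\<lambda>z. lim (\<lambda>m. F (of_real (\<rho> m) * z)))"
  have L[measurable]: "L \<in> borel_measurable M"
    unfolding L_def by (intro borel_measurable_lim_metric Fr \<rho>)
  have L_eq: "L z = l" if "radial_limit F z l" for z l
    using filterlim_compose[OF that[unfolded radial_limit_def] \<rho>_left] by (simp add: L_def limI)
  \<comment> \<open>Convergence of F (r z) to L z in countable terms: tolerance 1 / (e + 1), a
    neighbourhood of 1 given by N, and rational radii x. The maximum with 0 keeps the radii
    positive.\<close>
  define P where "P = (\<lambda>z. \<forall>e::nat. \<exists>N::nat. \<forall>x::rat.
    of_rat x \<in> {max 0 (1 - 1 / real (Suc N))<..<1} \<longrightarrow> dist (F (of_real (of_rat x) * z)) (L z) \<le> 1 / real (Suc e))"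
  have P_iff: "(\<exists>l. radial_limit F z l) \<longleftrightarrow> P z" if z: "z \<in> circle" for z
  proof
    assume "\<exists>l. radial_limit F z l"
    then obtain l where l: "radial_limit F z l" by blast
    have Lz: "L z = l" by (rule L_eq[OF l])
    show "P z"
      unfolding P_def Lz
    proof
      fix e :: nat
      have "\<forall>\<^sub>F r in at_left (1::real). dist (F (of_real r * z)) l < 1 / real (Suc e)"
        using l unfolding radial_limit_def by (rule tendstoD) simp
      then obtain b where b: "b < 1" "\<And>r. b < r \<Longrightarrow> r < 1 \<Longrightarrow> dist (F (of_real r * z)) l < 1 / real (Suc e)"
        unfolding eventually_at_left_field by blast
      obtain N where "inverse (real (Suc N)) < 1 - b"
        using reals_Archimedean[of "1 - b"] b(1) by auto
      then have N: "b < 1 - 1 / real (Suc N)" by (simp add: inverse_eq_divide)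
      show "\<exists>N. \<forall>x::rat. of_rat x \<in> {max 0 (1 - 1 / real (Suc N))<..<1} \<longrightarrow> dist (F (of_real (of_rat x) * z)) l \<le> 1 / real (Suc e)"
      proof (intro exI[of _ N] allI impI)
        fix x :: rat assume "of_rat x \<in> {max 0 (1 - 1 / real (Suc N))<..<1}"
        then have "1 - 1 / real (Suc N) < of_rat x" "of_rat x < (1 :: real)"
          by (simp_all only: greaterThanLessThan_iff max_less_iff_conj)
        then show "dist (F (of_real (of_rat x) * z)) l \<le> 1 / real (Suc e)"
          using b(2)[OF less_trans[OF N]] by (intro less_imp_le)
      qed
    qed
  next
    assume P: "P z"
    have "radial_limit F z (L z)"
      unfolding radial_limit_def
    proof (rule tendstoI)
      fix \<epsilon> :: real assume "0 < \<epsilon>"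
      then obtain e where e: "inverse (real (Suc e)) < \<epsilon>" using reals_Archimedean by blast
      from P[unfolded P_def, THEN spec, of e]
      obtain N where N0: "\<forall>x::rat. of_rat x \<in> {max 0 (1 - 1 / real (Suc N))<..<1} \<longrightarrow> dist (F (of_real (of_rat x) * z)) (L z) \<le> 1 / real (Suc e)" ..
      have N: "dist (F (of_real r * z)) (L z) \<le> 1 / real (Suc e)"
        if r: "r \<in> \<rat>" "max 0 (1 - 1 / real (Suc N)) < r" "r < 1" for r
      proof -
        obtain x where x: "r = of_rat x" using r(1) by (rule Rats_cases)
        show ?thesis
          using N0[THEN spec, of x] r(2,3) unfolding x greaterThanLessThan_iff by blast
      qed
      have "dist (F (of_real r * z)) (L z) < \<epsilon>" if r: "r \<in> {max 0 (1 - 1 / real (Suc N))<..<1}" for r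
      proof (rule ccontr)
        have r01: "r \<in> {0<..<1}"
          using r by (simp only: greaterThanLessThan_iff max_less_iff_conj)
        \<comment> \<open>By continuity a deviation above 1 / (e + 1) at r persists on an interval
          to the right of r, which contains a rational radius.\<close>
        assume "\<not> dist (F (of_real r * z)) (L z) < \<epsilon>"
        then have "1 / real (Suc e) < dist (F (of_real r * z)) (L z)" using e by (simp add: inverse_eq_divide)
        moreover have "continuous_on {0<..<1} (\<lambda>r. dist (F (of_real r * z)) (L z))"
          by (intro continuous_intros continuous_on_compose2[OF F]) (use z in \<open>auto simp: norm_mult\<close>)
        then have "isCont (\<lambda>r. dist (F (of_real r * z)) (L z)) r"
          using r01 continuous_on_eq_continuous_at[OF open_greaterThanLessThan] by blast
        ultimately have "\<forall>\<^sub>F s in at_right r. 1 / real (Suc e) < dist (F (of_real s * z)) (L z)"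
          by (intro order_tendstoD(1)[where y = "dist (F (of_real r * z)) (L z)"])
            (auto simp: isCont_def intro: filterlim_mono[OF _ order_refl at_le])
        then obtain b where b: "r < b" "\<And>s. r < s \<Longrightarrow> s < b \<Longrightarrow> 1 / real (Suc e) < dist (F (of_real s * z)) (L z)"
          unfolding eventually_at_right_field by blast
        obtain s where s: "s \<in> \<rat>" "r < s" "s < min b 1"
          using Rats_dense_in_real[of r "min b 1"] b(1) r by auto
        then have "dist (F (of_real s * z)) (L z) \<le> 1 / real (Suc e)"
          using r by (intro N) auto
        then show False using b(2)[of s] s by auto
      qed
      then show "\<forall>\<^sub>F r in at_left 1. dist (F (of_real r * z)) (L z) < \<epsilon>"
      proof (rule eventually_at_leftI)
        have "0 < 1 / real (Suc N)" by simp
        then show "max 0 (1 - 1 / real (Suc N)) < 1"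
          unfolding max_less_iff_conj by argo
      qed
    qed
    then show "\<exists>l. radial_limit F z l" by blast
  qed
  have "Measurable.pred M P"
    unfolding P_def
  proof (intro pred_intros_countable pred_intros_imp')
    fix e N :: nat and x :: rat assume x: "of_rat x \<in> {max 0 (1 - 1 / real (Suc N))<..<1}"
    have "0 < (of_rat x :: real)" "of_rat x < (1 :: real)"
      using x by (simp_all only: greaterThanLessThan_iff max_less_iff_conj)
    then have [measurable]: "(\<lambda>z. F (of_real (of_rat x) * z)) \<in> borel_measurable M"
      by (rule Fr)
    show "Measurable.pred M (\<lambda>z. dist (F (of_real (of_rat x) * z)) (L z) \<le> 1 / real (Suc e))"
      by measurable
  qed
  then have m: "(\<lambda>z. if P z then L z else 0) \<in> borel_measurable M"
    by measurable
  have "bv F z = (if P z then L z else 0)" if "z \<in> space M" for z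
  proof -
    have z: "z \<in> circle" "z \<notin> disk" using that by (auto simp: sp)
    show ?thesis
    proof (cases "P z")
      case True
      then obtain l where l: "radial_limit F z l" using P_iff[OF z(1)] by blast
      have "(THE l. radial_limit F z l) = L z"
        using l L_eq by (intro the_equality) auto
      moreover have "has_bv F z" using l z by (auto simp: has_bv_def)
      ultimately show ?thesis using True z by (simp add: bv_def)
    next
      case False
      then have "\<not> has_bv F z" using P_iff[OF z(1)] z by (auto simp: has_bv_def)
      then show ?thesis using False z by (simp add: bv_def)
    qed
  qed
  then show ?thesis
    using m unfolding S M_def[symmetric] by (subst measurable_cong) auto
qed

text \<open>Bounds pass to radial limits; B \<ge> 0 accounts for points without one, where
  \<open>bv\<close> has the default value 0.\<close>

lemma bv_norm_le:
  assumes le: "\<And>z. z \<in> disk \<Longrightarrow> norm (F z) \<le> B" and B: "0 \<le> B"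
  shows "norm (bv F w) \<le> B"
proof (cases "has_bv F w \<and> w \<notin> disk")
  case True
  then obtain l where w: "w \<in> circle" and l: "radial_limit F w l"
    by (auto simp: has_bv_def)
  have uniq: "l' = l" if "radial_limit F w l'" for l'
    using l that unfolding radial_limit_def by (intro tendsto_unique[of "at_left (1::real)"]) auto
  have "norm l \<le> B"
  proof (rule tendsto_upperbound)
    show "((\<lambda>r. norm (F (of_real r * w))) \<longlongrightarrow> norm l) (at_left (1::real))"
      using l unfolding radial_limit_def by (rule tendsto_norm)
    show "\<forall>\<^sub>F r in at_left (1::real). norm (F (of_real r * w)) \<le> B"
      by (rule eventually_at_leftI[of 0]) (use w in \<open>auto intro!: le simp: norm_mult\<close>)
  qed simp
  moreover have "(THE l. radial_limit F w l) = l"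
    using l uniq by blast
  ultimately show ?thesis using True by (simp add: bv_def)
qed (use le B in \<open>auto simp: bv_def\<close>)

text \<open>A value exceeding the supremum over A would do so on a nonempty open subset of the disk,
  which A meets.\<close>

lemma SUP_dense:
  fixes v :: "complex \<Rightarrow> real"
  assumes v: "continuous_on disk v" and A: "\<And>X. open X \<Longrightarrow> X \<noteq> {} \<Longrightarrow> \<exists>d\<in>A. d \<in> X"
  shows "(SUP a\<in>disk. ennreal (v a)) = (SUP a\<in>A \<inter> disk. ennreal (v a))"
proof (rule antisym)
  show "(SUP a\<in>disk. ennreal (v a)) \<le> (SUP a\<in>A \<inter> disk. ennreal (v a))"
  proof (rule SUP_least, rule ccontr)
    fix a assume a: "a \<in> disk" and "\<not> ennreal (v a) \<le> (SUP a\<in>A \<inter> disk. ennreal (v a))"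
    then have lt: "(SUP a\<in>A \<inter> disk. ennreal (v a)) < ennreal (v a)" by simp
    then obtain s where s: "(SUP a\<in>A \<inter> disk. ennreal (v a)) = ennreal s" "0 \<le> s"
      by (cases "SUP a\<in>A \<inter> disk. ennreal (v a)") auto
    have "s < v a" using lt s by (simp add: ennreal_less_iff)
    have "open (disk \<inter> v -` {s<..})"
      using v by (rule continuous_open_preimage) auto
    moreover have "disk \<inter> v -` {s<..} \<noteq> {}" using a \<open>s < v a\<close> by blast
    ultimately obtain d where d: "d \<in> A" "d \<in> disk" "s < v d" using A by blast
    then have "ennreal (v d) \<le> (SUP a\<in>A \<inter> disk. ennreal (v a))" by (intro SUP_upper) auto
    then show False using d s by (simp add: ennreal_le_iff)
  qed
  show "(SUP a\<in>A \<inter> disk. ennreal (v a)) \<le> (SUP a\<in>disk. ennreal (v a))"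
    by (rule SUP_subset_mono) auto
qed

text \<open>Uniformly in a, |1 - cnj a * w| \<ge> (1 - |w|^2) / 2. This turns
  \<open>ptest_bound\<close> into the weights of Q_k at the cost of a power of 2.\<close>

lemma test_le_Q_val:
  assumes \<gamma>: "0 \<le> \<gamma>"
  obtains C where "0 < C" "\<And>c w j a. norm w \<le> 1 \<Longrightarrow> norm a < 1 \<Longrightarrow> j \<le> n \<Longrightarrow>
    ennreal (norm (\<Sum>k\<le>n. c k * ptest \<gamma> j k a w)) \<le> ennreal C * (\<Sum>k\<le>n. Q_val \<gamma> c w k)"
proof -
  obtain C where C: "0 < C" "\<And>j k a z. j \<le> n \<Longrightarrow> k \<le> n \<Longrightarrow> norm a < 1 \<Longrightarrow> norm z \<le> 1 \<Longrightarrow>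
    norm (ptest \<gamma> j k a z) \<le> C * norm (1 - cnj a * z) powr - (real k + \<gamma>)"
    by (rule ptest_bound_uniform[OF \<gamma>, of n]) blast
  define C' where "C' = C * 2 powr (real n + \<gamma>)"
  have C': "0 < C'" "C \<le> C'"
    using C(1) \<gamma> ge_one_powr_ge_zero[of 2 "real n + \<gamma>"] by (auto simp: C'_def mult_le_cancel_left1)
  show thesis
  proof (rule that[OF C'(1)])
    fix c and w a :: complex and j
    assume w: "norm w \<le> 1" and a: "norm a < 1" and j: "j \<le> n"
    show "ennreal (norm (\<Sum>k\<le>n. c k * ptest \<gamma> j k a w)) \<le> ennreal C' * (\<Sum>k\<le>n. Q_val \<gamma> c w k)"
    proof (rule sum_le_Q_val[OF \<gamma> w C'(1)])
      fix k assume w1: "norm w < 1" and k: "k \<le> n"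
      define d e where "d = 1 - (norm w)\<^sup>2" and "e = real k + \<gamma>"
      have d: "0 < d" using one_minus_norm_bounds(1)[OF w1] by (simp add: d_def)
      have e: "0 \<le> e" "e \<le> real n + \<gamma>" using k \<gamma> by (auto simp: e_def)
      have "d / 2 \<le> norm (1 - cnj a * w)"
        using one_minus_norm_sq_le(2)[OF a w] unfolding d_def by argo
      then have "norm (1 - cnj a * w) powr - e \<le> (d / 2) powr - e"
        using d e by (intro powr_mono2') auto
      also have "\<dots> = 2 powr e * d powr - e"
        by (simp only: powr_divide powr_minus_divide) simp
      also have "\<dots> \<le> 2 powr (real n + \<gamma>) * d powr - e"
        using e by (intro mult_right_mono powr_mono) auto
      finally have "C * norm (1 - cnj a * w) powr - e \<le> C * (2 powr (real n + \<gamma>) * d powr - e)"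
        using C(1) by (intro mult_left_mono) auto
      then show "norm (ptest \<gamma> j k a w) \<le> C' * (1 - (norm w)\<^sup>2) powr - (real k + \<gamma>)"
        using C(2)[OF j k a w] by (simp add: C'_def d_def e_def)
    next
      assume "\<gamma> = 0"
      then have "norm (ptest \<gamma> j 0 a w) \<le> C"
        using C(2)[OF j _ a w, of 0] one_minus_norm_sq_le(3)[OF a w] by simp
      then show "norm (ptest \<gamma> j 0 a w) \<le> C'" using C' by simp
    qed
  qed
qed

lemma bv_in_cball:
  assumes "\<tau> ` disk \<subseteq> disk"
  shows "norm (bv \<tau> z) \<le> 1"
  by (rule bv_norm_le) (use assms in \<open>force simp: image_subset_iff\<close>)+

subsection \<open>The equivalences\<close>

locale composition_data =
  fixes n :: nat and u :: "nat \<Rightarrow> complex \<Rightarrow> complex" and \<tau> :: "complex \<Rightarrow> complex"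
    and q :: real and \<mu> :: "complex measure"
  assumes u_hol: "\<And>k. k \<le> n \<Longrightarrow> u k holomorphic_on disk"
    and tau_hol: "\<tau> holomorphic_on disk"
    and tau_self: "\<tau> ` disk \<subseteq> disk"
    and q_pos: "0 < q"
    and mu: "sets \<mu> = sets (restrict_space borel disk) \<or> sets \<mu> = sets (restrict_space borel circle)"
begin

abbreviation "c z k \<equiv> bv (u k) z"
abbreviation "w z \<equiv> bv \<tau> z"

lemma w_le: "norm (w z) \<le> 1"
  by (rule bv_in_cball[OF tau_self])

section \<open>Measurability of the functions in the five conditions\<close>

lemma measurable_bv_mu:
  assumes "F holomorphic_on disk"
  shows "bv F \<in> borel_measurable \<mu>"
proof -
  obtain S where S: "S = disk \<or> S = circle" and sets: "sets \<mu> = sets (restrict_space borel S)"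
    using mu by blast
  have "bv F \<in> borel_measurable (restrict_space borel S)"
    by (rule measurable_bv[OF holomorphic_on_imp_continuous_on[OF assms] S])
  then show ?thesis
    using measurable_cong_sets[OF sets refl] by blast
qed

lemma measurable_c: "k \<le> n \<Longrightarrow> (\<lambda>z. c z k) \<in> borel_measurable \<mu>"
  using measurable_bv_mu[OF u_hol] by simp

lemma measurable_w [measurable]: "w \<in> borel_measurable \<mu>"
  by (rule measurable_bv_mu[OF tau_hol])

lemma measurable_comp_w:
  assumes "continuous_on (cball 0 1) G"
  shows "(\<lambda>z. G (w z)) \<in> borel_measurable \<mu>"
proof -
  have 1: "w \<in> measurable \<mu> (restrict_space borel (cball 0 1))"
    by (rule measurable_restrict_space2) (auto simp: w_le)
  have 2: "G \<in> borel_measurable (restrict_space borel (cball 0 1))"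
    by (rule borel_measurable_continuous_on_restrict[OF assms])
  show ?thesis by (rule measurable_compose[OF 1 2])
qed

lemma measurable_combination:
  assumes "\<And>k. k \<le> n \<Longrightarrow> continuous_on (cball 0 1) (G k)"
  shows "(\<lambda>z. ennreal (r * norm (\<Sum>k\<le>n. c z k * G k (w z)))) \<in> borel_measurable \<mu>"
proof -
  have "(\<lambda>z. \<Sum>k\<le>n. c z k * G k (w z)) \<in> borel_measurable \<mu>"
    using assms by (intro borel_measurable_sum borel_measurable_times measurable_c measurable_comp_w) auto
  then show ?thesis by measurable
qed

lemma Q_fun_eq: "Q_fun \<gamma> u \<tau> k z = Q_val \<gamma> (c z) (w z) k"
  by (simp add: Q_fun_def Q_val_def)

lemma measurable_Q:
  assumes "k \<le> n"
  shows "Q_fun \<gamma> u \<tau> k \<in> borel_measurable \<mu>"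
proof -
  have [measurable]: "bv (u k) \<in> borel_measurable \<mu>"
    using measurable_c[OF assms] .
  have "(\<lambda>z. ennreal (norm (bv (u k) z)) /
     (if real k + \<gamma> = 0 then 1 else ennreal ((1 - (norm (w z))\<^sup>2) powr (real k + \<gamma>)))) \<in> borel_measurable \<mu>"
    by measurable
  also have "(\<lambda>z. ennreal (norm (bv (u k) z)) /
     (if real k + \<gamma> = 0 then 1 else ennreal ((1 - (norm (w z))\<^sup>2) powr (real k + \<gamma>)))) = Q_fun \<gamma> u \<tau> k"
    by (rule ext) (simp add: Q_fun_def)
  finally show ?thesis .
qed

lemma test_sup_eq:
  "test_sup \<gamma> n u \<tau> j z = (SUP a\<in>disk. ennreal (norm (\<Sum>k\<le>n. c z k * ptest \<gamma> j k a (w z))))"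
  unfolding test_sup_def S_op_def
  using bv_higher_deriv_ctest[OF _ w_le, where c = 1]
  by (intro SUP_cong refl) simp

lemma continuous_ptest: "norm a < 1 \<Longrightarrow> continuous_on (cball 0 1) (ptest \<gamma> j k a)"
  by (rule DERIV_continuous_on[OF has_field_derivative_at_within[OF ptest_has_derivative[OF test_domain]]]) auto

text \<open>One countable set serves all \<gamma>, j and z, both for the measurability of the
  supremum and for uniting null sets under order boundedness.\<close>

lemma test_sup_countable:
  obtains A where "countable A" "A \<subseteq> disk"
    "\<And>\<gamma> j z. test_sup \<gamma> n u \<tau> j z = (SUP a\<in>A. ennreal (norm (\<Sum>k\<le>n. c z k * ptest \<gamma> j k a (w z))))"
proof -
  obtain B :: "complex set" where B: "countable B" "\<And>X. open X \<Longrightarrow> X \<noteq> {} \<Longrightarrow> \<exists>d\<in>B. d \<in> X"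
    using countable_dense_setE by blast
  show thesis
  proof (rule that[of "B \<inter> disk"])
    fix \<gamma> j z
    have pw: "continuous_on disk (\<lambda>a::complex. (1 - (norm a)\<^sup>2) powr \<gamma>)"
    proof (intro continuous_on_powr continuous_intros ballI)
      fix a :: complex assume "a \<in> disk"
      then show "1 - (norm a)\<^sup>2 \<noteq> 0" using one_minus_norm_bounds(1)[of a] by simp
    qed
    have "continuous_on disk (\<lambda>a. norm (\<Sum>k\<le>n. c z k * ptest \<gamma> j k a (w z)))"
      unfolding ptest_def
      by (intro continuous_on_norm continuous_on_sum continuous_on_mult continuous_on_const continuous_on_of_real continuous_dtest_param w_le pw)
    then show "test_sup \<gamma> n u \<tau> j z = (SUP a\<in>B \<inter> disk. ennreal (norm (\<Sum>k\<le>n. c z k * ptest \<gamma> j k a (w z))))"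
      unfolding test_sup_eq by (rule SUP_dense) (rule B(2))
  qed (use B in auto)
qed

lemma measurable_test_sup: "test_sup \<gamma> n u \<tau> j \<in> borel_measurable \<mu>"
proof -
  obtain A where A: "countable A" "A \<subseteq> disk"
    "\<And>\<gamma> j z. test_sup \<gamma> n u \<tau> j z = (SUP a\<in>A. ennreal (norm (\<Sum>k\<le>n. c z k * ptest \<gamma> j k a (w z))))"
    by (rule test_sup_countable) blast
  have "(\<lambda>z. SUP a\<in>A. ennreal (norm (\<Sum>k\<le>n. c z k * ptest \<gamma> j k a (w z)))) \<in> borel_measurable \<mu>"
  proof (intro borel_measurable_SUP A(1))
    fix a assume "a \<in> A"
    then have "norm a < 1" using A(2) by auto
    then show "(\<lambda>z. ennreal (norm (\<Sum>k\<le>n. c z k * ptest \<gamma> j k a (w z)))) \<in> borel_measurable \<mu>"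
      using measurable_combination[of "\<lambda>k. ptest \<gamma> j k a" 1] continuous_ptest by simp
  qed
  also have "(\<lambda>z. SUP a\<in>A. ennreal (norm (\<Sum>k\<le>n. c z k * ptest \<gamma> j k a (w z)))) = test_sup \<gamma> n u \<tau> j"
    by (rule ext) (rule A(3)[symmetric])
  finally show ?thesis .
qed

lemma monomial_sup_eq:
  "monomial_sup \<gamma> n u \<tau> z = (SUP m. ennreal (mono_weight \<gamma> m * norm (\<Sum>k\<le>n. c z k * dmono k m (w z))))"
  unfolding monomial_sup_def S_op_def mono_weight_def
  by (intro SUP_cong refl) (simp add: bv_higher_deriv_mono w_le)

lemma measurable_monomial_sup: "monomial_sup \<gamma> n u \<tau> \<in> borel_measurable \<mu>"
proof -
  have "continuous_on (cball 0 1) (dmono k m)" for k m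
    by (rule DERIV_continuous_on[OF has_field_derivative_at_within[OF dmono_has_derivative]])
  then have "(\<lambda>z. SUP m. ennreal (mono_weight \<gamma> m * norm (\<Sum>k\<le>n. c z k * dmono k m (w z)))) \<in> borel_measurable \<mu>"
    using measurable_combination[of "\<lambda>k. dmono k m" "mono_weight \<gamma> m" for m]
    by (intro borel_measurable_SUP) auto
  also have "(\<lambda>z. SUP m. ennreal (mono_weight \<gamma> m * norm (\<Sum>k\<le>n. c z k * dmono k m (w z)))) = monomial_sup \<gamma> n u \<tau>"
    by (rule ext) (rule monomial_sup_eq[symmetric])
  finally show ?thesis .
qed

section \<open>Comparison of the integrability conditions\<close>

lemma Lq_sum_iff:
  "in_Lq q \<mu> (\<lambda>z. \<Sum>k\<le>n. Q_fun \<gamma> u \<tau> k z) \<longleftrightarrow> (\<forall>k\<le>n. in_Lq q \<mu> (Q_fun \<gamma> u \<tau> k))"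
proof
  assume *: "in_Lq q \<mu> (\<lambda>z. \<Sum>k\<le>n. Q_fun \<gamma> u \<tau> k z)"
  show "\<forall>k\<le>n. in_Lq q \<mu> (Q_fun \<gamma> u \<tau> k)"
  proof (intro allI impI)
    fix k assume k: "k \<le> n"
    show "in_Lq q \<mu> (Q_fun \<gamma> u \<tau> k)"
    proof (rule in_Lq_dominated[OF * measurable_Q[OF k] _ q_pos, of 1])
      show "AE z in \<mu>. Q_fun \<gamma> u \<tau> k z \<le> ennreal 1 * (\<Sum>k\<le>n. Q_fun \<gamma> u \<tau> k z)"
        using k by (auto intro!: member_le_sum)
    qed simp
  qed
qed (use in_Lq_sum q_pos in blast)

lemma Lq_test_iff:
  assumes \<gamma>: "0 \<le> \<gamma>"
  shows "in_Lq q \<mu> (\<lambda>z. \<Sum>k\<le>n. Q_fun \<gamma> u \<tau> k z) \<longleftrightarrow> (\<forall>j\<le>n. in_Lq q \<mu> (test_sup \<gamma> n u \<tau> j))"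
proof
  assume *: "in_Lq q \<mu> (\<lambda>z. \<Sum>k\<le>n. Q_fun \<gamma> u \<tau> k z)"
  obtain C where C: "0 < C" "\<And>c w j a. norm w \<le> 1 \<Longrightarrow> norm a < 1 \<Longrightarrow> j \<le> n \<Longrightarrow>
    ennreal (norm (\<Sum>k\<le>n. c k * ptest \<gamma> j k a w)) \<le> ennreal C * (\<Sum>k\<le>n. Q_val \<gamma> c w k)"
    by (rule test_le_Q_val[OF \<gamma>, of n]) blast
  show "\<forall>j\<le>n. in_Lq q \<mu> (test_sup \<gamma> n u \<tau> j)"
  proof (intro allI impI)
    fix j assume j: "j \<le> n"
    show "in_Lq q \<mu> (test_sup \<gamma> n u \<tau> j)"
    proof (rule in_Lq_dominated[OF * measurable_test_sup C(1) q_pos], rule AE_I2)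
      fix z
      show "test_sup \<gamma> n u \<tau> j z \<le> ennreal C * (\<Sum>k\<le>n. Q_fun \<gamma> u \<tau> k z)"
        unfolding test_sup_eq Q_fun_eq by (rule SUP_least, rule C(2)[OF w_le _ j]) simp
    qed
  qed
next
  assume *: "\<forall>j\<le>n. in_Lq q \<mu> (test_sup \<gamma> n u \<tau> j)"
  \<comment> \<open>\<open>Q_val_le_test\<close> asks for a single bound M valid for all j; the sum
    of the suprema provides it.\<close>
  have sum: "in_Lq q \<mu> (\<lambda>z. \<Sum>j\<le>n. test_sup \<gamma> n u \<tau> j z)"
    using * q_pos by (intro in_Lq_sum) auto
  obtain K where K: "0 < K" "\<And>c w M k. norm w \<le> 1 \<Longrightarrow>
    (\<And>j a. j \<le> n \<Longrightarrow> norm a < 1 \<Longrightarrow> norm (\<Sum>k\<le>n. c k * ptest \<gamma> j k a w) \<le> M) \<Longrightarrow> k \<le> n \<Longrightarrow>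
    Q_val \<gamma> c w k \<le> ennreal (K * M)"
    by (rule Q_val_le_test[OF \<gamma>, of n]) blast
  have "in_Lq q \<mu> (Q_fun \<gamma> u \<tau> k)" if k: "k \<le> n" for k
  proof (rule in_Lq_dominated[OF sum measurable_Q[OF k] K(1) q_pos], rule AE_I2)
    fix z
    show "Q_fun \<gamma> u \<tau> k z \<le> ennreal K * (\<Sum>j\<le>n. test_sup \<gamma> n u \<tau> j z)"
    proof (cases "\<Sum>j\<le>n. test_sup \<gamma> n u \<tau> j z")
      case (real M)
      have "Q_val \<gamma> (c z) (w z) k \<le> ennreal (K * M)"
      proof (rule K(2)[OF w_le _ k])
        fix j and a :: complex assume j: "j \<le> n" and a: "norm a < 1"
        have "ennreal (norm (\<Sum>k\<le>n. c z k * ptest \<gamma> j k a (w z))) \<le> test_sup \<gamma> n u \<tau> j z"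
          unfolding test_sup_eq using a by (intro SUP_upper) auto
        also have "\<dots> \<le> (\<Sum>j\<le>n. test_sup \<gamma> n u \<tau> j z)"
          using j by (intro member_le_sum) auto
        finally show "norm (\<Sum>k\<le>n. c z k * ptest \<gamma> j k a (w z)) \<le> M"
          using real by (simp add: ennreal_le_iff)
      qed
      then show ?thesis
        using real K(1) by (simp add: Q_fun_eq ennreal_mult)
    next
      case top
      show ?thesis unfolding top using K(1) by (simp add: ennreal_mult_top)
    qed
  qed
  then show "in_Lq q \<mu> (\<lambda>z. \<Sum>k\<le>n. Q_fun \<gamma> u \<tau> k z)"
    using Lq_sum_iff by blast
qed

lemma Lq_monomial_iff:
  assumes \<gamma>: "0 \<le> \<gamma>"
  shows "in_Lq q \<mu> (\<lambda>z. \<Sum>k\<le>n. Q_fun \<gamma> u \<tau> k z) \<longleftrightarrow> in_Lq q \<mu> (monomial_sup \<gamma> n u \<tau>)"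
proof
  assume *: "in_Lq q \<mu> (\<lambda>z. \<Sum>k\<le>n. Q_fun \<gamma> u \<tau> k z)"
  obtain C where C: "0 < C" "\<And>k m (w :: complex). k \<le> n \<Longrightarrow> norm w < 1 \<Longrightarrow>
    norm (of_real (mono_weight \<gamma> m) * dmono k m w) \<le> C * (1 - (norm w)\<^sup>2) powr - (real k + \<gamma>)"
    by (rule monomial_deriv_bound[OF \<gamma>, of n]) blast
  \<comment> \<open>On the circle with \<gamma> = 0 the weighted monomials have modulus 1, a case
    outside the interior constant C; C + 1 covers both.\<close>
  have C1: "0 < C + 1" using C(1) by simp
  show "in_Lq q \<mu> (monomial_sup \<gamma> n u \<tau>)"
  proof (rule in_Lq_dominated[OF * measurable_monomial_sup C1 q_pos], rule AE_I2)
    fix z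
    show "monomial_sup \<gamma> n u \<tau> z \<le> ennreal (C + 1) * (\<Sum>k\<le>n. Q_fun \<gamma> u \<tau> k z)"
      unfolding monomial_sup_eq Q_fun_eq
    proof (rule SUP_least)
      fix m
      have "ennreal (norm (\<Sum>k\<le>n. c z k * (of_real (mono_weight \<gamma> m) * dmono k m (w z))))
          \<le> ennreal (C + 1) * (\<Sum>k\<le>n. Q_val \<gamma> (c z) (w z) k)"
      proof (rule sum_le_Q_val[OF \<gamma> w_le C1])
        fix k assume "norm (w z) < 1" "k \<le> n"
        then have "norm (of_real (mono_weight \<gamma> m) * dmono k m (w z)) \<le> C * (1 - (norm (w z))\<^sup>2) powr - (real k + \<gamma>)"
          by (intro C(2))
        also have "\<dots> \<le> (C + 1) * (1 - (norm (w z))\<^sup>2) powr - (real k + \<gamma>)"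
          by (intro mult_right_mono) auto
        finally show "norm (of_real (mono_weight \<gamma> m) * dmono k m (w z)) \<le> (C + 1) * (1 - (norm (w z))\<^sup>2) powr - (real k + \<gamma>)" .
      next
        assume "norm (w z) = 1" "\<gamma> = 0"
        then have "norm (of_real (mono_weight \<gamma> m) * dmono 0 m (w z)) = 1"
          by (simp add: mono_weight_def dmono_def norm_mult norm_power)
        then show "norm (of_real (mono_weight \<gamma> m) * dmono 0 m (w z)) \<le> C + 1"
          using C(1) by simp
      qed
      moreover have "(\<Sum>k\<le>n. c z k * (of_real (mono_weight \<gamma> m) * dmono k m (w z)))
          = of_real (mono_weight \<gamma> m) * (\<Sum>k\<le>n. c z k * dmono k m (w z))"
        by (simp add: sum_distrib_left mult_ac)
      ultimately show "ennreal (mono_weight \<gamma> m * norm (\<Sum>k\<le>n. c z k * dmono k m (w z)))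
          \<le> ennreal (C + 1) * (\<Sum>k\<le>n. Q_val \<gamma> (c z) (w z) k)"
        using mono_weight_pos[of \<gamma> m] by (simp add: norm_mult)
    qed
  qed
next
  assume *: "in_Lq q \<mu> (monomial_sup \<gamma> n u \<tau>)"
  obtain K where K: "0 < K" "\<And>c w M k. norm w \<le> 1 \<Longrightarrow>
    (\<And>m. mono_weight \<gamma> m * norm (\<Sum>k\<le>n. c k * dmono k m w) \<le> M) \<Longrightarrow> k \<le> n \<Longrightarrow>
    Q_val \<gamma> c w k \<le> ennreal (K * M)"
    by (rule Q_val_le_monomial[OF \<gamma>, of n]) blast
  have "in_Lq q \<mu> (Q_fun \<gamma> u \<tau> k)" if k: "k \<le> n" for k
  proof (rule in_Lq_dominated[OF * measurable_Q[OF k] K(1) q_pos], rule AE_I2)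
    fix z
    show "Q_fun \<gamma> u \<tau> k z \<le> ennreal K * monomial_sup \<gamma> n u \<tau> z"
    proof (cases "monomial_sup \<gamma> n u \<tau> z")
      case (real M)
      have "Q_val \<gamma> (c z) (w z) k \<le> ennreal (K * M)"
      proof (rule K(2)[OF w_le _ k])
        fix m
        have "ennreal (mono_weight \<gamma> m * norm (\<Sum>k\<le>n. c z k * dmono k m (w z))) \<le> monomial_sup \<gamma> n u \<tau> z"
          unfolding monomial_sup_eq by (intro SUP_upper) auto
        then show "mono_weight \<gamma> m * norm (\<Sum>k\<le>n. c z k * dmono k m (w z)) \<le> M"
          using real by (simp add: ennreal_le_iff)
      qed
      then show ?thesis
        using real K(1) by (simp add: Q_fun_eq ennreal_mult)
    next
      case top
      show ?thesis unfolding top using K(1) by (simp add: ennreal_mult_top)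
    qed
  qed
  then show "in_Lq q \<mu> (\<lambda>z. \<Sum>k\<le>n. Q_fun \<gamma> u \<tau> k z)"
    using Lq_sum_iff by blast
qed

section \<open>Order boundedness\<close>

lemma order_bounded_imp_test:
  assumes X: "admissible_space X" and ob: "order_bounded X q \<mu> n u \<tau>"
  shows "\<forall>j\<le>n. in_Lq q \<mu> (test_sup (gam X) n u \<tau> j)"
proof (intro allI impI)
  fix j assume "j \<le> n"
  define \<gamma> where "\<gamma> = gam X"
  obtain h where h: "\<And>z. 0 \<le> h z" "in_Lq q \<mu> (\<lambda>z. ennreal (h z))"
    "\<And>f. f \<in> unit_ball X \<Longrightarrow> AE z in \<mu>. S_defined n u \<tau> f z \<and> norm (S_op n u \<tau> f z) \<le> h z"
    using ob unfolding order_bounded_def by blast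
  obtain r where r: "0 < r" "\<And>a j. norm a < 1 \<Longrightarrow>
    (\<lambda>z. of_real r * (test_fun \<gamma> a z * sigma a z ^ j)) \<in> unit_ball X"
    unfolding \<gamma>_def by (rule space_test[OF X]) blast
  obtain A where A: "countable A" "A \<subseteq> disk"
    "\<And>\<gamma> j z. test_sup \<gamma> n u \<tau> j z = (SUP a\<in>A. ennreal (norm (\<Sum>k\<le>n. c z k * ptest \<gamma> j k a (w z))))"
    by (rule test_sup_countable) blast
  \<comment> \<open>The exceptional null set depends on the function, so only countably many
    functions can be treated together.\<close>
  have "AE z in \<mu>. \<forall>a\<in>A. norm (S_op n u \<tau> (\<lambda>z. of_real r * (test_fun \<gamma> a z * sigma a z ^ j)) z) \<le> h z"
  proof (subst AE_ball_countable[OF A(1)], rule ballI)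
    fix a assume "a \<in> A"
    then have "norm a < 1" using A(2) by auto
    from h(3)[OF r(2)[OF this]]
    show "AE z in \<mu>. norm (S_op n u \<tau> (\<lambda>z. of_real r * (test_fun \<gamma> a z * sigma a z ^ j)) z) \<le> h z"
      by eventually_elim blast
  qed
  then have "AE z in \<mu>. test_sup \<gamma> n u \<tau> j z \<le> ennreal (1 / r) * ennreal (h z)"
  proof eventually_elim
    case (elim z)
    show ?case
      unfolding A(3)
    proof (rule SUP_least)
      fix a assume a: "a \<in> A"
      then have a1: "norm a < 1" using A(2) by auto
      have "S_op n u \<tau> (\<lambda>z. of_real r * (test_fun \<gamma> a z * sigma a z ^ j)) z
        = of_real r * (\<Sum>k\<le>n. c z k * ptest \<gamma> j k a (w z))"
        unfolding S_op_def bv_higher_deriv_ctest[OF a1 w_le] by (simp add: sum_distrib_left mult_ac)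
      then have "r * norm (\<Sum>k\<le>n. c z k * ptest \<gamma> j k a (w z)) \<le> h z"
        using elim a r(1) by (auto simp: norm_mult)
      then have "norm (\<Sum>k\<le>n. c z k * ptest \<gamma> j k a (w z)) \<le> 1 / r * h z"
        using r(1) by (simp add: field_simps)
      then have "ennreal (norm (\<Sum>k\<le>n. c z k * ptest \<gamma> j k a (w z))) \<le> ennreal (1 / r * h z)"
        by (rule ennreal_leI)
      also have "\<dots> = ennreal (1 / r) * ennreal (h z)"
        using r(1) h(1) by (intro ennreal_mult) auto
      finally show "ennreal (norm (\<Sum>k\<le>n. c z k * ptest \<gamma> j k a (w z))) \<le> ennreal (1 / r) * ennreal (h z)" .
    qed
  qed
  then show "in_Lq q \<mu> (test_sup (gam X) n u \<tau> j)"
    unfolding \<gamma>_def[symmetric] using r(1) q_pos h(2)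
    by (intro in_Lq_dominated[OF _ measurable_test_sup]) auto
qed

text \<open>The majorant is a multiple of \<Sum> Q_k. Where this sum is finite and |\<tau>(z)| = 1,
  every coefficient with k + \<gamma> > 0 vanishes, so the boundary behaviour of the derivatives
  does not matter. The term k = 0 with \<gamma> = 0 remains; it occurs only for bounded functions
  and is the reason for the last hypothesis.\<close>

lemma Lq_imp_order_bounded:
  assumes X: "admissible_space X" and L: "in_Lq q \<mu> (\<lambda>z. \<Sum>k\<le>n. Q_fun (gam X) u \<tau> k z)"
    and Hinf: "X = Hinf \<Longrightarrow> \<forall>f\<in>carrier_of X. AE z in \<mu>. bv (u 0) z \<noteq> 0 \<longrightarrow> has_bv f (bv \<tau> z)"
  shows "order_bounded X q \<mu> n u \<tau>"
proof -
  define \<gamma> where "\<gamma> = gam X"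
  have \<gamma>: "0 \<le> \<gamma>" unfolding \<gamma>_def by (rule gam_nonneg[OF X])
  have \<gamma>0: "X = Hinf" if "\<gamma> = 0"
    using that X by (cases X) (auto simp: \<gamma>_def admissible_space_def)
  define \<Sigma> where "\<Sigma> = (\<lambda>z. \<Sum>k\<le>n. Q_val \<gamma> (c z) (w z) k)"
  have L': "in_Lq q \<mu> \<Sigma>" using L by (simp add: \<Sigma>_def \<gamma>_def Q_fun_eq)
  then have [measurable]: "\<Sigma> \<in> borel_measurable \<mu>" by (simp add: in_Lq_def)
  obtain A where A: "0 < A" "\<And>f z. f \<in> unit_ball X \<Longrightarrow> z \<in> disk \<Longrightarrow> norm (f z) \<le> A * (1 - (norm z)\<^sup>2) powr - \<gamma>"
    unfolding \<gamma>_def by (rule space_growth[OF X]) blast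
  obtain K where K: "0 < K" "\<And>f A k w. f holomorphic_on disk \<Longrightarrow> 0 \<le> A \<Longrightarrow>
    (\<And>z. z \<in> disk \<Longrightarrow> norm (f z) \<le> A * (1 - (norm z)\<^sup>2) powr - \<gamma>) \<Longrightarrow> k \<le> n \<Longrightarrow> w \<in> disk \<Longrightarrow>
    norm ((deriv ^^ k) f w) \<le> K * A * (1 - (norm w)\<^sup>2) powr - (real k + \<gamma>)"
    by (rule growth_higher_deriv[OF \<gamma>, of n]) blast
  \<comment> \<open>K A bounds the derivatives at interior points, A the boundary values of f
    itself.\<close>
  define C where "C = K * A + A"
  have C: "0 < C" "K * A \<le> C" "A \<le> C"
    unfolding C_def using K(1) A(1) by (auto intro: add_pos_pos)
  \<comment> \<open>\<open>enn2real\<close> sends \<infinity> to 0; this affects only a null set,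
    since the sum is finite almost everywhere.\<close>
  define h where "h = (\<lambda>z. C * enn2real (\<Sigma> z))"
  have "AE z in \<mu>. ennreal (h z) \<le> ennreal C * \<Sigma> z"
  proof (rule AE_I2)
    fix z
    have "ennreal (enn2real (\<Sigma> z)) \<le> \<Sigma> z"
      by (cases "\<Sigma> z") auto
    then show "ennreal (h z) \<le> ennreal C * \<Sigma> z"
      using C(1) by (simp add: h_def ennreal_mult mult_left_mono)
  qed
  then have hL: "in_Lq q \<mu> (\<lambda>z. ennreal (h z))"
    by (intro in_Lq_dominated[OF L' _ C(1) q_pos]) (simp_all add: h_def)
  have "AE z in \<mu>. S_defined n u \<tau> f z \<and> norm (S_op n u \<tau> f z) \<le> h z" if f: "f \<in> unit_ball X" for f
  proof -
    have fc: "f \<in> carrier_of X" and hol: "f holomorphic_on disk"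
      using f by (auto simp: unit_ball_def carrier_of_def)
    have "AE z in \<mu>. X = Hinf \<longrightarrow> bv (u 0) z \<noteq> 0 \<longrightarrow> has_bv f (bv \<tau> z)"
      using Hinf fc by (cases "X = Hinf") auto
    moreover have "AE z in \<mu>. \<Sigma> z \<noteq> top" by (rule in_Lq_finite_AE[OF L'])
    ultimately show ?thesis
    proof eventually_elim
      case (elim z)
      have "S_defined n u \<tau> f z"
        unfolding S_defined_def
      proof (intro allI impI)
        fix k assume k: "k \<le> n" "bv (u k) z \<noteq> 0"
        show "has_bv ((deriv ^^ k) f) (bv \<tau> z)"
        proof (cases "norm (w z) < 1")
          case True
          then show ?thesis by (simp add: has_bv_def)
        next
          case False
          then have w1: "norm (w z) = 1" using w_le[of z] by simp
          have "Q_val \<gamma> (c z) (w z) k \<le> \<Sigma> z"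
            unfolding \<Sigma>_def using k by (intro member_le_sum) auto
          then have "Q_val \<gamma> (c z) (w z) k \<noteq> top"
            using elim by (auto simp: top_unique)
          then have "real k + \<gamma> = 0"
            using w1 k by (auto simp: Q_val_circle split: if_splits)
          then have "k = 0" "\<gamma> = 0" using \<gamma> by (auto simp: add_nonneg_eq_0_iff)
          then show ?thesis using elim k \<gamma>0 by simp
        qed
      qed
      moreover have "ennreal (norm (S_op n u \<tau> f z)) \<le> ennreal C * \<Sigma> z"
        unfolding S_op_def \<Sigma>_def
      proof (rule sum_le_Q_val[OF \<gamma> w_le C(1)])
        fix k assume w1: "norm (w z) < 1" and k: "k \<le> n"
        have "norm ((deriv ^^ k) f (w z)) \<le> K * A * (1 - (norm (w z))\<^sup>2) powr - (real k + \<gamma>)"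
          using A f w1 k by (intro K(2)[OF hol]) auto
        also have "\<dots> \<le> C * (1 - (norm (w z))\<^sup>2) powr - (real k + \<gamma>)"
          using C(2) by (rule mult_right_mono) simp
        finally show "norm (bv ((deriv ^^ k) f) (w z)) \<le> C * (1 - (norm (w z))\<^sup>2) powr - (real k + \<gamma>)"
          using w1 by (simp add: bv_def)
      next
        assume "\<gamma> = 0"
        have "norm (f z) \<le> A" if "z \<in> disk" for z
          using A(2)[OF f that] \<open>\<gamma> = 0\<close> A(1) one_minus_norm_bounds(1)[of z] that by simp
        then have "norm (bv f (w z)) \<le> A"
          using A(1) by (intro bv_norm_le) auto
        then show "norm (bv ((deriv ^^ 0) f) (w z)) \<le> C"
          using C(3) by simp
      qed
      then have "ennreal (norm (S_op n u \<tau> f z)) \<le> ennreal (h z)"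
        using elim C(1) by (cases "\<Sigma> z") (auto simp: h_def ennreal_mult)
      then have "norm (S_op n u \<tau> f z) \<le> h z"
        using C(1) by (simp add: ennreal_le_iff h_def)
      ultimately show ?case by blast
    qed
  qed
  moreover have "\<forall>z. 0 \<le> h z" "h \<in> borel_measurable \<mu>"
    using C(1) by (auto simp: h_def)
  ultimately show ?thesis
    unfolding order_bounded_def using hL by blast
qed

text \<open>Closes the cycle: order boundedness controls the test suprema, these control \<Sum> Q_k,
  and \<Sum> Q_k supplies the majorant.\<close>

lemma order_bounded_iff:
  assumes X: "admissible_space X"
    and Hinf: "X = Hinf \<Longrightarrow> \<forall>f\<in>carrier_of X. AE z in \<mu>. bv (u 0) z \<noteq> 0 \<longrightarrow> has_bv f (bv \<tau> z)"
  shows "order_bounded X q \<mu> n u \<tau> \<longleftrightarrow> in_Lq q \<mu> (\<lambda>z. \<Sum>k\<le>n. Q_fun (gam X) u \<tau> k z)"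
  using order_bounded_imp_test[OF X] Lq_imp_order_bounded[OF X _ Hinf] Lq_test_iff[OF gam_nonneg[OF X]] by blast

end

theorem theorem3:
  fixes n :: nat and u :: "nat \<Rightarrow> complex \<Rightarrow> complex" and \<tau> :: "complex \<Rightarrow> complex"
    and q :: real and \<mu> :: "complex measure"
  assumes u_hol: "\<And>k. k \<le> n \<Longrightarrow> u k holomorphic_on disk"
    and tau_hol: "\<tau> holomorphic_on disk"
    and tau_self: "\<tau> ` disk \<subseteq> disk"
    and q_pos: "0 < q"
    and mu: "sets \<mu> = sets (restrict_space borel disk) \<or>
             sets \<mu> = sets (restrict_space borel circle)"
    \<comment> \<open>automatic for a measure on the disk\<close>
    and bvs: "AE z in \<mu>. has_bv \<tau> z \<and> (\<forall>k\<le>n. has_bv (u k) z)"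
  shows
    "(\<forall>X. X = Hinf \<or> (\<exists>\<alpha>>0. X = Growth \<alpha>) \<longrightarrow>
        \<comment> \<open>automatic for a measure on the disk\<close>
        (X = Hinf \<longrightarrow> (\<forall>f\<in>carrier_of X. AE z in \<mu>. bv (u 0) z \<noteq> 0 \<longrightarrow> has_bv f (bv \<tau> z))) \<longrightarrow>
        (order_bounded X q \<mu> n u \<tau> \<longleftrightarrow> in_Lq q \<mu> (\<lambda>z. \<Sum>k\<le>n. Q_fun (gam X) u \<tau> k z)) \<and>
        (order_bounded X q \<mu> n u \<tau> \<longleftrightarrow> (\<forall>k\<le>n. in_Lq q \<mu> (Q_fun (gam X) u \<tau> k))) \<and>
        (order_bounded X q \<mu> n u \<tau> \<longleftrightarrow> (\<forall>k\<le>n. in_Lq q \<mu> (test_sup (gam X) n u \<tau> k))) \<and>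
        (order_bounded X q \<mu> n u \<tau> \<longleftrightarrow> in_Lq q \<mu> (monomial_sup (gam X) n u \<tau>))) \<and>
     (\<forall>X. (\<exists>p>0. \<exists>\<alpha>>-1. X = Bergman p \<alpha>) \<or> (\<exists>p>0. X = Hardy p) \<longrightarrow>
        (order_bounded X q \<mu> n u \<tau> \<longleftrightarrow> in_Lq q \<mu> (\<lambda>z. \<Sum>k\<le>n. Q_fun (gam X) u \<tau> k z)) \<and>
        (order_bounded X q \<mu> n u \<tau> \<longleftrightarrow> (\<forall>k\<le>n. in_Lq q \<mu> (Q_fun (gam X) u \<tau> k))) \<and>
        (order_bounded X q \<mu> n u \<tau> \<longleftrightarrow> (\<forall>k\<le>n. in_Lq q \<mu> (test_sup (gam X) n u \<tau> k))))"
proof -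
  interpret composition_data n u \<tau> q \<mu>
    using u_hol tau_hol tau_self q_pos mu by unfold_locales
  let ?O = "\<lambda>X. order_bounded X q \<mu> n u \<tau>"
  let ?P = "\<lambda>X. (?O X \<longleftrightarrow> in_Lq q \<mu> (\<lambda>z. \<Sum>k\<le>n. Q_fun (gam X) u \<tau> k z)) \<and>
    (?O X \<longleftrightarrow> (\<forall>k\<le>n. in_Lq q \<mu> (Q_fun (gam X) u \<tau> k))) \<and>
    (?O X \<longleftrightarrow> (\<forall>k\<le>n. in_Lq q \<mu> (test_sup (gam X) n u \<tau> k)))"
  \<comment> \<open>The integrability conditions depend on X only through \<open>gam X\<close>, so
    one statement for all admissible spaces serves both parts.\<close>
  have equiv: "?P X" "?O X \<longleftrightarrow> in_Lq q \<mu> (monomial_sup (gam X) n u \<tau>)"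
    if X: "admissible_space X"
      and Hinf: "X = Hinf \<Longrightarrow> \<forall>f\<in>carrier_of X. AE z in \<mu>. bv (u 0) z \<noteq> 0 \<longrightarrow> has_bv f (bv \<tau> z)" for X
    using order_bounded_iff[OF X Hinf] Lq_sum_iff[of "gam X"]
      Lq_test_iff[OF gam_nonneg[OF X]] Lq_monomial_iff[OF gam_nonneg[OF X]]
    by blast+
  have A: "?P X \<and> (?O X \<longleftrightarrow> in_Lq q \<mu> (monomial_sup (gam X) n u \<tau>))"
    if "X = Hinf \<or> (\<exists>\<alpha>>0. X = Growth \<alpha>)"
      and Hinf: "X = Hinf \<longrightarrow> (\<forall>f\<in>carrier_of X. AE z in \<mu>. bv (u 0) z \<noteq> 0 \<longrightarrow> has_bv f (bv \<tau> z))" for X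
  proof -
    have X: "admissible_space X" using that(1) by (auto simp: admissible_space_def)
    show ?thesis by (intro conjI equiv[OF X]) (use Hinf in blast)+
  qed
  have B: "?P X" if "(\<exists>p>0. \<exists>\<alpha>>-1. X = Bergman p \<alpha>) \<or> (\<exists>p>0. X = Hardy p)" for X
  proof (rule equiv(1))
    show "admissible_space X" using that by (auto simp: admissible_space_def)
  qed (use that in auto)
  show ?thesis
    using A B by (simp only: conj_assoc) blast
qed

end
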